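(* Let $G$ be a locally compact Hausdorff étale groupoid. Then the following are equivalent: (1) $G$ is inner exact and satisfies the residual intersection property. (2) The map $I\mapsto U_I$, where $$U_I=\bigcup_{f\in I\cap C_0(G^{(0)})} f^{-1}(\mathbb{C}\setminus\{0\}),$$ gives rise to a one-to-one correspondence between the closed two-sided ideals of $C_r^*(G)$ and the open invariant subsets of $G^{(0)}$.
   Context: A locally compact groupoid is a groupoid $G$ with a locally compact Hausdorff topology for which product and inversion are continuous; $G^{(0)}$ is its unit space, $r(g)=gg^{-1}$ and $d(g)=g^{-1}g$ its range and domain maps. $G$ is étale if $r$ and $d$ are local homeomorphisms (equivalently, it has a basis of open bisections); then $G^{(0)}$ is clopen in $G$. A subset $D\subseteq G^{(0)}$ is invariant if $d(g)\in D$ implies $r(g)\in D$ for all $g\in G$; for $D$ invariant, $G_D=\{g\in G: d(g)\in D\}$ is a subgroupoid with unit space $D$, étale if $D$ is open or closed. $C_r^*(G)$ is the completion of $C_c(G)$, with convolution $(f_1*f_2)(g)=\sum_{h: r(h)=r(g)}f_1(h)f_2(h^{-1}g)$ and involution $f^*(g)=\overline{f(g^{-1})}$, in the norm $\|f\|_r=\sup_{u\in G^{(0)}}\|\pi_u(f)\|$, where $\pi_u(f)\xi=f*\xi$ on $\ell^2(d^{-1}(u))$. Extension by zero gives an embedding $C_0(G^{(0)})\subseteq C_r^*(G)$. Ideals are closed and two-sided; for an ideal $I$ of $C_r^*(G)$ the set $U_I$ is an open invariant subset of $G^{(0)}$. $G$ is inner exact if for every closed invariant $D\subseteq G^{(0)}$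 the sequence $0\to C_r^*(G_{G^{(0)}\setminus D})\to C_r^*(G)\to C_r^*(G_D)\to 0$ is exact (first map induced by extension by zero, second by restriction of functions). $G$ has the intersection property if $I\cap C_0(G^{(0)})\neq\{0\}$ for every non-zero ideal $I\subseteq C_r^*(G)$. $G$ has the residual intersection property if $G_D$ has the intersection property for every closed invariant subset $D\subseteq G^{(0)}$. *)

theory Defs
  imports "HOL-Analysis.Analysis"
begin

section \<open>Topological groupoids\<close>

text \<open>The underlying set of a groupoid is the carrier of its topology.  The operations are total
  functions; their values are only meaningful for arguments in the carrier and, for the product,
  for composable pairs.\<close>

record 'g groupoid =
  gtop :: "'g topology"
  gmult :: "'g \<Rightarrow> 'g \<Rightarrow> 'g"
  ginv :: "'g \<Rightarrow> 'g"

definition gcarrier :: "'g groupoid \<Rightarrow> 'g set" where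
  "gcarrier G = topspace (gtop G)"

definition rng :: "'g groupoid \<Rightarrow> 'g \<Rightarrow> 'g" where
  "rng G g = gmult G g (ginv G g)"

definition dm :: "'g groupoid \<Rightarrow> 'g \<Rightarrow> 'g" where
  "dm G g = gmult G (ginv G g) g"

definition unit_space :: "'g groupoid \<Rightarrow> 'g set" where
  "unit_space G = dm G ` gcarrier G"

definition unit_top :: "'g groupoid \<Rightarrow> 'g topology" where
  "unit_top G = subtopology (gtop G) (unit_space G)"

definition composable :: "'g groupoid \<Rightarrow> ('g \<times> 'g) set" where
  "composable G = {(g, h). g \<in> gcarrier G \<and> h \<in> gcarrier G \<and> dm G g = rng G h}"

definition algebraic_groupoid :: "'g groupoid \<Rightarrow> bool" where
  "algebraic_groupoid G \<longleftrightarrow>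
     (\<forall>g\<in>gcarrier G. ginv G g \<in> gcarrier G \<and> ginv G (ginv G g) = g) \<and>
     (\<forall>(g, h)\<in>composable G. gmult G g h \<in> gcarrier G \<and>
        dm G (gmult G g h) = dm G h \<and> rng G (gmult G g h) = rng G g) \<and>
     (\<forall>g h k. (g, h) \<in> composable G \<and> (h, k) \<in> composable G \<longrightarrow>
        gmult G (gmult G g h) k = gmult G g (gmult G h k)) \<and>
     (\<forall>(g, h)\<in>composable G. gmult G (ginv G g) (gmult G g h) = h \<and>
        gmult G (gmult G g h) (ginv G h) = g)"

definition locally_compact_groupoid :: "'g groupoid \<Rightarrow> bool" where
  "locally_compact_groupoid G \<longleftrightarrow>
     algebraic_groupoid G \<and>
     locally_compact_space (gtop G) \<and>
     Hausdorff_space (gtop G) \<and>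
     continuous_map (subtopology (prod_topology (gtop G) (gtop G)) (composable G)) (gtop G)
       (\<lambda>(g, h). gmult G g h) \<and>
     continuous_map (gtop G) (gtop G) (ginv G)"

definition local_homeomorphism :: "'a topology \<Rightarrow> 'b topology \<Rightarrow> ('a \<Rightarrow> 'b) \<Rightarrow> bool" where
  "local_homeomorphism X Y f \<longleftrightarrow>
     (\<forall>x\<in>topspace X. \<exists>U V. openin X U \<and> x \<in> U \<and> openin Y V \<and>
        homeomorphic_map (subtopology X U) (subtopology Y V) f)"

definition etale :: "'g groupoid \<Rightarrow> bool" where
  "etale G \<longleftrightarrow> local_homeomorphism (gtop G) (unit_top G) (rng G) \<and>
              local_homeomorphism (gtop G) (unit_top G) (dm G)"

definition invariant :: "'g groupoid \<Rightarrow> 'g set \<Rightarrow> bool" where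
  "invariant G D \<longleftrightarrow> D \<subseteq> unit_space G \<and> (\<forall>g\<in>gcarrier G. dm G g \<in> D \<longrightarrow> rng G g \<in> D)"

text \<open>The subgroupoid \<open>G\<^sub>D\<close> for invariant \<open>D\<close>.\<close>

definition restrict_groupoid :: "'g groupoid \<Rightarrow> 'g set \<Rightarrow> 'g groupoid" where
  "restrict_groupoid G D =
     G\<lparr>gtop := subtopology (gtop G) {g \<in> gcarrier G. dm G g \<in> D}\<rparr>"


section \<open>Normed *-algebras over the complex numbers and their completions\<close>

record 'a nalg =
  acarrier :: "'a set"
  azero :: 'a
  aadd :: "'a \<Rightarrow> 'a \<Rightarrow> 'a"
  ascale :: "complex \<Rightarrow> 'a \<Rightarrow> 'a"
  amult :: "'a \<Rightarrow> 'a \<Rightarrow> 'a"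
  astar :: "'a \<Rightarrow> 'a"
  anorm :: "'a \<Rightarrow> real"

definition adist :: "'a nalg \<Rightarrow> 'a \<Rightarrow> 'a \<Rightarrow> real" where
  "adist A x y = anorm A (aadd A x (ascale A (- 1) y))"

definition cauchy_seqs :: "'a nalg \<Rightarrow> (nat \<Rightarrow> 'a) set" where
  "cauchy_seqs A = {s. (\<forall>n. s n \<in> acarrier A) \<and>
     (\<forall>e>0. \<exists>N. \<forall>m\<ge>N. \<forall>n\<ge>N. adist A (s m) (s n) < e)}"

definition null_rel :: "'a nalg \<Rightarrow> ((nat \<Rightarrow> 'a) \<times> (nat \<Rightarrow> 'a)) set" where
  "null_rel A = {(s, t). s \<in> cauchy_seqs A \<and> t \<in> cauchy_seqs A \<and>
     (\<lambda>n. adist A (s n) (t n)) \<longlonglongrightarrow> 0}"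

text \<open>The completion consists of the Cauchy sequences modulo null sequences.\<close>

definition completion :: "'a nalg \<Rightarrow> (nat \<Rightarrow> 'a) set nalg" where
  "completion A =
    \<lparr> acarrier = cauchy_seqs A // null_rel A,
      azero = null_rel A `` {\<lambda>n. azero A},
      aadd = (\<lambda>X Y. \<Union>s\<in>X. \<Union>t\<in>Y. null_rel A `` {\<lambda>n. aadd A (s n) (t n)}),
      ascale = (\<lambda>c X. \<Union>s\<in>X. null_rel A `` {\<lambda>n. ascale A c (s n)}),
      amult = (\<lambda>X Y. \<Union>s\<in>X. \<Union>t\<in>Y. null_rel A `` {\<lambda>n. amult A (s n) (t n)}),
      astar = (\<lambda>X. \<Union>s\<in>X. null_rel A `` {\<lambda>n. astar A (s n)}),
      anorm = (\<lambda>X. THE l. \<exists>s\<in>X. (\<lambda>n. anorm A (s n)) \<longlonglongrightarrow> l) \<rparr>"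

text \<open>The map between completions induced by a bounded linear map \<open>\<phi>\<close> from \<open>A\<close> to \<open>B\<close>.\<close>

definition induced_map ::
    "'a nalg \<Rightarrow> 'b nalg \<Rightarrow> ('a \<Rightarrow> 'b) \<Rightarrow> (nat \<Rightarrow> 'a) set \<Rightarrow> (nat \<Rightarrow> 'b) set" where
  "induced_map A B \<phi> X = (\<Union>s\<in>X. null_rel B `` {\<lambda>n. \<phi> (s n)})"

definition closed_ideal :: "'a nalg \<Rightarrow> 'a set \<Rightarrow> bool" where
  "closed_ideal A I \<longleftrightarrow>
     I \<subseteq> acarrier A \<and> azero A \<in> I \<and>
     (\<forall>x\<in>I. \<forall>y\<in>I. aadd A x y \<in> I) \<and>
     (\<forall>c. \<forall>x\<in>I. ascale A c x \<in> I) \<and>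
     (\<forall>a\<in>acarrier A. \<forall>x\<in>I. amult A a x \<in> I \<and> amult A x a \<in> I) \<and>
     (\<forall>x\<in>acarrier A. (\<forall>e>0. \<exists>y\<in>I. adist A x y < e) \<longrightarrow> x \<in> I)"

definition short_exact ::
    "'a nalg \<Rightarrow> ('a \<Rightarrow> 'b) \<Rightarrow> 'b nalg \<Rightarrow> ('b \<Rightarrow> 'c) \<Rightarrow> 'c nalg \<Rightarrow> bool" where
  "short_exact A \<phi> B \<psi> C \<longleftrightarrow>
     inj_on \<phi> (acarrier A) \<and>
     \<phi> ` acarrier A = {b \<in> acarrier B. \<psi> b = azero C} \<and>
     \<psi> ` acarrier B = acarrier C"


section \<open>The reduced groupoid C*-algebra\<close>

text \<open>Functions on a subset of the groupoid are represented by functions on the whole type which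
  vanish off that subset.\<close>

definition extend0 :: "'g set \<Rightarrow> ('g \<Rightarrow> complex) \<Rightarrow> 'g \<Rightarrow> complex" where
  "extend0 S f = (\<lambda>g. if g \<in> S then f g else 0)"

definition Cc :: "'g groupoid \<Rightarrow> ('g \<Rightarrow> complex) set" where
  "Cc G = {f. (\<forall>g. g \<notin> gcarrier G \<longrightarrow> f g = 0) \<and>
     continuous_map (gtop G) euclidean f \<and>
     compactin (gtop G) (gtop G closure_of {g \<in> gcarrier G. f g \<noteq> 0})}"

definition C0_unit :: "'g groupoid \<Rightarrow> ('g \<Rightarrow> complex) set" where
  "C0_unit G = {f. (\<forall>g. g \<notin> unit_space G \<longrightarrow> f g = 0) \<and>
     continuous_map (unit_top G) euclidean f \<and>
     (\<forall>e>0. compactin (unit_top G) {u \<in> unit_space G. e \<le> cmod (f u)})}"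

definition conv :: "'g groupoid \<Rightarrow> ('g \<Rightarrow> complex) \<Rightarrow> ('g \<Rightarrow> complex) \<Rightarrow> 'g \<Rightarrow> complex" where
  "conv G f1 f2 = extend0 (gcarrier G)
     (\<lambda>g. \<Sum>\<^sub>\<infinity>h\<in>{h \<in> gcarrier G. rng G h = rng G g}. f1 h * f2 (gmult G (ginv G h) g))"

definition involution :: "'g groupoid \<Rightarrow> ('g \<Rightarrow> complex) \<Rightarrow> 'g \<Rightarrow> complex" where
  "involution G f = extend0 (gcarrier G) (\<lambda>g. cnj (f (ginv G g)))"

definition l2 :: "'g set \<Rightarrow> ('g \<Rightarrow> complex) set" where
  "l2 X = {\<xi>. (\<forall>g. g \<notin> X \<longrightarrow> \<xi> g = 0) \<and> (\<lambda>g. (cmod (\<xi> g))\<^sup>2) summable_on X}"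

definition l2_norm :: "'g set \<Rightarrow> ('g \<Rightarrow> complex) \<Rightarrow> real" where
  "l2_norm X \<xi> = sqrt (\<Sum>\<^sub>\<infinity>g\<in>X. (cmod (\<xi> g))\<^sup>2)"

definition dm_fibre :: "'g groupoid \<Rightarrow> 'g \<Rightarrow> 'g set" where
  "dm_fibre G u = {g \<in> gcarrier G. dm G g = u}"

text \<open>The operator norm of \<open>\<pi>\<^sub>u(f)\<close>, the convolution by \<open>f\<close> on \<open>\<ell>\<^sup>2(d\<^sup>-\<^sup>1(u))\<close>.\<close>

definition pi_norm :: "'g groupoid \<Rightarrow> 'g \<Rightarrow> ('g \<Rightarrow> complex) \<Rightarrow> real" where
  "pi_norm G u f = Sup {l2_norm (dm_fibre G u) (conv G f \<xi>) | \<xi>.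
     \<xi> \<in> l2 (dm_fibre G u) \<and> l2_norm (dm_fibre G u) \<xi> \<le> 1}"

text \<open>Both suprema are over bounded sets when \<open>G\<close> is etale and \<open>f\<close> is in \<open>C\<^sub>c(G)\<close> or \<open>C\<^sub>0(G\<^sup>(\<^sup>0\<^sup>))\<close>.  Inserting 0
  matters only for the empty groupoid, since \<open>Sup {}\<close> is unspecified on the reals.\<close>

definition reduced_norm :: "'g groupoid \<Rightarrow> ('g \<Rightarrow> complex) \<Rightarrow> real" where
  "reduced_norm G f = Sup (insert 0 ((\<lambda>u. pi_norm G u f) ` unit_space G))"

definition Cc_alg :: "'g groupoid \<Rightarrow> ('g \<Rightarrow> complex) nalg" where
  "Cc_alg G =
    \<lparr> acarrier = Cc G,
      azero = (\<lambda>g. 0),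
      aadd = (\<lambda>f1 f2 g. f1 g + f2 g),
      ascale = (\<lambda>c f g. c * f g),
      amult = conv G,
      astar = involution G,
      anorm = reduced_norm G \<rparr>"

definition Cr :: "'g groupoid \<Rightarrow> (nat \<Rightarrow> 'g \<Rightarrow> complex) set nalg" where
  "Cr G = completion (Cc_alg G)"

text \<open>The embedding of \<open>C\<^sub>0(G\<^sup>(\<^sup>0\<^sup>))\<close> in the reduced algebra.  An \<open>f \<in> C\<^sub>0(G\<^sup>(\<^sup>0\<^sup>))\<close>, extended by zero, need not have
  compact support, so it is sent to the class of all sequences in \<open>C\<^sub>c(G)\<close> converging to it in the
  reduced norm (given on \<open>f\<close> by the same formula; there it is the supremum norm).  For
  \<open>f \<in> C\<^sub>c(G\<^sup>(\<^sup>0\<^sup>))\<close> this is the class of the constant sequence \<open>f\<close>.\<close>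

definition C0_embed :: "'g groupoid \<Rightarrow> ('g \<Rightarrow> complex) \<Rightarrow> (nat \<Rightarrow> 'g \<Rightarrow> complex) set" where
  "C0_embed G f = {s \<in> cauchy_seqs (Cc_alg G). (\<lambda>n. adist (Cc_alg G) (s n) f) \<longlonglongrightarrow> 0}"


section \<open>Inner exactness, the intersection property, and the sets \<open>U\<^sub>I\<close>\<close>

definition inner_exact :: "'g groupoid \<Rightarrow> bool" where
  "inner_exact G \<longleftrightarrow> (\<forall>D. closedin (unit_top G) D \<and> invariant G D \<longrightarrow>
     (let H = restrict_groupoid G (unit_space G - D); K = restrict_groupoid G D in
       short_exact
         (Cr H) (induced_map (Cc_alg H) (Cc_alg G) (extend0 (gcarrier H)))
         (Cr G) (induced_map (Cc_alg G) (Cc_alg K) (extend0 (gcarrier K)))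
         (Cr K)))"

definition intersection_property :: "'g groupoid \<Rightarrow> bool" where
  "intersection_property G \<longleftrightarrow>
     (\<forall>I. closed_ideal (Cr G) I \<and> I \<noteq> {azero (Cr G)} \<longrightarrow>
        I \<inter> C0_embed G ` C0_unit G \<noteq> {azero (Cr G)})"

definition residual_intersection_property :: "'g groupoid \<Rightarrow> bool" where
  "residual_intersection_property G \<longleftrightarrow>
     (\<forall>D. closedin (unit_top G) D \<and> invariant G D \<longrightarrow>
        intersection_property (restrict_groupoid G D))"

definition ideal_support :: "'g groupoid \<Rightarrow> (nat \<Rightarrow> 'g \<Rightarrow> complex) set set \<Rightarrow> 'g set" where
  "ideal_support G I = (\<Union>f\<in>{f \<in> C0_unit G. C0_embed G f \<in> I}. f -` (UNIV - {0}))"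

end

theory Submission
  imports Defs
begin

text \<open>
  For a closed invariant set \<open>D\<close> with open complement \<open>U\<close>, let \<open>q\<close> be the map from \<open>C\<^sub>r\<^sup>*(G)\<close> to \<open>C\<^sub>r\<^sup>*(G\<^sub>D)\<close> induced
  by restriction and let \<open>J\<close> be the closure of \<open>C\<^sub>c(G\<^sub>U)\<close> in \<open>C\<^sub>r\<^sup>*(G)\<close>.  Three facts hold for every etale
  groupoid.  The ideal \<open>J\<close> is the isometric image of \<open>C\<^sub>r\<^sup>*(G\<^sub>U)\<close>, has support \<open>U\<close> and is contained in every closed
  ideal whose support contains \<open>U\<close> (\<open>induced_extend\<close>, \<open>support_J\<close>, \<open>J_minimal\<close>).  The kernel of \<open>q\<close> also has
  support \<open>U\<close> (\<open>support_kernel\<close>), because a function on the unit space is killed by \<open>q\<close> precisely if it vanishes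
  on \<open>D\<close>.  Finally \<open>q\<close> is surjective, and elements lift with control of the norm (\<open>exact_lift\<close>), so that
  images of closed ideals containing the kernel are closed.  Exactness at \<open>D\<close> therefore means that the kernel
  equals \<open>J\<close> (\<open>short_exact_iff\<close>).

  Suppose first that (1) holds and let \<open>I\<close> be a closed ideal with support \<open>U\<close>.  Then \<open>J\<close>, which is the kernel
  of \<open>q\<close>, lies in \<open>I\<close>, and \<open>q(I)\<close> is a closed ideal.  If it were non-zero it would contain a non-zero function
  on \<open>D\<close>; an extension of that function to the unit space of \<open>G\<close> would lie in \<open>I\<close> without being supported in \<open>U\<close>.
  Hence \<open>I = J\<close> (\<open>ideal_eq_J\<close>), so an ideal is determined by its support, and every \<open>U\<close> occurs.  Conversely,
  if ideals are determined by their supports, the kernel of \<open>q\<close> equals \<open>J\<close>; and if an ideal of \<open>C\<^sub>r\<^sup>*(G\<^sub>D)\<close>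
  meets \<open>C\<^sub>0(D)\<close> trivially, its preimage under \<open>q\<close> has support \<open>U\<close>, is therefore the kernel, and the ideal is zero
  (\<open>intersection_property_K\<close>).

  Surjectivity of \<open>q\<close> is usually deduced from the theorem that *-homomorphisms of C*-algebras have closed range.
  Here a direct argument replaces the functional calculus.  Let \<open>f\<close> have norm at most \<open>\<surd>M\<close> and let its
  restriction to \<open>G\<^sub>D\<close> have norm \<open>c\<close>.  The elements \<open>f (1 - f\<^sup>* f / M)\<^sup>N\<close> have norm at most \<open>\<surd>(M / (2 N + 1))\<close>, since
  \<open>t (1 - t / M)\<^sup>2\<^sup>N\<close> is small on \<open>[0, M]\<close>, whereas on \<open>G\<^sub>D\<close> the spectrum of \<open>f\<^sup>* f\<close> is contained in \<open>[0, c\<^sup>2]\<close>, where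
  \<open>(1 - t / M)\<^sup>N\<close> stays near 1 as long as \<open>N c\<^sup>2 / M\<close> is small.  With \<open>N\<close> close to \<open>M / (2 c\<^sup>2)\<close> this gives an
  element of norm at most \<open>2 c\<close> whose restriction is within \<open>c / 2\<close> of that of \<open>f\<close> (\<open>damp_exists\<close>), and a
  geometric series of such corrections gives exact lifts.

  The norm estimates are made on vectors of finite support.  Functions in \<open>C\<^sub>c(G)\<close> have only finitely many
  non-zero values on each range or domain fibre, so they act on such vectors, and the reduced norm is the
  operator norm of this action (\<open>reduced_norm_eq_onorm\<close>).  Products, adjoints and sums of operators then
  translate into the algebraic identities and norm inequalities of \<open>C\<^sub>c(G)\<close>.
\<close>


section \<open>Finitely supported vectors\<close>

typedef 'g fvec = "{\<xi> :: 'g \<Rightarrow> complex. finite {g. \<xi> g \<noteq> 0}}"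
  morphisms coord Abs_fvec
  by (rule exI[of _ "\<lambda>g. 0"]) simp

lemma finite_coord: "finite {g. coord \<xi> g \<noteq> 0}"
  using coord[of \<xi>] by simp

lemma coord_Abs: "finite {g. \<xi> g \<noteq> 0} \<Longrightarrow> coord (Abs_fvec \<xi>) = \<xi>"
  by (simp add: Abs_fvec_inverse)

lemma fvec_eqI: "(\<And>g. coord \<xi> g = coord \<eta> g) \<Longrightarrow> \<xi> = \<eta>"
  by (metis coord_inject ext)

definition cscale :: "complex \<Rightarrow> 'g fvec \<Rightarrow> 'g fvec" where
  "cscale c \<xi> = Abs_fvec (\<lambda>g. c * coord \<xi> g)"

definition delta :: "'g \<Rightarrow> 'g fvec" where
  "delta u = Abs_fvec (\<lambda>g. if g = u then 1 else 0)"

definition mask :: "'g set \<Rightarrow> 'g fvec \<Rightarrow> 'g fvec" where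
  "mask S \<xi> = Abs_fvec (\<lambda>g. if g \<in> S then coord \<xi> g else 0)"

lemma coord_cscale [simp]: "coord (cscale c \<xi>) g = c * coord \<xi> g"
  unfolding cscale_def
  by (subst coord_Abs) (auto intro: finite_subset[OF _ finite_coord[of \<xi>]])

lemma coord_delta [simp]: "coord (delta u) g = (if g = u then 1 else 0)"
  unfolding delta_def by (subst coord_Abs) auto

lemma coord_mask [simp]: "coord (mask S \<xi>) g = (if g \<in> S then coord \<xi> g else 0)"
  unfolding mask_def
  by (subst coord_Abs) (auto intro: finite_subset[OF _ finite_coord[of \<xi>]])

instantiation fvec :: (type) real_vector
begin

definition zero_fvec :: "'a fvec" where "zero_fvec = Abs_fvec (\<lambda>g. 0)"
definition plus_fvec :: "'a fvec \<Rightarrow> 'a fvec \<Rightarrow> 'a fvec" where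
  "plus_fvec \<xi> \<eta> = Abs_fvec (\<lambda>g. coord \<xi> g + coord \<eta> g)"
definition uminus_fvec :: "'a fvec \<Rightarrow> 'a fvec" where
  "uminus_fvec \<xi> = cscale (- 1) \<xi>"
definition minus_fvec :: "'a fvec \<Rightarrow> 'a fvec \<Rightarrow> 'a fvec" where
  "minus_fvec \<xi> \<eta> = \<xi> + - \<eta>"
definition scaleR_fvec :: "real \<Rightarrow> 'a fvec \<Rightarrow> 'a fvec" where
  "scaleR_fvec r \<xi> = cscale (of_real r) \<xi>"

lemma coord_zero': "coord (0 :: 'a fvec) g = 0"
  unfolding zero_fvec_def by (subst coord_Abs) auto

lemma coord_plus': "coord (\<xi> + \<eta> :: 'a fvec) g = coord \<xi> g + coord \<eta> g"
proof -
  have "{g. coord \<xi> g + coord \<eta> g \<noteq> 0} \<subseteq> {g. coord \<xi> g \<noteq> 0} \<union> {g. coord \<eta> g \<noteq> 0}" by auto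
  then have "finite {g. coord \<xi> g + coord \<eta> g \<noteq> 0}"
    using finite_coord[of \<xi>] finite_coord[of \<eta>] by (meson finite_UnI finite_subset)
  then show ?thesis unfolding plus_fvec_def by (simp add: coord_Abs)
qed

instance
  by standard (rule fvec_eqI, simp add: coord_zero' coord_plus' minus_fvec_def uminus_fvec_def
      scaleR_fvec_def algebra_simps)+

end

lemmas coord_zero [simp] = coord_zero'
lemmas coord_plus [simp] = coord_plus'

lemma coord_minus [simp]: "coord (\<xi> - \<eta>) g = coord \<xi> g - coord \<eta> g"
  by (simp add: minus_fvec_def uminus_fvec_def)

lemma coord_scaleR [simp]: "coord (r *\<^sub>R \<xi>) g = of_real r * coord \<xi> g"
  by (simp add: scaleR_fvec_def)

text \<open>The real part of the usual sesquilinear product makes the vectors a real inner product space, which gives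
  access to Cauchy-Schwarz, to operator norms and to adjoints of complex linear operators alike.\<close>

instantiation fvec :: (type) real_inner
begin

definition inner_fvec :: "'a fvec \<Rightarrow> 'a fvec \<Rightarrow> real" where
  "inner_fvec \<xi> \<eta> = (\<Sum>g | coord \<xi> g \<noteq> 0. Re (coord \<xi> g * cnj (coord \<eta> g)))"
definition norm_fvec :: "'a fvec \<Rightarrow> real" where
  "norm_fvec \<xi> = sqrt (\<xi> \<bullet> \<xi>)"
definition sgn_fvec :: "'a fvec \<Rightarrow> 'a fvec" where
  "sgn_fvec \<xi> = \<xi> /\<^sub>R norm \<xi>"
definition dist_fvec :: "'a fvec \<Rightarrow> 'a fvec \<Rightarrow> real" where
  "dist_fvec \<xi> \<eta> = norm (\<xi> - \<eta>)"
definition uniformity_fvec :: "('a fvec \<times> 'a fvec) filter" where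
  "uniformity_fvec = (INF e\<in>{0<..}. principal {(x, y). dist x y < e})"
definition open_fvec :: "'a fvec set \<Rightarrow> bool" where
  "open_fvec U = (\<forall>x\<in>U. eventually (\<lambda>(x', y). x' = x \<longrightarrow> y \<in> U) uniformity)"

lemma inner_superset':
  assumes "finite S" "\<And>g. g \<notin> S \<Longrightarrow> coord \<xi> g = 0 \<or> coord \<eta> g = 0"
  shows "(\<xi> :: 'a fvec) \<bullet> \<eta> = (\<Sum>g\<in>S. Re (coord \<xi> g * cnj (coord \<eta> g)))"
proof -
  have "\<xi> \<bullet> \<eta> = (\<Sum>g\<in>{g. coord \<xi> g \<noteq> 0} \<union> S. Re (coord \<xi> g * cnj (coord \<eta> g)))"
    unfolding inner_fvec_def
    by (rule sum.mono_neutral_left) (use finite_coord[of \<xi>] assms in auto)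
  also have "\<dots> = (\<Sum>g\<in>S. Re (coord \<xi> g * cnj (coord \<eta> g)))"
    by (rule sum.mono_neutral_right) (use finite_coord[of \<xi>] assms in fastforce)+
  finally show ?thesis .
qed

instance
proof
  fix x y z :: "'a fvec" and r s :: real
  show "sgn x = x /\<^sub>R norm x" by (rule sgn_fvec_def)
  show "dist x y = norm (x - y)" by (rule dist_fvec_def)
  show "uniformity = (INF e\<in>{0<..}. principal {(x, y). dist x (y :: 'a fvec) < e})"
    by (rule uniformity_fvec_def)
  show "open U = (\<forall>x\<in>U. eventually (\<lambda>(x', y). x' = x \<longrightarrow> y \<in> U) uniformity)" for U :: "'a fvec set"
    by (rule open_fvec_def)
  define S where "S = {g. coord x g \<noteq> 0} \<union> {g. coord y g \<noteq> 0} \<union> {g. coord z g \<noteq> 0}"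
  have fS: "finite S" unfolding S_def using finite_coord by auto
  have ip: "a \<bullet> b = (\<Sum>g\<in>S. Re (coord a g * cnj (coord b g)))"
    if "\<And>g. g \<notin> S \<Longrightarrow> coord a g = 0 \<or> coord b g = 0" for a b :: "'a fvec"
    using inner_superset'[OF fS that] .
  show "x \<bullet> y = y \<bullet> x"
    by (subst (1 2) ip) (auto simp: S_def algebra_simps intro!: sum.cong)
  show "(x + y) \<bullet> z = x \<bullet> z + y \<bullet> z"
    by (subst (1 2 3) ip)
      (auto simp: S_def sum.distrib[symmetric] algebra_simps intro!: sum.cong)
  show "(r *\<^sub>R x) \<bullet> y = r * (x \<bullet> y)"
    by (subst (1 2) ip) (auto simp: S_def sum_distrib_left algebra_simps intro!: sum.cong)
  have sq: "x \<bullet> x = (\<Sum>g\<in>S. (cmod (coord x g))\<^sup>2)"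
    by (subst ip) (auto simp: S_def complex_mult_cnj cmod_def intro!: sum.cong)
  show "0 \<le> x \<bullet> x" unfolding sq by (simp add: sum_nonneg)
  show "(x \<bullet> x = 0) = (x = 0)"
  proof
    assume "x \<bullet> x = 0"
    then have "\<forall>g\<in>S. (cmod (coord x g))\<^sup>2 = 0" unfolding sq using fS by (simp add: sum_nonneg_eq_0_iff)
    then have "coord x g = 0" if "g \<in> S" for g using that by simp
    moreover have "coord x g = 0" if "g \<notin> S" for g using that by (simp add: S_def)
    ultimately have "coord x g = 0" for g by blast
    then show "x = 0" by (intro fvec_eqI) simp
  next
    assume "x = 0"
    then have "coord x g = 0" for g by simp
    then show "x \<bullet> x = 0" unfolding sq by simp
  qed
  show "norm x = sqrt (x \<bullet> x)" by (rule norm_fvec_def)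
qed

end

lemmas inner_fvec_superset = inner_superset'

lemma norm_fvec_superset:
  assumes "finite S" "\<And>g. g \<notin> S \<Longrightarrow> coord \<xi> g = 0"
  shows "(norm \<xi>)\<^sup>2 = (\<Sum>g\<in>S. (cmod (coord \<xi> g))\<^sup>2)"
proof -
  have "(norm \<xi>)\<^sup>2 = \<xi> \<bullet> \<xi>" by (rule power2_norm_eq_inner)
  also have "\<dots> = (\<Sum>g\<in>S. Re (coord \<xi> g * cnj (coord \<xi> g)))"
    using assms by (intro inner_fvec_superset) auto
  also have "\<dots> = (\<Sum>g\<in>S. (cmod (coord \<xi> g))\<^sup>2)"
    by (simp add: cmod_def power2_eq_square)
  finally show ?thesis .
qed

lemma norm_cscale [simp]: "norm (cscale c \<xi>) = cmod c * norm \<xi>"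
proof -
  have "(norm (cscale c \<xi>))\<^sup>2 = (cmod c * norm \<xi>)\<^sup>2"
    unfolding power_mult_distrib
    by (subst (1 2) norm_fvec_superset[OF finite_coord[of \<xi>]])
      (auto simp: norm_mult power_mult_distrib sum_distrib_left)
  then show ?thesis by (simp add: power2_eq_iff_nonneg)
qed

lemma norm_delta [simp]: "norm (delta u) = 1"
proof -
  have "(norm (delta u))\<^sup>2 = 1\<^sup>2" by (subst norm_fvec_superset[of "{u}"]) auto
  then show ?thesis by (rule power2_eq_imp_eq) simp_all
qed

lemma coord_le_norm: "cmod (coord \<xi> g) \<le> norm \<xi>"
proof -
  have "(cmod (coord \<xi> g))\<^sup>2 \<le> (\<Sum>h\<in>insert g {g. coord \<xi> g \<noteq> 0}. (cmod (coord \<xi> h))\<^sup>2)"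
    by (rule member_le_sum) (simp_all add: finite_coord)
  also have "\<dots> = (norm \<xi>)\<^sup>2"
    by (rule norm_fvec_superset[symmetric]) (simp_all add: finite_coord)
  finally show ?thesis by (simp add: power2_le_iff_abs_le)
qed

lemma norm_mask_le: "norm (mask S \<xi>) \<le> norm \<xi>"
proof -
  have "(norm (mask S \<xi>))\<^sup>2 = (\<Sum>h | coord \<xi> h \<noteq> 0. (cmod (coord (mask S \<xi>) h))\<^sup>2)"
    by (rule norm_fvec_superset) (simp_all add: finite_coord)
  also have "\<dots> \<le> (\<Sum>h | coord \<xi> h \<noteq> 0. (cmod (coord \<xi> h))\<^sup>2)"
    by (rule sum_mono) simp
  also have "\<dots> = (norm \<xi>)\<^sup>2"
    by (rule norm_fvec_superset[symmetric]) (simp_all add: finite_coord)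
  finally show ?thesis by (simp add: power2_le_iff_abs_le)
qed


section \<open>Damping an operator by powers of its modulus\<close>

text \<open>\<open>B\<close> is the adjoint of \<open>A\<close> and \<open>M\<close> bounds the square of the norm of \<open>A\<close>, so that \<open>0 \<le> B A \<le> M\<close> as quadratic
  forms and \<open>S = 1 - B A / M\<close> lies between 0 and 1.\<close>

locale adjoint_pair =
  fixes A B :: "'h::real_inner \<Rightarrow> 'h" and M :: real
  assumes linA: "linear A" and linB: "linear B"
    and adj: "A \<xi> \<bullet> \<eta> = \<xi> \<bullet> B \<eta>"
    and M_pos: "0 < M"
    and boundA: "(norm (A \<xi>))\<^sup>2 \<le> M * (norm \<xi>)\<^sup>2"
begin

definition S where "S \<xi> = \<xi> - (1 / M) *\<^sub>R B (A \<xi>)"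

lemma linear_BA: "linear (\<lambda>\<xi>. B (A \<xi>))"
  using linear_compose[OF linA linB] by (simp add: o_def)

lemma linear_S: "linear S"
  unfolding S_def
  by (intro linear_compose_sub linear_id[unfolded id_def] linear_compose_scale_right linear_BA)

lemma linear_S_pow: "linear (S ^^ k)"
proof (induction k)
  case 0 show ?case by (simp only: funpow.simps linear_id)
next
  case (Suc k) show ?case by (simp only: funpow.simps linear_compose[OF Suc linear_S])
qed

lemma BA_sym: "B (A \<xi>) \<bullet> \<eta> = \<xi> \<bullet> B (A \<eta>)"
  by (metis adj inner_commute)

lemma S_sym: "S \<xi> \<bullet> \<eta> = \<xi> \<bullet> S \<eta>"
  by (simp add: S_def inner_diff_left inner_diff_right BA_sym)

lemma S_pow_sym: "(S ^^ k) \<xi> \<bullet> \<eta> = \<xi> \<bullet> (S ^^ k) \<eta>"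
  by (induction k arbitrary: \<xi> \<eta>) (simp_all add: S_sym funpow_swap1)

lemma BA_inner: "B (A \<xi>) \<bullet> \<eta> = A \<xi> \<bullet> A \<eta>"
  by (metis adj inner_commute)

lemma S_pos: "0 \<le> S \<xi> \<bullet> \<xi>"
proof -
  have "S \<xi> \<bullet> \<xi> = (norm \<xi>)\<^sup>2 - (norm (A \<xi>))\<^sup>2 / M"
    by (simp add: S_def inner_diff_left power2_norm_eq_inner BA_inner)
  moreover have "(norm (A \<xi>))\<^sup>2 / M \<le> (norm \<xi>)\<^sup>2" using boundA[of \<xi>] M_pos by (simp add: field_simps)
  ultimately show ?thesis by simp
qed

text \<open>Splitting an exponent into halves turns it into a square, up to a factor of the positive \<open>S\<close>.\<close>

lemma S_pow_pos: "0 \<le> (S ^^ k) \<xi> \<bullet> \<xi>"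
proof (cases "even k")
  case True
  then obtain j where "k = j + j" by (metis evenE mult_2)
  then have "(S ^^ k) \<xi> \<bullet> \<xi> = (S ^^ j) \<xi> \<bullet> (S ^^ j) \<xi>" by (simp add: funpow_add S_pow_sym)
  then show ?thesis by simp
next
  case False
  then obtain j where "k = Suc (j + j)" by (metis oddE mult_2 Suc_eq_plus1)
  then have "(S ^^ k) \<xi> = (S ^^ j) (S ((S ^^ j) \<xi>))"
    by (simp only: funpow.simps funpow_add o_apply funpow_swap1)
  then have "(S ^^ k) \<xi> \<bullet> \<xi> = S ((S ^^ j) \<xi>) \<bullet> (S ^^ j) \<xi>"
    by (simp add: S_pow_sym)
  then show ?thesis using S_pos by simp
qed

definition moment where "moment \<xi> k = (S ^^ k) \<xi> \<bullet> \<xi>"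

text \<open>The moments \<open>\<langle>S\<^sup>k \<xi>, \<xi>\<rangle>\<close> form a convex sequence because \<open>S\<^sup>k (1 - S)\<^sup>2\<close> is positive.  Its decrements are thus
  decreasing, and the last of \<open>k + 1\<close> decrements is at most their average.\<close>

lemma moment_convex:
  "moment \<xi> (Suc k) - moment \<xi> (Suc (Suc k)) \<le> moment \<xi> k - moment \<xi> (Suc k)"
proof -
  interpret Sk: linear "S ^^ k" by (rule linear_S_pow)
  have e: "(S ^^ k) (S \<xi>) = S ((S ^^ k) \<xi>)" by (simp add: funpow_swap1)
  have e2: "(S ^^ k) (S (S \<xi>)) = S (S ((S ^^ k) \<xi>))" by (simp add: funpow_swap1)
  have "0 \<le> (S ^^ k) (\<xi> - S \<xi>) \<bullet> (\<xi> - S \<xi>)" by (rule S_pow_pos)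
  also have "\<dots> = moment \<xi> k - moment \<xi> (Suc k) - (moment \<xi> (Suc k) - moment \<xi> (Suc (Suc k)))"
    by (simp add: moment_def Sk.diff inner_diff_left inner_diff_right e e2 S_sym)
  finally show ?thesis by simp
qed

lemma moment_le: "real (Suc k) * (moment \<xi> k - moment \<xi> (Suc k)) \<le> moment \<xi> 0 - moment \<xi> (Suc k)"
proof (induction k)
  case (Suc k)
  have "real (Suc k) * (moment \<xi> (Suc k) - moment \<xi> (Suc (Suc k)))
      \<le> real (Suc k) * (moment \<xi> k - moment \<xi> (Suc k))"
    using moment_convex by (intro mult_left_mono) auto
  then show ?case using Suc by (simp add: algebra_simps)
qed simp

text \<open>The square on the left is \<open>M\<close> times the decrement of the moments at \<open>2 N\<close>, which is at most \<open>1 / (2 N + 1)\<close> of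
  the zeroth moment.  This is the bound of \<open>t (1 - t / M)\<^sup>2\<^sup>N\<close> on \<open>[0, M]\<close>.\<close>

lemma damped_bound: "(norm (A ((S ^^ N) \<xi>)))\<^sup>2 \<le> M / real (2 * N + 1) * (norm \<xi>)\<^sup>2"
proof -
  have "(norm (A ((S ^^ N) \<xi>)))\<^sup>2 = (S ^^ N) \<xi> \<bullet> B (A ((S ^^ N) \<xi>))"
    by (simp add: power2_norm_eq_inner adj)
  also have "B (A ((S ^^ N) \<xi>)) = M *\<^sub>R ((S ^^ N) \<xi> - S ((S ^^ N) \<xi>))"
    using M_pos by (simp add: S_def)
  also have "(S ^^ N) \<xi> - S ((S ^^ N) \<xi>) = (S ^^ N) (\<xi> - S \<xi>)"
    by (simp add: linear_diff[OF linear_S_pow] funpow_swap1)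
  also have "(S ^^ N) \<xi> \<bullet> (M *\<^sub>R (S ^^ N) (\<xi> - S \<xi>)) = M * ((S ^^ (N + N)) \<xi> \<bullet> (\<xi> - S \<xi>))"
    by (simp add: S_pow_sym[symmetric] funpow_add)
  also have "(S ^^ (N + N)) \<xi> \<bullet> (\<xi> - S \<xi>) = moment \<xi> (2 * N) - moment \<xi> (Suc (2 * N))"
    by (simp add: moment_def inner_diff_right S_sym mult_2)
  finally have 1: "(norm (A ((S ^^ N) \<xi>)))\<^sup>2 = M * (moment \<xi> (2 * N) - moment \<xi> (Suc (2 * N)))" .
  have "real (Suc (2 * N)) * (moment \<xi> (2 * N) - moment \<xi> (Suc (2 * N))) \<le> moment \<xi> 0"
    using moment_le[of "2 * N" \<xi>] S_pow_pos[of "Suc (2 * N)" \<xi>] by (simp add: moment_def)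
  then have "moment \<xi> (2 * N) - moment \<xi> (Suc (2 * N)) \<le> (norm \<xi>)\<^sup>2 / real (2 * N + 1)"
    by (simp add: moment_def power2_norm_eq_inner field_simps)
  from mult_left_mono[OF this, of M] show ?thesis unfolding 1 using M_pos by simp
qed

lemma norm_B_le:
  assumes "\<And>\<xi>. norm (A \<xi>) \<le> c * norm \<xi>"
  shows "norm (B \<eta>) \<le> c * norm \<eta>"
proof (cases "norm (B \<eta>) = 0")
  case True
  have "0 \<le> c * norm \<eta>" using assms[of \<eta>] norm_ge_zero[of "A \<eta>"] by linarith
  with True show ?thesis by simp
next
  case False
  have "norm (B \<eta>) * norm (B \<eta>) = A (B \<eta>) \<bullet> \<eta>"
    by (simp only: adj power2_norm_eq_inner[symmetric] power2_eq_square[symmetric])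
  also have "\<dots> \<le> norm (A (B \<eta>)) * norm \<eta>" by (rule norm_cauchy_schwarz)
  also have "\<dots> \<le> c * norm (B \<eta>) * norm \<eta>" by (intro mult_right_mono assms) simp
  finally have "norm (B \<eta>) * norm (B \<eta>) \<le> norm (B \<eta>) * (c * norm \<eta>)" by (simp add: ac_simps)
  then show ?thesis using False by simp
qed

lemma norm_S_le: "norm (S \<xi>) \<le> norm \<xi>"
proof -
  have "norm (A \<zeta>) \<le> sqrt M * norm \<zeta>" for \<zeta>
    using real_sqrt_le_mono[OF boundA[of \<zeta>]] by (simp add: real_sqrt_mult)
  then have "norm (B (A \<xi>)) \<le> sqrt M * norm (A \<xi>)" by (rule norm_B_le)
  then have "(norm (B (A \<xi>)))\<^sup>2 \<le> (sqrt M * norm (A \<xi>))\<^sup>2" by (rule power_mono) simp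
  then have 1: "(norm (B (A \<xi>)))\<^sup>2 \<le> M * (norm (A \<xi>))\<^sup>2"
    using M_pos by (simp add: power_mult_distrib)
  have "(norm (S \<xi>))\<^sup>2 = (norm \<xi>)\<^sup>2 - 2 * (norm (A \<xi>))\<^sup>2 / M + (norm (B (A \<xi>)))\<^sup>2 / M\<^sup>2"
  proof -
    have "\<xi> \<bullet> B (A \<xi>) = (norm (A \<xi>))\<^sup>2" by (simp only: adj[symmetric] power2_norm_eq_inner)
    moreover have "(norm (\<xi> - \<eta>))\<^sup>2 = (norm \<xi>)\<^sup>2 - 2 * (\<xi> \<bullet> \<eta>) + (norm \<eta>)\<^sup>2" for \<eta>
      by (simp add: dot_norm_neg field_simps)
    ultimately show ?thesis
      using M_pos by (simp add: S_def power_divide)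
  qed
  also have "\<dots> \<le> (norm \<xi>)\<^sup>2 - (norm (A \<xi>))\<^sup>2 / M"
    using 1 M_pos by (simp add: field_simps power2_eq_square)
  also have "\<dots> \<le> (norm \<xi>)\<^sup>2" using M_pos by simp
  finally show ?thesis by (simp add: power2_le_iff_abs_le)
qed

text \<open>Each factor \<open>S\<close> is a contraction and moves a vector by at most \<open>c\<^sup>2 / M\<close> of its length, so \<open>N\<close> of them
  move it by at most \<open>N c\<^sup>2 / M\<close>.\<close>

lemma damped_residual:
  assumes c: "\<And>\<xi>. norm (A \<xi>) \<le> c * norm \<xi>" and "0 \<le> c"
  shows "norm (A (\<xi> - (S ^^ N) \<xi>)) \<le> real N * c ^ 3 / M * norm \<xi>"
proof -
  have "norm (\<xi> - (S ^^ N) \<xi>) \<le> real N * c\<^sup>2 / M * norm \<xi>"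
  proof (induction N)
    case (Suc N)
    have "\<xi> - (S ^^ Suc N) \<xi> = (1 / M) *\<^sub>R B (A \<xi>) + S (\<xi> - (S ^^ N) \<xi>)"
      by (simp add: linear_diff[OF linear_S]) (simp add: S_def)
    then have "norm (\<xi> - (S ^^ Suc N) \<xi>)
        \<le> norm ((1 / M) *\<^sub>R B (A \<xi>)) + norm (S (\<xi> - (S ^^ N) \<xi>))"
      by (metis norm_triangle_ineq)
    also have "norm (S (\<xi> - (S ^^ N) \<xi>)) \<le> real N * c\<^sup>2 / M * norm \<xi>"
      using norm_S_le Suc by (rule order_trans)
    also have "norm ((1 / M) *\<^sub>R B (A \<xi>)) \<le> c\<^sup>2 / M * norm \<xi>"
    proof -
      have "norm (B (A \<xi>)) \<le> c * (c * norm \<xi>)"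
        using norm_B_le[OF c, of "A \<xi>"] mult_left_mono[OF c[of \<xi>] \<open>0 \<le> c\<close>] by linarith
      then show ?thesis using M_pos by (simp add: field_simps power2_eq_square)
    qed
    finally show ?case using M_pos by (simp add: field_simps)
  qed simp
  then have "c * norm (\<xi> - (S ^^ N) \<xi>) \<le> c * (real N * c\<^sup>2 / M * norm \<xi>)"
    using \<open>0 \<le> c\<close> by (rule mult_left_mono)
  then show ?thesis using c[of "\<xi> - (S ^^ N) \<xi>"] by (simp add: power3_eq_cube power2_eq_square ac_simps)
qed

end


section \<open>Convolution operators\<close>

lemma coord_support: "g \<notin> {g. coord \<xi> g \<noteq> 0} \<Longrightarrow> coord \<xi> g = 0"
  by simp

lemma sum_coord_le_norm:
  assumes "finite T"
  shows "(\<Sum>g\<in>T. (cmod (coord \<xi> g))\<^sup>2) \<le> (norm \<xi>)\<^sup>2"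
proof -
  have "(\<Sum>g\<in>T. (cmod (coord \<xi> g))\<^sup>2) \<le> (\<Sum>g\<in>T \<union> {g. coord \<xi> g \<noteq> 0}. (cmod (coord \<xi> g))\<^sup>2)"
    using assms finite_coord[of \<xi>] by (intro sum_mono2) auto
  also have "\<dots> = (norm \<xi>)\<^sup>2"
    using assms finite_coord[of \<xi>] by (intro norm_fvec_superset[symmetric]) auto
  finally show ?thesis .
qed

definition lconv :: "'g groupoid \<Rightarrow> ('g \<Rightarrow> complex) \<Rightarrow> 'g fvec \<Rightarrow> 'g fvec" where
  "lconv G f \<xi> = Abs_fvec (conv G f (coord \<xi>))"

text \<open>Rows and columns of the matrix of a convolution operator correspond to range and domain fibres.  Finite
  columns let the operator preserve finite support; finite rows make its action on arbitrary vectors,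
  and products with arbitrary functions, finite sums.\<close>

definition row_finite :: "'g groupoid \<Rightarrow> ('g \<Rightarrow> complex) \<Rightarrow> bool" where
  "row_finite G f \<longleftrightarrow> (\<forall>x. finite {h \<in> gcarrier G. rng G h = x \<and> f h \<noteq> 0})"

definition column_finite :: "'g groupoid \<Rightarrow> ('g \<Rightarrow> complex) \<Rightarrow> bool" where
  "column_finite G f \<longleftrightarrow> (\<forall>x. finite {h \<in> gcarrier G. dm G h = x \<and> f h \<noteq> 0})"

definition bounded_functions :: "'g groupoid \<Rightarrow> ('g \<Rightarrow> complex) set" where
  "bounded_functions G = {f. (\<forall>g. g \<notin> gcarrier G \<longrightarrow> f g = 0) \<and> row_finite G f \<and> column_finite G f \<and>
     (\<exists>c. \<forall>\<xi>. norm (lconv G f \<xi>) \<le> c * norm \<xi>)}"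

lemma row_finite_add:
  assumes "row_finite G f1" "row_finite G f2"
  shows "row_finite G (\<lambda>g. f1 g + c * f2 g)"
  unfolding row_finite_def
proof
  fix x
  have "{h \<in> gcarrier G. rng G h = x \<and> f1 h + c * f2 h \<noteq> 0}
     \<subseteq> {h \<in> gcarrier G. rng G h = x \<and> f1 h \<noteq> 0} \<union> {h \<in> gcarrier G. rng G h = x \<and> f2 h \<noteq> 0}" by auto
  then show "finite {h \<in> gcarrier G. rng G h = x \<and> f1 h + c * f2 h \<noteq> 0}"
    using assms unfolding row_finite_def by (meson finite_UnI finite_subset)
qed

lemma column_finite_add:
  assumes "column_finite G f1" "column_finite G f2"
  shows "column_finite G (\<lambda>g. f1 g + c * f2 g)"
  unfolding column_finite_def
proof
  fix x
  have "{h \<in> gcarrier G. dm G h = x \<and> f1 h + c * f2 h \<noteq> 0}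
     \<subseteq> {h \<in> gcarrier G. dm G h = x \<and> f1 h \<noteq> 0} \<union> {h \<in> gcarrier G. dm G h = x \<and> f2 h \<noteq> 0}" by auto
  then show "finite {h \<in> gcarrier G. dm G h = x \<and> f1 h + c * f2 h \<noteq> 0}"
    using assms unfolding column_finite_def by (meson finite_UnI finite_subset)
qed

locale groupoid_algebraic =
  fixes G :: "'g groupoid"
  assumes algebraic: "algebraic_groupoid G"
begin

abbreviation C where "C \<equiv> gcarrier G"
abbreviation r where "r \<equiv> rng G"
abbreviation d where "d \<equiv> dm G"
abbreviation inverse_arrow ("inv'' _" [90] 90) where "inv' g \<equiv> ginv G g"
abbreviation times_arrow (infixl "\<cdot>" 75) where "g \<cdot> h \<equiv> gmult G g h"

lemma inv_closed [simp]: "g \<in> C \<Longrightarrow> inv' g \<in> C"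
  and inv_inv [simp]: "g \<in> C \<Longrightarrow> inv' (inv' g) = g"
  using algebraic by (auto simp: algebraic_groupoid_def)

lemma mult_closed [simp]: "g \<in> C \<Longrightarrow> h \<in> C \<Longrightarrow> d g = r h \<Longrightarrow> g \<cdot> h \<in> C"
  and dm_mult [simp]: "g \<in> C \<Longrightarrow> h \<in> C \<Longrightarrow> d g = r h \<Longrightarrow> d (g \<cdot> h) = d h"
  and rng_mult [simp]: "g \<in> C \<Longrightarrow> h \<in> C \<Longrightarrow> d g = r h \<Longrightarrow> r (g \<cdot> h) = r g"
  and mult_inv_left [simp]: "g \<in> C \<Longrightarrow> h \<in> C \<Longrightarrow> d g = r h \<Longrightarrow> inv' g \<cdot> (g \<cdot> h) = h"
  and mult_inv_right [simp]: "g \<in> C \<Longrightarrow> h \<in> C \<Longrightarrow> d g = r h \<Longrightarrow> g \<cdot> h \<cdot> inv' h = g"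
  using algebraic by (auto simp: algebraic_groupoid_def composable_def)

lemma mult_assoc:
  "g \<in> C \<Longrightarrow> h \<in> C \<Longrightarrow> k \<in> C \<Longrightarrow> d g = r h \<Longrightarrow> d h = r k \<Longrightarrow> g \<cdot> h \<cdot> k = g \<cdot> (h \<cdot> k)"
  using algebraic by (auto simp: algebraic_groupoid_def composable_def)

lemma rng_inv [simp]: "g \<in> C \<Longrightarrow> r (inv' g) = d g"
  and dm_inv [simp]: "g \<in> C \<Longrightarrow> d (inv' g) = r g"
  by (simp_all add: rng_def dm_def)

lemma dm_closed [simp]: "g \<in> C \<Longrightarrow> d g \<in> C"
  using mult_closed[of "inv' g" g] by (simp add: dm_def[of G g, symmetric])

lemma rng_closed [simp]: "g \<in> C \<Longrightarrow> r g \<in> C"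
  using mult_closed[of g "inv' g"] by (simp add: rng_def[of G g, symmetric])

lemma dm_dm [simp]: "g \<in> C \<Longrightarrow> d (d g) = d g"
  using dm_mult[of "inv' g" g] by (simp add: dm_def[of G g, symmetric])

lemma rng_dm [simp]: "g \<in> C \<Longrightarrow> r (d g) = d g"
  using rng_mult[of "inv' g" g] by (simp add: dm_def[of G g, symmetric])

lemma dm_rng [simp]: "g \<in> C \<Longrightarrow> d (r g) = r g"
  using dm_mult[of g "inv' g"] by (simp add: rng_def[of G g, symmetric])

lemma mult_dm [simp]: "g \<in> C \<Longrightarrow> g \<cdot> d g = g"
  using mult_inv_left[of "inv' g" g] by (simp add: dm_def[of G g])

lemma rng_times [simp]: "g \<in> C \<Longrightarrow> r g \<cdot> g = g"
  using mult_inv_right[of g "inv' g"] by (simp add: rng_def[of G g])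

lemma inv_dm [simp]: "g \<in> C \<Longrightarrow> inv' (d g) = d g"
  using mult_dm[of "inv' (d g)"] dm_def[of G "d g"] by simp

lemma unit_space_iff: "u \<in> unit_space G \<longleftrightarrow> u \<in> C \<and> d u = u"
  unfolding unit_space_def by (auto simp: image_iff) (metis dm_closed)+

lemma unitD:
  assumes "u \<in> unit_space G"
  shows "u \<in> C" "d u = u" "r u = u" "inv' u = u"
proof -
  show u: "u \<in> C" and du: "d u = u" using assms by (auto simp: unit_space_iff)
  show "r u = u" using rng_dm[OF u] du by simp
  show "inv' u = u" using inv_dm[OF u] du by simp
qed

lemma dm_unit [simp]: "g \<in> C \<Longrightarrow> d g \<in> unit_space G"
  and rng_unit [simp]: "g \<in> C \<Longrightarrow> r g \<in> unit_space G"
  by (simp_all add: unit_space_iff)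

lemmas unit_simps [simp] = unitD(2,3,4)

lemma inv_mult:
  assumes "g \<in> C" "h \<in> C" "d g = r h"
  shows "inv' (g \<cdot> h) = inv' h \<cdot> inv' g"
proof -
  have "inv' h \<cdot> inv' g \<cdot> (g \<cdot> h) = inv' h \<cdot> (inv' g \<cdot> (g \<cdot> h))"
    using assms by (intro mult_assoc) simp_all
  also have "\<dots> = d h" using assms by (simp add: dm_def)
  finally have "inv' h \<cdot> inv' g \<cdot> (g \<cdot> h) \<cdot> inv' (g \<cdot> h) = d h \<cdot> inv' (g \<cdot> h)" by simp
  also have "\<dots> = inv' (g \<cdot> h)" using rng_times[of "inv' (g \<cdot> h)"] assms by simp
  also have "inv' h \<cdot> inv' g \<cdot> (g \<cdot> h) \<cdot> inv' (g \<cdot> h) = inv' h \<cdot> inv' g"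
    using assms by (intro mult_inv_right) simp_all
  finally show ?thesis by simp
qed

lemma quotient_times [simp]: "g \<in> C \<Longrightarrow> k \<in> C \<Longrightarrow> d g = d k \<Longrightarrow> g \<cdot> inv' k \<cdot> k = g"
  using mult_inv_right[of g "inv' k"] by simp

lemma times_quotient [simp]: "h \<in> C \<Longrightarrow> g \<in> C \<Longrightarrow> r h = r g \<Longrightarrow> h \<cdot> (inv' h \<cdot> g) = g"
  using mult_inv_left[of "inv' h" g] by simp

text \<open>The matrix of convolution by \<open>f\<close> in the basis of point masses.\<close>

definition kern :: "('g \<Rightarrow> complex) \<Rightarrow> 'g \<Rightarrow> 'g \<Rightarrow> complex" where
  "kern f g k = (if g \<in> C \<and> k \<in> C \<and> d k = d g then f (g \<cdot> inv' k) else 0)"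

lemma conv_kern:
  assumes "finite T" "\<And>k. k \<notin> T \<Longrightarrow> \<xi> k = 0"
  shows "conv G f \<xi> g = (\<Sum>k\<in>T. kern f g k * \<xi> k)"
proof (cases "g \<in> C")
  case True
  have "bij_betw (\<lambda>k. g \<cdot> inv' k) {k \<in> C. d k = d g} {h \<in> C. r h = r g}"
  proof (rule bij_betw_byWitness[where f' = "\<lambda>h. inv' h \<cdot> g"])
    show "\<forall>k\<in>{k \<in> C. d k = d g}. inv' (g \<cdot> inv' k) \<cdot> g = k"
      using True by (simp add: inv_mult)
    show "\<forall>h\<in>{h \<in> C. r h = r g}. g \<cdot> inv' (inv' h \<cdot> g) = h"
      using True mult_inv_left[of "inv' g"] by (simp add: inv_mult)
    show "(\<lambda>k. g \<cdot> inv' k) ` {k \<in> C. d k = d g} \<subseteq> {h \<in> C. r h = r g}"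
      "(\<lambda>h. inv' h \<cdot> g) ` {h \<in> C. r h = r g} \<subseteq> {k \<in> C. d k = d g}"
      using True by (simp_all add: image_subset_iff)
  qed
  from infsum_reindex_bij_betw[OF this, of "\<lambda>h. f h * \<xi> (inv' h \<cdot> g)"]
  have "conv G f \<xi> g = (\<Sum>\<^sub>\<infinity>k\<in>{k \<in> C. d k = d g}. f (g \<cdot> inv' k) * \<xi> (inv' (g \<cdot> inv' k) \<cdot> g))"
    using True by (simp add: conv_def extend0_def)
  also have "\<dots> = (\<Sum>\<^sub>\<infinity>k\<in>T. kern f g k * \<xi> k)"
    using True assms(2) by (intro infsum_cong_neutral) (auto simp: kern_def inv_mult)
  also have "\<dots> = (\<Sum>k\<in>T. kern f g k * \<xi> k)" using assms(1) by simp
  finally show ?thesis .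
qed (simp add: conv_def extend0_def kern_def)

lemma conv_coord: "conv G f (coord \<xi>) g = (\<Sum>k | coord \<xi> k \<noteq> 0. kern f g k * coord \<xi> k)"
  by (rule conv_kern[OF finite_coord coord_support])

lemma conv_row:
  assumes "finite R" "R \<subseteq> {h \<in> C. r h = r g}" "\<And>h. h \<in> C \<Longrightarrow> r h = r g \<Longrightarrow> h \<notin> R \<Longrightarrow> f h = 0" "g \<in> C"
  shows "conv G f \<xi> g = (\<Sum>h\<in>R. f h * \<xi> (inv' h \<cdot> g))"
proof -
  have "conv G f \<xi> g = (\<Sum>\<^sub>\<infinity>h\<in>R. f h * \<xi> (inv' h \<cdot> g))"
    unfolding conv_def extend0_def if_P[OF assms(4)] using assms(2,3)
    by (intro infsum_cong_neutral) auto
  then show ?thesis using assms(1) by simp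
qed

lemma coord_lconv_conv:
  assumes "column_finite G f"
  shows "coord (lconv G f \<xi>) = conv G f (coord \<xi>)"
proof -
  let ?K = "{k. coord \<xi> k \<noteq> 0}"
  have "{g. conv G f (coord \<xi>) g \<noteq> 0} \<subseteq> (\<Union>k\<in>?K. (\<lambda>h. h \<cdot> k) ` {h \<in> C. d h = r k \<and> f h \<noteq> 0})"
  proof
    fix g assume "g \<in> {g. conv G f (coord \<xi>) g \<noteq> 0}"
    then have "(\<Sum>k\<in>?K. kern f g k * coord \<xi> k) \<noteq> 0"
      by (simp add: conv_coord)
    then obtain k where "k \<in> ?K" "kern f g k \<noteq> 0"
      by (elim sum.not_neutral_contains_not_neutral) auto
    then have "g \<cdot> inv' k \<in> {h \<in> C. d h = r k \<and> f h \<noteq> 0}" "g = g \<cdot> inv' k \<cdot> k"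
      by (auto simp: kern_def split: if_splits)
    with \<open>k \<in> ?K\<close> show "g \<in> (\<Union>k\<in>?K. (\<lambda>h. h \<cdot> k) ` {h \<in> C. d h = r k \<and> f h \<noteq> 0})" by blast
  qed
  moreover have "finite (\<Union>k\<in>?K. (\<lambda>h. h \<cdot> k) ` {h \<in> C. d h = r k \<and> f h \<noteq> 0})"
    using assms finite_coord[of \<xi>] by (simp add: column_finite_def)
  ultimately show ?thesis unfolding lconv_def by (intro coord_Abs) (rule finite_subset)
qed

lemma coord_lconv:
  assumes "column_finite G f" "finite T" "\<And>k. k \<notin> T \<Longrightarrow> coord \<xi> k = 0"
  shows "coord (lconv G f \<xi>) g = (\<Sum>k\<in>T. kern f g k * coord \<xi> k)"
  unfolding coord_lconv_conv[OF assms(1)] using assms(2,3) by (rule conv_kern)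

lemma coord_lconv_support:
  "column_finite G f \<Longrightarrow> coord (lconv G f \<xi>) g = (\<Sum>k | coord \<xi> k \<noteq> 0. kern f g k * coord \<xi> k)"
  by (simp add: coord_lconv_conv conv_coord)

lemma coord_lconv_outside: "column_finite G f \<Longrightarrow> g \<notin> C \<Longrightarrow> coord (lconv G f \<xi>) g = 0"
  by (simp add: coord_lconv_support kern_def)

lemma lconv_add_cscale:
  assumes "column_finite G f"
  shows "lconv G f (\<xi> + cscale c \<eta>) = lconv G f \<xi> + cscale c (lconv G f \<eta>)"
proof (rule fvec_eqI)
  fix g
  let ?T = "{k. coord \<xi> k \<noteq> 0} \<union> {k. coord \<eta> k \<noteq> 0}"
  have T: "finite ?T" using finite_coord by auto
  show "coord (lconv G f (\<xi> + cscale c \<eta>)) g = coord (lconv G f \<xi> + cscale c (lconv G f \<eta>)) g"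
  proof -
    have "coord (lconv G f \<zeta>) g = (\<Sum>k\<in>?T. kern f g k * coord \<zeta> k)"
      if "\<zeta> \<in> {\<xi>, \<eta>, \<xi> + cscale c \<eta>}" for \<zeta>
      using that by (intro coord_lconv[OF assms T]) auto
    then show ?thesis by (simp add: sum.distrib[symmetric] sum_distrib_left algebra_simps)
  qed
qed

lemma linear_lconv: "column_finite G f \<Longrightarrow> linear (lconv G f)"
proof (rule linearI)
  assume f: "column_finite G f"
  have zero: "lconv G f 0 = 0"
    using coord_lconv[OF f, of "{}" 0] by (intro fvec_eqI) simp
  show "lconv G f (\<xi> + \<eta>) = lconv G f \<xi> + lconv G f \<eta>" for \<xi> \<eta>
    using lconv_add_cscale[OF f, of \<xi> 1 \<eta>] by (simp add: cscale_def coord_inverse)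
  show "lconv G f (a *\<^sub>R \<xi>) = a *\<^sub>R lconv G f \<xi>" for a \<xi>
    using lconv_add_cscale[OF f, of 0 "of_real a" \<xi>] by (simp add: zero scaleR_fvec_def)
qed

lemma lconv_add:
  assumes "column_finite G f1" "column_finite G f2"
  shows "lconv G (\<lambda>g. f1 g + c * f2 g) \<xi> = lconv G f1 \<xi> + cscale c (lconv G f2 \<xi>)"
proof (rule fvec_eqI)
  fix g
  let ?T = "{k. coord \<xi> k \<noteq> 0}"
  have "kern (\<lambda>g. f1 g + c * f2 g) g k = kern f1 g k + c * kern f2 g k" for k
    by (simp add: kern_def)
  then show "coord (lconv G (\<lambda>g. f1 g + c * f2 g) \<xi>) g = coord (lconv G f1 \<xi> + cscale c (lconv G f2 \<xi>)) g"
    by (simp add: coord_lconv_support assms column_finite_add sum.distrib[symmetric] sum_distrib_left algebra_simps)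
qed

lemma conv_support:
  assumes "row_finite G f1" "conv G f1 f2 g \<noteq> 0"
  obtains h k where "h \<in> C" "k \<in> C" "d h = r k" "g = h \<cdot> k" "f1 h \<noteq> 0" "f2 k \<noteq> 0"
proof -
  let ?R = "{h \<in> C. r h = r g \<and> f1 h \<noteq> 0}"
  have g: "g \<in> C" using assms(2) by (auto simp: conv_def extend0_def split: if_splits)
  have "conv G f1 f2 g = (\<Sum>h\<in>?R. f1 h * f2 (inv' h \<cdot> g))"
    using assms(1) g by (intro conv_row) (auto simp: row_finite_def)
  then have "(\<Sum>h\<in>?R. f1 h * f2 (inv' h \<cdot> g)) \<noteq> 0" using assms(2) by simp
  then obtain h where "h \<in> ?R" "f1 h * f2 (inv' h \<cdot> g) \<noteq> 0"
    by (rule sum.not_neutral_contains_not_neutral)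
  then show ?thesis using g by (intro that[of h "inv' h \<cdot> g"]) simp_all
qed

lemma row_finite_conv:
  assumes "row_finite G f1" "row_finite G f2"
  shows "row_finite G (conv G f1 f2)"
  unfolding row_finite_def
proof
  fix x
  have "{g \<in> C. r g = x \<and> conv G f1 f2 g \<noteq> 0}
    \<subseteq> (\<Union>h\<in>{h \<in> C. r h = x \<and> f1 h \<noteq> 0}. (\<lambda>k. h \<cdot> k) ` {k \<in> C. r k = d h \<and> f2 k \<noteq> 0})"
  proof
    fix g assume "g \<in> {g \<in> C. r g = x \<and> conv G f1 f2 g \<noteq> 0}"
    then obtain h k where "h \<in> C" "k \<in> C" "d h = r k" "g = h \<cdot> k" "f1 h \<noteq> 0" "f2 k \<noteq> 0" "r g = x"
      using conv_support[OF assms(1)] by blast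
    then show "g \<in> (\<Union>h\<in>{h \<in> C. r h = x \<and> f1 h \<noteq> 0}. (\<lambda>k. h \<cdot> k) ` {k \<in> C. r k = d h \<and> f2 k \<noteq> 0})"
      by (intro UN_I[of h] image_eqI[of _ _ k]) simp_all
  qed
  then show "finite {g \<in> C. r g = x \<and> conv G f1 f2 g \<noteq> 0}"
    using assms unfolding row_finite_def by (elim finite_subset) auto
qed

lemma column_finite_conv:
  assumes "row_finite G f1" "column_finite G f1" "column_finite G f2"
  shows "column_finite G (conv G f1 f2)"
  unfolding column_finite_def
proof
  fix x
  have "{g \<in> C. d g = x \<and> conv G f1 f2 g \<noteq> 0}
    \<subseteq> (\<Union>k\<in>{k \<in> C. d k = x \<and> f2 k \<noteq> 0}. (\<lambda>h. h \<cdot> k) ` {h \<in> C. d h = r k \<and> f1 h \<noteq> 0})"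
  proof
    fix g assume "g \<in> {g \<in> C. d g = x \<and> conv G f1 f2 g \<noteq> 0}"
    then obtain h k where "h \<in> C" "k \<in> C" "d h = r k" "g = h \<cdot> k" "f1 h \<noteq> 0" "f2 k \<noteq> 0" "d g = x"
      using conv_support[OF assms(1)] by blast
    then show "g \<in> (\<Union>k\<in>{k \<in> C. d k = x \<and> f2 k \<noteq> 0}. (\<lambda>h. h \<cdot> k) ` {h \<in> C. d h = r k \<and> f1 h \<noteq> 0})"
      by (intro UN_I[of k] image_eqI[of _ _ h]) simp_all
  qed
  then show "finite {g \<in> C. d g = x \<and> conv G f1 f2 g \<noteq> 0}"
    using assms unfolding column_finite_def by (elim finite_subset) auto
qed

text \<open>This is associativity of convolution, with a vector as third factor.\<close>

lemma lconv_conv: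
  assumes "row_finite G f1" "column_finite G f1" "column_finite G f2"
  shows "lconv G (conv G f1 f2) \<xi> = lconv G f1 (lconv G f2 \<xi>)"
proof (rule fvec_eqI)
  fix g
  let ?T = "{k. coord \<xi> k \<noteq> 0}" and ?R = "{h \<in> C. r h = r g \<and> f1 h \<noteq> 0}"
  note T = finite_coord[of \<xi>]
  have R: "finite ?R" using assms(1) by (simp add: row_finite_def)
  show "coord (lconv G (conv G f1 f2) \<xi>) g = coord (lconv G f1 (lconv G f2 \<xi>)) g"
  proof (cases "g \<in> C")
    case True
    have K: "kern (conv G f1 f2) g k = (\<Sum>h\<in>?R. f1 h * kern f2 (inv' h \<cdot> g) k)" for k
    proof (cases "k \<in> C \<and> d k = d g")
      case k: True
      have "kern (conv G f1 f2) g k = conv G f1 f2 (g \<cdot> inv' k)" using k True by (simp add: kern_def)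
      also have "\<dots> = (\<Sum>h\<in>?R. f1 h * f2 (inv' h \<cdot> (g \<cdot> inv' k)))"
        using k True R by (intro conv_row) auto
      also have "\<dots> = (\<Sum>h\<in>?R. f1 h * kern f2 (inv' h \<cdot> g) k)"
      proof (rule sum.cong)
        fix h assume "h \<in> ?R"
        then have "inv' h \<cdot> (g \<cdot> inv' k) = inv' h \<cdot> g \<cdot> inv' k"
          using k True by (intro mult_assoc[symmetric]) auto
        then show "f1 h * f2 (inv' h \<cdot> (g \<cdot> inv' k)) = f1 h * kern f2 (inv' h \<cdot> g) k"
          using \<open>h \<in> ?R\<close> k True by (simp add: kern_def)
      qed simp
      finally show ?thesis .
    next
      case False
      then show ?thesis using True by (auto simp: kern_def intro!: sum.neutral)
    qed
    have "coord (lconv G (conv G f1 f2) \<xi>) g = (\<Sum>k\<in>?T. (\<Sum>h\<in>?R. f1 h * kern f2 (inv' h \<cdot> g) k) * coord \<xi> k)"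
      unfolding K[symmetric] by (rule coord_lconv[OF column_finite_conv[OF assms] T]) simp
    also have "\<dots> = (\<Sum>h\<in>?R. f1 h * (\<Sum>k\<in>?T. kern f2 (inv' h \<cdot> g) k * coord \<xi> k))"
      by (simp add: sum_distrib_left sum_distrib_right mult.assoc) (rule sum.swap)
    also have "\<dots> = (\<Sum>h\<in>?R. f1 h * coord (lconv G f2 \<xi>) (inv' h \<cdot> g))"
      by (simp only: coord_lconv_support assms)
    also have "\<dots> = coord (lconv G f1 (lconv G f2 \<xi>)) g"
      unfolding coord_lconv_conv[OF assms(2)]
      by (rule conv_row[symmetric, OF R _ _ True]) auto
    finally show ?thesis .
  next
    case False
    then show ?thesis
      by (simp add: coord_lconv_outside assms column_finite_conv)
  qed
qed

lemma involution_row_column: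
  "row_finite G f \<Longrightarrow> column_finite G (involution G f)"
  "column_finite G f \<Longrightarrow> row_finite G (involution G f)"
proof -
  assume f: "row_finite G f"
  have "{h \<in> C. d h = x \<and> involution G f h \<noteq> 0} \<subseteq> ginv G ` {h \<in> C. r h = x \<and> f h \<noteq> 0}" for x
    by (auto simp: involution_def extend0_def intro!: image_eqI[of _ _ "ginv G _"])
  then show "column_finite G (involution G f)"
    using f unfolding column_finite_def row_finite_def by (meson finite_imageI finite_subset)
next
  assume f: "column_finite G f"
  have "{h \<in> C. r h = x \<and> involution G f h \<noteq> 0} \<subseteq> ginv G ` {h \<in> C. d h = x \<and> f h \<noteq> 0}" for x
    by (auto simp: involution_def extend0_def intro!: image_eqI[of _ _ "ginv G _"])
  then show "row_finite G (involution G f)"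
    using f unfolding column_finite_def row_finite_def by (meson finite_imageI finite_subset)
qed

lemma lconv_involution:
  assumes "row_finite G f" "column_finite G f"
  shows "lconv G f \<xi> \<bullet> \<eta> = \<xi> \<bullet> lconv G (involution G f) \<eta>"
proof -
  let ?T = "{k. coord \<xi> k \<noteq> 0} \<union> {k. coord \<eta> k \<noteq> 0}"
  have T: "finite ?T" using finite_coord by auto
  have K: "kern (involution G f) k g = cnj (kern f g k)" for g k
    by (auto simp: kern_def involution_def extend0_def inv_mult)
  have "lconv G f \<xi> \<bullet> \<eta> = (\<Sum>g\<in>?T. Re (coord (lconv G f \<xi>) g * cnj (coord \<eta> g)))"
    using T by (intro inner_fvec_superset) auto
  also have "\<dots> = (\<Sum>g\<in>?T. \<Sum>k\<in>?T. Re (kern f g k * coord \<xi> k * cnj (coord \<eta> g)))"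
  proof -
    have "coord (lconv G f \<xi>) g = (\<Sum>k\<in>?T. kern f g k * coord \<xi> k)" for g
      by (rule coord_lconv[OF assms(2) T]) blast
    then show ?thesis by (simp add: sum_distrib_right)
  qed
  also have "\<dots> = (\<Sum>k\<in>?T. \<Sum>g\<in>?T. Re (kern f g k * coord \<xi> k * cnj (coord \<eta> g)))"
    by (rule sum.swap)
  also have "\<dots> = (\<Sum>k\<in>?T. Re (coord \<xi> k * cnj (coord (lconv G (involution G f) \<eta>) k)))"
  proof -
    have "coord (lconv G (involution G f) \<eta>) k = (\<Sum>g\<in>?T. kern (involution G f) k g * coord \<eta> g)" for k
      by (rule coord_lconv[OF involution_row_column(1)[OF assms(1)] T]) blast
    then show ?thesis by (simp add: K sum_distrib_left mult_ac)
  qed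
  also have "\<dots> = \<xi> \<bullet> lconv G (involution G f) \<eta>"
    using T by (intro inner_fvec_superset[symmetric]) auto
  finally show ?thesis .
qed

lemma coord_lconv_delta:
  assumes "column_finite G f" "g \<in> C"
  shows "coord (lconv G f (delta (d g))) g = f g"
  using coord_lconv[OF assms(1), of "{d g}" "delta (d g)" g] assms(2) by (simp add: kern_def)

end


section \<open>The reduced norm as an operator norm\<close>

lemma l2_coord:
  assumes "\<And>g. g \<notin> X \<Longrightarrow> coord \<xi> g = 0"
  shows "coord \<xi> \<in> l2 X" "l2_norm X (coord \<xi>) = norm \<xi>"
proof -
  have "((\<lambda>g. (cmod (coord \<xi> g))\<^sup>2) has_sum (\<Sum>g | coord \<xi> g \<noteq> 0. (cmod (coord \<xi> g))\<^sup>2)) {g. coord \<xi> g \<noteq> 0}"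
    by (rule has_sum_finite) (rule finite_coord)
  also have "(\<Sum>g | coord \<xi> g \<noteq> 0. (cmod (coord \<xi> g))\<^sup>2) = (norm \<xi>)\<^sup>2"
    by (rule norm_fvec_superset[OF finite_coord coord_support, symmetric])
  finally have "((\<lambda>g. (cmod (coord \<xi> g))\<^sup>2) has_sum (norm \<xi>)\<^sup>2) {g. coord \<xi> g \<noteq> 0}" .
  then have hs: "((\<lambda>g. (cmod (coord \<xi> g))\<^sup>2) has_sum (norm \<xi>)\<^sup>2) X"
    using assms by (subst has_sum_cong_neutral[where T = "{g. coord \<xi> g \<noteq> 0}" and g = "\<lambda>g. (cmod (coord \<xi> g))\<^sup>2"]) auto
  show "coord \<xi> \<in> l2 X" unfolding l2_def using hs assms by (auto simp: summable_on_def)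
  show "l2_norm X (coord \<xi>) = norm \<xi>" unfolding l2_norm_def using infsumI[OF hs] by simp
qed

context groupoid_algebraic
begin

lemma bounded_functionsD:
  assumes "f \<in> bounded_functions G"
  shows "row_finite G f" "column_finite G f" "g \<notin> C \<Longrightarrow> f g = 0"
  using assms by (simp_all add: bounded_functions_def)

lemma bounded_linear_lconv: "f \<in> bounded_functions G \<Longrightarrow> bounded_linear (lconv G f)"
  using linear_lconv[of f] unfolding bounded_functions_def
  by (auto simp: bounded_linear_def bounded_linear_axioms_def mult.commute)

lemma bounded_functionsI:
  assumes "\<And>g. g \<notin> C \<Longrightarrow> f g = 0" "row_finite G f" "column_finite G f" "\<And>\<xi>. norm (lconv G f \<xi>) \<le> K * norm \<xi>"
  shows "f \<in> bounded_functions G"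
  using assms unfolding bounded_functions_def by blast

lemma bounded_functions_add:
  assumes "f1 \<in> bounded_functions G" "f2 \<in> bounded_functions G"
  shows "(\<lambda>g. f1 g + c * f2 g) \<in> bounded_functions G"
proof -
  from assms obtain K1 K2 where K: "\<And>\<xi>. norm (lconv G f1 \<xi>) \<le> K1 * norm \<xi>"
    "\<And>\<xi>. norm (lconv G f2 \<xi>) \<le> K2 * norm \<xi>" unfolding bounded_functions_def by blast
  note D = assms[THEN bounded_functionsD(1)] assms[THEN bounded_functionsD(2)]
  have "norm (lconv G (\<lambda>g. f1 g + c * f2 g) \<xi>) \<le> (K1 + cmod c * K2) * norm \<xi>" for \<xi>
  proof -
    have "norm (lconv G (\<lambda>g. f1 g + c * f2 g) \<xi>) \<le> norm (lconv G f1 \<xi>) + cmod c * norm (lconv G f2 \<xi>)"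
      using norm_triangle_ineq[of "lconv G f1 \<xi>" "cscale c (lconv G f2 \<xi>)"] by (simp add: lconv_add D)
    also have "\<dots> \<le> K1 * norm \<xi> + cmod c * (K2 * norm \<xi>)"
      by (intro add_mono mult_left_mono K) simp
    finally show ?thesis by (simp add: algebra_simps)
  qed
  then show ?thesis
    using D assms[THEN bounded_functionsD(3)]
    by (intro bounded_functionsI row_finite_add column_finite_add) auto
qed

lemma bounded_functions_zero: "(\<lambda>g. 0) \<in> bounded_functions G"
proof (rule bounded_functionsI)
  have "column_finite G (\<lambda>g. 0)" by (simp add: column_finite_def)
  then have "lconv G (\<lambda>g. 0) \<xi> = 0" for \<xi>
    by (intro fvec_eqI) (simp add: coord_lconv_support kern_def)
  then show "norm (lconv G (\<lambda>g. 0) \<xi>) \<le> 0 * norm \<xi>" for \<xi> by simp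
qed (simp_all add: column_finite_def row_finite_def)

lemma bounded_functions_scale: "f \<in> bounded_functions G \<Longrightarrow> (\<lambda>g. c * f g) \<in> bounded_functions G"
  using bounded_functions_add[OF bounded_functions_zero, of f c] by simp

lemma bounded_functions_conv:
  assumes "f1 \<in> bounded_functions G" "f2 \<in> bounded_functions G"
  shows "conv G f1 f2 \<in> bounded_functions G"
proof -
  note D = assms[THEN bounded_functionsD(1)] assms[THEN bounded_functionsD(2)]
  interpret f1: bounded_linear "lconv G f1" by (rule bounded_linear_lconv[OF assms(1)])
  interpret f2: bounded_linear "lconv G f2" by (rule bounded_linear_lconv[OF assms(2)])
  obtain K1 K2 where K: "\<And>\<xi>. norm (lconv G f1 \<xi>) \<le> norm \<xi> * K1" "0 \<le> K1"
    "\<And>\<xi>. norm (lconv G f2 \<xi>) \<le> norm \<xi> * K2" using f1.nonneg_bounded f2.nonneg_bounded by blast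
  have "norm (lconv G (conv G f1 f2) \<xi>) \<le> (K2 * K1) * norm \<xi>" for \<xi>
    using order_trans[OF K(1) mult_right_mono[OF K(3) K(2)], of \<xi>] by (simp add: lconv_conv D mult_ac)
  then show ?thesis
    using D by (intro bounded_functionsI row_finite_conv column_finite_conv) (auto simp: conv_def extend0_def)
qed

text \<open>An adjoint satisfies \<open>\<parallel>B \<eta>\<parallel>\<^sup>2 = \<langle>A B \<eta>, \<eta>\<rangle> \<le> K \<parallel>B \<eta>\<parallel> \<parallel>\<eta>\<parallel>\<close>.\<close>

lemma bounded_functions_involution:
  assumes "f \<in> bounded_functions G"
  shows "involution G f \<in> bounded_functions G"
proof -
  note D = bounded_functionsD[OF assms]
  obtain K where K: "\<And>\<xi>. norm (lconv G f \<xi>) \<le> K * norm \<xi>"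
    using assms unfolding bounded_functions_def by blast
  have "norm (lconv G (involution G f) \<eta>) \<le> K * norm \<eta>" for \<eta>
  proof -
    let ?b = "lconv G (involution G f) \<eta>"
    have "norm ?b * norm ?b = lconv G f ?b \<bullet> \<eta>"
      using lconv_involution[OF D(1,2), of ?b \<eta>]
      by (simp only: power2_norm_eq_inner[symmetric] power2_eq_square[symmetric])
    also have "\<dots> \<le> norm (lconv G f ?b) * norm \<eta>" by (rule norm_cauchy_schwarz)
    also have "\<dots> \<le> K * norm ?b * norm \<eta>" by (intro mult_right_mono K) simp
    finally have 1: "norm ?b * norm ?b \<le> norm ?b * (K * norm \<eta>)" by (simp add: mult_ac)
    show ?thesis
    proof (cases "norm ?b = 0")
      case True
      then show ?thesis using K[of \<eta>] norm_ge_zero[of "lconv G f \<eta>"] by linarith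
    next
      case False
      then show ?thesis using 1 by simp
    qed
  qed
  then show ?thesis using D
    by (intro bounded_functionsI involution_row_column) (auto simp: involution_def extend0_def)
qed

text \<open>The representation on vectors is faithful, because a function can be read off from its values on point masses at
  units.  Identities between convolution products may therefore be checked for operators.\<close>

lemma fun_eq_lconv:
  assumes "f1 \<in> bounded_functions G" "f2 \<in> bounded_functions G" "\<And>\<xi>. lconv G f1 \<xi> = lconv G f2 \<xi>"
  shows "f1 = f2"
proof
  fix g show "f1 g = f2 g"
    using coord_lconv_delta[OF bounded_functionsD(2)[OF assms(1)], of g]
      coord_lconv_delta[OF bounded_functionsD(2)[OF assms(2)], of g]
      bounded_functionsD(3)[OF assms(1), of g] bounded_functionsD(3)[OF assms(2), of g] assms(3)
    by (cases "g \<in> C") auto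
qed

text \<open>Finitely many values of \<open>f * \<xi>\<close> depend, as \<open>f\<close> has finite rows, on finitely many values of \<open>\<xi>\<close> only; so a bound on
  vectors of finite support carries over to the full \<open>\<ell>\<^sup>2\<close> space of a fibre.\<close>

lemma l2_norm_conv_le:
  assumes f: "f \<in> bounded_functions G" and K: "\<And>\<xi>. norm (lconv G f \<xi>) \<le> K * norm \<xi>" "0 \<le> K"
    and \<xi>: "\<xi> \<in> l2 (dm_fibre G u)" "l2_norm (dm_fibre G u) \<xi> \<le> 1"
  shows "l2_norm (dm_fibre G u) (conv G f \<xi>) \<le> K"
proof -
  let ?X = "dm_fibre G u"
  note D = bounded_functionsD[OF f]
  have fin: "(\<Sum>g\<in>F. (cmod (conv G f \<xi> g))\<^sup>2) \<le> K\<^sup>2" if F: "finite F" "F \<subseteq> ?X" for F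
  proof -
    let ?R = "\<lambda>g. {h \<in> C. r h = r g \<and> f h \<noteq> 0}"
    have R: "finite (?R g)" for g using D(1) by (simp add: row_finite_def)
    define E where "E = (\<Union>g\<in>F. (\<lambda>h. inv' h \<cdot> g) ` ?R g)"
    have E: "finite E" unfolding E_def using F R by auto
    have EX: "E \<subseteq> ?X"
    proof
      fix k assume "k \<in> E"
      then obtain g h where "g \<in> F" "h \<in> ?R g" "k = inv' h \<cdot> g" unfolding E_def by blast
      then show "k \<in> ?X" using F(2) by (auto simp: dm_fibre_def)
    qed
    define \<eta> where "\<eta> = Abs_fvec (\<lambda>k. if k \<in> E then \<xi> k else 0)"
    have \<eta>: "coord \<eta> = (\<lambda>k. if k \<in> E then \<xi> k else 0)" unfolding \<eta>_def
      by (rule coord_Abs) (rule finite_subset[OF _ E], auto)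
    have "conv G f \<xi> g = coord (lconv G f \<eta>) g" if g: "g \<in> F" for g
    proof -
      have gC: "g \<in> C" using F g by (auto simp: dm_fibre_def)
      have "conv G f \<zeta> g = (\<Sum>h\<in>?R g. f h * \<zeta> (inv' h \<cdot> g))" for \<zeta>
        by (rule conv_row[OF R _ _ gC]) auto
      moreover have "\<xi> (inv' h \<cdot> g) = coord \<eta> (inv' h \<cdot> g)" if "h \<in> ?R g" for h
        using that g unfolding \<eta> E_def by auto
      ultimately show ?thesis by (simp add: coord_lconv_conv[OF D(2)])
    qed
    then have "(\<Sum>g\<in>F. (cmod (conv G f \<xi> g))\<^sup>2) = (\<Sum>g\<in>F. (cmod (coord (lconv G f \<eta>) g))\<^sup>2)" by simp
    also have "\<dots> \<le> (norm (lconv G f \<eta>))\<^sup>2" by (rule sum_coord_le_norm[OF F(1)])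
    also have "\<dots> \<le> (K * norm \<eta>)\<^sup>2" by (intro power_mono K) simp
    also have "\<dots> = K\<^sup>2 * (\<Sum>k\<in>E. (cmod (coord \<eta> k))\<^sup>2)"
      unfolding power_mult_distrib using norm_fvec_superset[OF E, of \<eta>] \<eta> by simp
    also have "(\<Sum>k\<in>E. (cmod (coord \<eta> k))\<^sup>2) = (\<Sum>k\<in>E. (cmod (\<xi> k))\<^sup>2)" unfolding \<eta> by simp
    also have "\<dots> \<le> (\<Sum>\<^sub>\<infinity>k\<in>?X. (cmod (\<xi> k))\<^sup>2)"
      using \<xi>(1) E EX by (intro finite_sum_le_infsum) (auto simp: l2_def)
    also have "\<dots> \<le> 1" using \<xi>(2) by (simp add: l2_norm_def)
    finally show ?thesis by (simp add: mult_left_mono)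
  qed
  have "(\<lambda>g. (cmod (conv G f \<xi> g))\<^sup>2) summable_on ?X"
    using fin by (intro nonneg_bdd_above_summable_on) (auto simp: bdd_above_def)
  then have "(\<Sum>\<^sub>\<infinity>g\<in>?X. (cmod (conv G f \<xi> g))\<^sup>2) \<le> K\<^sup>2"
    using fin by (rule infsum_le_finite_sums)
  then show ?thesis unfolding l2_norm_def using K(2) by (simp add: real_le_lsqrt)
qed

lemma pi_norm_le:
  assumes f: "f \<in> bounded_functions G" and K: "\<And>\<xi>. norm (lconv G f \<xi>) \<le> K * norm \<xi>" "0 \<le> K"
  shows "pi_norm G u f \<le> K"
    and "bdd_above {l2_norm (dm_fibre G u) (conv G f \<xi>) | \<xi>.
     \<xi> \<in> l2 (dm_fibre G u) \<and> l2_norm (dm_fibre G u) \<xi> \<le> 1}"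
proof -
  have "coord 0 \<in> l2 (dm_fibre G u)" "l2_norm (dm_fibre G u) (coord 0) \<le> 1"
    using l2_coord[of "dm_fibre G u" 0] by auto
  then show "pi_norm G u f \<le> K" unfolding pi_norm_def
    using l2_norm_conv_le[OF assms] by (intro cSup_least) blast+
  show "bdd_above {l2_norm (dm_fibre G u) (conv G f \<xi>) | \<xi>.
     \<xi> \<in> l2 (dm_fibre G u) \<and> l2_norm (dm_fibre G u) \<xi> \<le> 1}"
    using l2_norm_conv_le[OF assms] unfolding bdd_above_def by blast
qed

lemma lconv_fibre:
  assumes "column_finite G f" "g \<in> C" "d g = u"
  shows "coord (lconv G f (mask (dm_fibre G u) \<xi>)) g = coord (lconv G f \<xi>) g"
proof -
  have "coord (lconv G f (mask (dm_fibre G u) \<xi>)) g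
      = (\<Sum>k | coord \<xi> k \<noteq> 0. kern f g k * coord (mask (dm_fibre G u) \<xi>) k)"
    by (rule coord_lconv[OF assms(1) finite_coord]) simp
  also have "\<dots> = (\<Sum>k | coord \<xi> k \<noteq> 0. kern f g k * coord \<xi> k)"
    using assms(2,3) by (intro sum.cong) (auto simp: kern_def dm_fibre_def)
  finally show ?thesis by (simp add: coord_lconv_support assms(1))
qed

lemma norm_lconv_fibre_le:
  assumes f: "f \<in> bounded_functions G" and \<xi>: "\<And>g. g \<notin> dm_fibre G u \<Longrightarrow> coord \<xi> g = 0"
  shows "norm (lconv G f \<xi>) \<le> pi_norm G u f * norm \<xi>"
proof (cases "\<xi> = 0")
  case True
  interpret f: bounded_linear "lconv G f" by (rule bounded_linear_lconv[OF f])
  show ?thesis using True by (simp add: f.zero)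
next
  case False
  interpret f: bounded_linear "lconv G f" by (rule bounded_linear_lconv[OF f])
  obtain K where K: "0 \<le> K" "\<And>\<xi>. norm (lconv G f \<xi>) \<le> norm \<xi> * K" using f.nonneg_bounded by blast
  define \<eta> where "\<eta> = (1 / norm \<xi>) *\<^sub>R \<xi>"
  have \<eta>0: "coord \<eta> g = 0" if "g \<notin> dm_fibre G u" for g using \<xi>[OF that] by (simp add: \<eta>_def)
  have n\<eta>: "norm \<eta> = 1" using False by (simp add: \<eta>_def)
  have out: "coord (lconv G f \<eta>) g = 0" if "g \<notin> dm_fibre G u" for g
    using that \<eta>0 unfolding coord_lconv_support[OF bounded_functionsD(2)[OF f]]
    by (intro sum.neutral) (auto simp: kern_def dm_fibre_def)
  have "norm (lconv G f \<eta>) = l2_norm (dm_fibre G u) (conv G f (coord \<eta>))"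
    using l2_coord(2)[OF out] by (simp add: coord_lconv_conv[OF bounded_functionsD(2)[OF f]])
  also have "\<dots> \<le> pi_norm G u f"
    unfolding pi_norm_def
    using pi_norm_le(2)[OF f, of K u] K l2_coord[OF \<eta>0] n\<eta>
    by (intro cSup_upper) (auto simp: mult.commute)
  finally have "norm (lconv G f \<eta>) \<le> pi_norm G u f" .
  then show ?thesis using False by (simp add: \<eta>_def f.scaleR field_simps)
qed

text \<open>The operator is block diagonal over the domain fibres.\<close>

lemma norm_lconv_le_fibrewise:
  assumes f: "f \<in> bounded_functions G" and R: "\<And>u. u \<in> unit_space G \<Longrightarrow> pi_norm G u f \<le> R" "0 \<le> R"
  shows "norm (lconv G f \<xi>) \<le> R * norm \<xi>"
proof -
  note D = bounded_functionsD[OF f]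
  let ?S = "{g \<in> C. coord \<xi> g \<noteq> 0}" and ?T = "{g. coord (lconv G f \<xi>) g \<noteq> 0}"
  let ?m = "\<lambda>u. mask (dm_fibre G u) \<xi>"
  have S: "finite ?S" by (rule finite_subset[OF _ finite_coord[of \<xi>]]) auto
  note T = finite_coord[of "lconv G f \<xi>"]
  have TC: "?T \<subseteq> C" using coord_lconv_outside[OF D(2)] by blast
  have dT: "d ` ?T \<subseteq> d ` ?S"
  proof
    fix u assume "u \<in> d ` ?T"
    then obtain g where g: "u = d g" "(\<Sum>k | coord \<xi> k \<noteq> 0. kern f g k * coord \<xi> k) \<noteq> 0"
      by (auto simp: coord_lconv_support[OF D(2)])
    then obtain k where "coord \<xi> k \<noteq> 0" "kern f g k \<noteq> 0"
      by (elim sum.not_neutral_contains_not_neutral) auto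
    then show "u \<in> d ` ?S" using g(1)
      by (intro image_eqI[of _ _ k]) (auto simp: kern_def split: if_splits)
  qed
  have "(norm (lconv G f \<xi>))\<^sup>2 = (\<Sum>g\<in>?T. (cmod (coord (lconv G f \<xi>) g))\<^sup>2)"
    by (rule norm_fvec_superset[OF T coord_support])
  also have "\<dots> = (\<Sum>u\<in>d ` ?S. \<Sum>g\<in>{g \<in> ?T. d g = u}. (cmod (coord (lconv G f \<xi>) g))\<^sup>2)"
    using S T dT by (intro sum.group[symmetric]) auto
  also have "\<dots> \<le> (\<Sum>u\<in>d ` ?S. R\<^sup>2 * (\<Sum>g\<in>{g \<in> ?S. d g = u}. (cmod (coord \<xi> g))\<^sup>2))"
  proof (rule sum_mono)
    fix u assume "u \<in> d ` ?S"
    then have u: "u \<in> unit_space G" by auto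
    have "(\<Sum>g\<in>{g \<in> ?T. d g = u}. (cmod (coord (lconv G f \<xi>) g))\<^sup>2)
        = (\<Sum>g\<in>{g \<in> ?T. d g = u}. (cmod (coord (lconv G f (?m u)) g))\<^sup>2)"
      using TC lconv_fibre[OF D(2)] by (intro sum.cong) auto
    also have "\<dots> \<le> (norm (lconv G f (?m u)))\<^sup>2"
      by (rule sum_coord_le_norm) (rule finite_subset[OF _ T], auto)
    also have "\<dots> \<le> (R * norm (?m u))\<^sup>2"
    proof (intro power_mono)
      have "norm (lconv G f (?m u)) \<le> pi_norm G u f * norm (?m u)"
        by (rule norm_lconv_fibre_le[OF f]) simp
      also have "\<dots> \<le> R * norm (?m u)" by (intro mult_right_mono R u) simp
      finally show "norm (lconv G f (?m u)) \<le> R * norm (?m u)" .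
    qed simp
    also have "(R * norm (?m u))\<^sup>2 = R\<^sup>2 * (\<Sum>g\<in>{g \<in> ?S. d g = u}. (cmod (coord (?m u) g))\<^sup>2)"
      unfolding power_mult_distrib using S
      by (subst norm_fvec_superset[of "{g \<in> ?S. d g = u}"])
        (auto simp: dm_fibre_def intro: finite_subset[OF _ S])
    also have "(\<Sum>g\<in>{g \<in> ?S. d g = u}. (cmod (coord (?m u) g))\<^sup>2) = (\<Sum>g\<in>{g \<in> ?S. d g = u}. (cmod (coord \<xi> g))\<^sup>2)"
      by (intro sum.cong) (auto simp: dm_fibre_def)
    finally show "(\<Sum>g\<in>{g \<in> ?T. d g = u}. (cmod (coord (lconv G f \<xi>) g))\<^sup>2)
        \<le> R\<^sup>2 * (\<Sum>g\<in>{g \<in> ?S. d g = u}. (cmod (coord \<xi> g))\<^sup>2)" .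
  qed
  also have "\<dots> = R\<^sup>2 * (\<Sum>g\<in>?S. (cmod (coord \<xi> g))\<^sup>2)"
    unfolding sum_distrib_left[symmetric] using S by (subst sum.group) auto
  also have "\<dots> \<le> R\<^sup>2 * (norm \<xi>)\<^sup>2"
    by (intro mult_left_mono sum_coord_le_norm S) simp
  finally have "(norm (lconv G f \<xi>))\<^sup>2 \<le> (R * norm \<xi>)\<^sup>2" by (simp add: power_mult_distrib)
  then show ?thesis by (rule power2_le_imp_le) (simp add: R(2))
qed

text \<open>One inequality passes from vectors of finite support to the \<open>\<ell>\<^sup>2\<close> space of each fibre, the other assembles a
  vector of finite support from its parts in the fibres.\<close>

theorem reduced_norm_eq_onorm:
  assumes f: "f \<in> bounded_functions G"
  shows "reduced_norm G f = onorm (lconv G f)"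
proof (rule antisym)
  note bl = bounded_linear_lconv[OF f]
  have K: "norm (lconv G f \<xi>) \<le> onorm (lconv G f) * norm \<xi>" for \<xi> by (rule onorm[OF bl])
  note pi = pi_norm_le(1)[OF f K onorm_pos_le[OF bl]]
  show "reduced_norm G f \<le> onorm (lconv G f)"
    unfolding reduced_norm_def using pi onorm_pos_le[OF bl] by (intro cSup_least) auto
  have bdd: "bdd_above (insert 0 ((\<lambda>u. pi_norm G u f) ` unit_space G))"
    using pi onorm_pos_le[OF bl] by (intro bdd_aboveI[of _ "onorm (lconv G f)"]) auto
  show "onorm (lconv G f) \<le> reduced_norm G f"
  proof (rule onorm_bound)
    show "0 \<le> reduced_norm G f" unfolding reduced_norm_def using bdd by (intro cSup_upper) auto
    then show "norm (lconv G f \<xi>) \<le> reduced_norm G f * norm \<xi>" for \<xi>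
      using bdd by (intro norm_lconv_le_fibrewise[OF f]) (auto simp: reduced_norm_def intro!: cSup_upper)
  qed
qed

lemma norm_lconv_le:
  "f \<in> bounded_functions G \<Longrightarrow> norm (lconv G f \<xi>) \<le> reduced_norm G f * norm \<xi>"
  using onorm[OF bounded_linear_lconv] by (simp add: reduced_norm_eq_onorm)

lemma reduced_norm_leI:
  assumes "f \<in> bounded_functions G" "0 \<le> K" "\<And>\<xi>. norm (lconv G f \<xi>) \<le> K * norm \<xi>"
  shows "reduced_norm G f \<le> K"
  using assms by (simp add: reduced_norm_eq_onorm onorm_bound)

lemma reduced_norm_nonneg: "f \<in> bounded_functions G \<Longrightarrow> 0 \<le> reduced_norm G f"
  by (simp add: reduced_norm_eq_onorm onorm_pos_le bounded_linear_lconv)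

lemma reduced_norm_add:
  assumes "f1 \<in> bounded_functions G" "f2 \<in> bounded_functions G"
  shows "reduced_norm G (\<lambda>g. f1 g + c * f2 g) \<le> reduced_norm G f1 + cmod c * reduced_norm G f2"
proof (rule reduced_norm_leI[OF bounded_functions_add[OF assms]])
  show "0 \<le> reduced_norm G f1 + cmod c * reduced_norm G f2"
    using assms by (simp add: reduced_norm_nonneg)
  fix \<xi>
  have "norm (lconv G (\<lambda>g. f1 g + c * f2 g) \<xi>) \<le> norm (lconv G f1 \<xi>) + cmod c * norm (lconv G f2 \<xi>)"
    using norm_triangle_ineq[of "lconv G f1 \<xi>" "cscale c (lconv G f2 \<xi>)"]
    by (simp add: lconv_add assms bounded_functionsD)
  also have "\<dots> \<le> reduced_norm G f1 * norm \<xi> + cmod c * (reduced_norm G f2 * norm \<xi>)"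
    by (intro add_mono mult_left_mono norm_lconv_le assms) simp
  finally show "norm (lconv G (\<lambda>g. f1 g + c * f2 g) \<xi>)
      \<le> (reduced_norm G f1 + cmod c * reduced_norm G f2) * norm \<xi>" by (simp add: algebra_simps)
qed

lemma reduced_norm_zero: "reduced_norm G (\<lambda>g. 0) = 0"
proof (rule antisym)
  have "column_finite G (\<lambda>g. 0)" by (simp add: column_finite_def)
  then have "lconv G (\<lambda>g. 0) \<xi> = 0" for \<xi>
    by (intro fvec_eqI) (simp add: coord_lconv_support kern_def)
  then show "reduced_norm G (\<lambda>g. 0) \<le> 0"
    by (intro reduced_norm_leI bounded_functions_zero) auto
qed (rule reduced_norm_nonneg[OF bounded_functions_zero])

lemma reduced_norm_scale:
  assumes "f \<in> bounded_functions G"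
  shows "reduced_norm G (\<lambda>g. c * f g) = cmod c * reduced_norm G f"
proof -
  have le: "reduced_norm G (\<lambda>g. a * h g) \<le> cmod a * reduced_norm G h" if "h \<in> bounded_functions G" for a h
    using reduced_norm_add[OF bounded_functions_zero that, of a] by (simp add: reduced_norm_zero)
  show ?thesis
  proof (cases "c = 0")
    case True then show ?thesis by (simp add: reduced_norm_zero)
  next
    case False
    have "reduced_norm G (\<lambda>g. (1 / c) * (c * f g)) \<le> cmod (1 / c) * reduced_norm G (\<lambda>g. c * f g)"
      by (rule le[OF bounded_functions_scale[OF assms]])
    then have "reduced_norm G f \<le> cmod (1 / c) * reduced_norm G (\<lambda>g. c * f g)" using False by simp
    then have "cmod c * reduced_norm G f \<le> reduced_norm G (\<lambda>g. c * f g)"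
      using False by (simp add: norm_divide field_simps)
    with le[OF assms, of c] show ?thesis by simp
  qed
qed

lemma reduced_norm_conv:
  assumes "f1 \<in> bounded_functions G" "f2 \<in> bounded_functions G"
  shows "reduced_norm G (conv G f1 f2) \<le> reduced_norm G f1 * reduced_norm G f2"
proof (rule reduced_norm_leI[OF bounded_functions_conv[OF assms]])
  show "0 \<le> reduced_norm G f1 * reduced_norm G f2" using assms by (simp add: reduced_norm_nonneg)
  fix \<xi>
  have "norm (lconv G f1 (lconv G f2 \<xi>)) \<le> reduced_norm G f1 * norm (lconv G f2 \<xi>)"
    by (rule norm_lconv_le[OF assms(1)])
  also have "\<dots> \<le> reduced_norm G f1 * (reduced_norm G f2 * norm \<xi>)"
    by (intro mult_left_mono norm_lconv_le assms reduced_norm_nonneg)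
  finally show "norm (lconv G (conv G f1 f2) \<xi>) \<le> reduced_norm G f1 * reduced_norm G f2 * norm \<xi>"
    by (simp add: lconv_conv assms bounded_functionsD mult.assoc)
qed

text \<open>The value at \<open>g\<close> is a matrix coefficient, between the point masses at \<open>g\<close> and at its domain.\<close>

lemma cmod_le_reduced_norm:
  assumes "f \<in> bounded_functions G"
  shows "cmod (f g) \<le> reduced_norm G f"
proof (cases "g \<in> C")
  case True
  have "cmod (f g) = cmod (coord (lconv G f (delta (d g))) g)"
    by (simp add: coord_lconv_delta bounded_functionsD(2)[OF assms] True)
  also have "\<dots> \<le> norm (lconv G f (delta (d g)))" by (rule coord_le_norm)
  also have "\<dots> \<le> reduced_norm G f * norm (delta (d g))" by (rule norm_lconv_le[OF assms])
  finally show ?thesis by simp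
next
  case False
  then show ?thesis by (simp add: bounded_functionsD(3)[OF assms] reduced_norm_nonneg[OF assms])
qed

lemma reduced_norm_eq_0:
  assumes "f \<in> bounded_functions G" "reduced_norm G f = 0"
  shows "f = (\<lambda>g. 0)"
  using cmod_le_reduced_norm[OF assms(1)] assms(2) by auto

text \<open>Convolution by a function on a bisection moves each coordinate to another place, injectively, and
  multiplies it by a value of the function.\<close>

lemma bisection_bounded:
  assumes V: "V \<subseteq> C" "inj_on r V" "inj_on d V" and f: "\<And>g. g \<notin> V \<Longrightarrow> f g = 0"
    and m: "\<And>g. cmod (f g) \<le> m"
  shows "f \<in> bounded_functions G" "reduced_norm G f \<le> m"
proof -
  have m0: "0 \<le> m" using m[of undefined] norm_ge_zero order_trans by blast
  have one: "finite A" if "\<And>a b. a \<in> A \<Longrightarrow> b \<in> A \<Longrightarrow> a = b" for A :: "'g set"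
  proof (cases "A = {}")
    case False
    then obtain a where "a \<in> A" by blast
    then have "A \<subseteq> {a}" using that by blast
    then show ?thesis by (rule finite_subset) simp
  qed simp
  have row: "row_finite G f" unfolding row_finite_def
  proof (intro allI one)
    fix x a b assume "a \<in> {h \<in> C. r h = x \<and> f h \<noteq> 0}" "b \<in> {h \<in> C. r h = x \<and> f h \<noteq> 0}"
    then have "a \<in> V" "b \<in> V" "r a = r b" using f by auto
    then show "a = b" using V(2) by (metis inj_onD)
  qed
  have col: "column_finite G f" unfolding column_finite_def
  proof (intro allI one)
    fix x a b assume "a \<in> {h \<in> C. d h = x \<and> f h \<noteq> 0}" "b \<in> {h \<in> C. d h = x \<and> f h \<noteq> 0}"
    then have "a \<in> V" "b \<in> V" "d a = d b" using f by auto
    then show "a = b" using V(3) by (metis inj_onD)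
  qed
  have le: "norm (lconv G f \<xi>) \<le> m * norm \<xi>" for \<xi>
  proof -
    let ?T = "{g. coord (lconv G f \<xi>) g \<noteq> 0}"
    define s where "s g = (THE h. h \<in> V \<and> r h = r g)" for g
    have s: "s g = h" if "h \<in> V" "r h = r g" for g h
      unfolding s_def using that by (intro the_equality) (metis inj_onD[OF V(2)])+
    have T: "s g \<in> V" "r (s g) = r g" "g \<in> C" "coord (lconv G f \<xi>) g = f (s g) * coord \<xi> (inv' (s g) \<cdot> g)"
      if "g \<in> ?T" for g
    proof -
      have nz: "conv G f (coord \<xi>) g \<noteq> 0" using that by (simp add: coord_lconv_conv col)
      obtain h k where hk: "h \<in> C" "k \<in> C" "d h = r k" "g = h \<cdot> k" "f h \<noteq> 0"
        by (rule conv_support[OF row nz])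
      then have hV: "h \<in> V" "r h = r g" using f by auto
      then have sg: "s g = h" using s by blast
      show gC: "g \<in> C" using hk by simp
      show "s g \<in> V" "r (s g) = r g" using sg hV by simp_all
      have "conv G f (coord \<xi>) g = (\<Sum>h\<in>{s g}. f h * coord \<xi> (inv' h \<cdot> g))"
      proof (rule conv_row[OF _ _ _ gC])
        show "f h' = 0" if "h' \<in> C" "r h' = r g" "h' \<notin> {s g}" for h' using that f s by blast
      qed (use hV sg hk in auto)
      then show "coord (lconv G f \<xi>) g = f (s g) * coord \<xi> (inv' (s g) \<cdot> g)"
        by (simp add: coord_lconv_conv col)
    qed
    have inj: "inj_on (\<lambda>g. inv' (s g) \<cdot> g) ?T"
    proof (rule inj_onI)
      fix g g' assume g: "g \<in> ?T" and g': "g' \<in> ?T" and eq: "inv' (s g) \<cdot> g = inv' (s g') \<cdot> g'"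
      note a = T(1-3)[OF g] T(1-3)[OF g']
      have sC: "s g \<in> C" "s g' \<in> C" using a V(1) by auto
      have "d (s g) = r (inv' (s g) \<cdot> g)" using a sC by simp
      also have "\<dots> = d (s g')" unfolding eq using a sC by simp
      finally have "s g = s g'" using a V(3) by (metis inj_onD)
      moreover have "s g \<cdot> (inv' (s g) \<cdot> g) = g" "s g' \<cdot> (inv' (s g') \<cdot> g') = g'"
        using a sC by (intro times_quotient; simp)+
      ultimately show "g = g'" using eq by metis
    qed
    have "(norm (lconv G f \<xi>))\<^sup>2 = (\<Sum>g\<in>?T. (cmod (coord (lconv G f \<xi>) g))\<^sup>2)"
      by (rule norm_fvec_superset[OF finite_coord coord_support])
    also have "\<dots> \<le> (\<Sum>g\<in>?T. m\<^sup>2 * (cmod (coord \<xi> (inv' (s g) \<cdot> g)))\<^sup>2)"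
    proof (rule sum_mono)
      fix g assume g: "g \<in> ?T"
      have "(cmod (coord (lconv G f \<xi>) g))\<^sup>2 = (cmod (f (s g)))\<^sup>2 * (cmod (coord \<xi> (inv' (s g) \<cdot> g)))\<^sup>2"
        unfolding T(4)[OF g] by (simp add: norm_mult power_mult_distrib)
      also have "\<dots> \<le> m\<^sup>2 * (cmod (coord \<xi> (inv' (s g) \<cdot> g)))\<^sup>2"
        using m by (intro mult_right_mono power_mono) auto
      finally show "(cmod (coord (lconv G f \<xi>) g))\<^sup>2 \<le> m\<^sup>2 * (cmod (coord \<xi> (inv' (s g) \<cdot> g)))\<^sup>2" .
    qed
    also have "\<dots> = m\<^sup>2 * (\<Sum>k\<in>(\<lambda>g. inv' (s g) \<cdot> g) ` ?T. (cmod (coord \<xi> k))\<^sup>2)"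
      by (simp add: sum_distrib_left sum.reindex[OF inj])
    also have "\<dots> \<le> m\<^sup>2 * (norm \<xi>)\<^sup>2"
      by (intro mult_left_mono sum_coord_le_norm finite_imageI finite_coord) simp
    finally have "(norm (lconv G f \<xi>))\<^sup>2 \<le> (m * norm \<xi>)\<^sup>2" by (simp add: power_mult_distrib)
    then show ?thesis by (rule power2_le_imp_le) (simp add: m0)
  qed
  show "f \<in> bounded_functions G"
    using row col le f V(1) by (intro bounded_functionsI) auto
  then show "reduced_norm G f \<le> m" using m0 le by (rule reduced_norm_leI)
qed

end


section \<open>Completions of normed algebras\<close>

locale normed_nalg =
  fixes A :: "'a nalg"
  assumes zero_closed [simp]: "azero A \<in> acarrier A"
    and add_closed [simp]: "\<lbrakk>x \<in> acarrier A; y \<in> acarrier A\<rbrakk> \<Longrightarrow> aadd A x y \<in> acarrier A"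
    and scale_closed [simp]: "x \<in> acarrier A \<Longrightarrow> ascale A c x \<in> acarrier A"
    and mult_closed [simp]: "\<lbrakk>x \<in> acarrier A; y \<in> acarrier A\<rbrakk> \<Longrightarrow> amult A x y \<in> acarrier A"
    and add_assoc: "\<lbrakk>x \<in> acarrier A; y \<in> acarrier A; z \<in> acarrier A\<rbrakk>
      \<Longrightarrow> aadd A (aadd A x y) z = aadd A x (aadd A y z)"
    and add_comm: "\<lbrakk>x \<in> acarrier A; y \<in> acarrier A\<rbrakk> \<Longrightarrow> aadd A x y = aadd A y x"
    and add_zero [simp]: "x \<in> acarrier A \<Longrightarrow> aadd A x (azero A) = x"
    and scale_right: "\<lbrakk>x \<in> acarrier A; y \<in> acarrier A\<rbrakk>
      \<Longrightarrow> ascale A c (aadd A x y) = aadd A (ascale A c x) (ascale A c y)"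
    and scale_left: "x \<in> acarrier A \<Longrightarrow> ascale A (b + c) x = aadd A (ascale A b x) (ascale A c x)"
    and scale_scale [simp]: "x \<in> acarrier A \<Longrightarrow> ascale A b (ascale A c x) = ascale A (b * c) x"
    and scale_one [simp]: "x \<in> acarrier A \<Longrightarrow> ascale A 1 x = x"
    and scale_zero [simp]: "x \<in> acarrier A \<Longrightarrow> ascale A 0 x = azero A"
    and mult_add_left: "\<lbrakk>x \<in> acarrier A; y \<in> acarrier A; z \<in> acarrier A\<rbrakk>
      \<Longrightarrow> amult A (aadd A x y) z = aadd A (amult A x z) (amult A y z)"
    and mult_add_right: "\<lbrakk>x \<in> acarrier A; y \<in> acarrier A; z \<in> acarrier A\<rbrakk>
      \<Longrightarrow> amult A x (aadd A y z) = aadd A (amult A x y) (amult A x z)"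
    and mult_scale_left: "\<lbrakk>x \<in> acarrier A; y \<in> acarrier A\<rbrakk>
      \<Longrightarrow> amult A (ascale A c x) y = ascale A c (amult A x y)"
    and mult_scale_right: "\<lbrakk>x \<in> acarrier A; y \<in> acarrier A\<rbrakk>
      \<Longrightarrow> amult A x (ascale A c y) = ascale A c (amult A x y)"
    and norm_add: "\<lbrakk>x \<in> acarrier A; y \<in> acarrier A\<rbrakk> \<Longrightarrow> anorm A (aadd A x y) \<le> anorm A x + anorm A y"
    and norm_scale [simp]: "x \<in> acarrier A \<Longrightarrow> anorm A (ascale A c x) = cmod c * anorm A x"
    and norm_mult: "\<lbrakk>x \<in> acarrier A; y \<in> acarrier A\<rbrakk> \<Longrightarrow> anorm A (amult A x y) \<le> anorm A x * anorm A y"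
    and norm_eq_0: "\<lbrakk>x \<in> acarrier A; anorm A x = 0\<rbrakk> \<Longrightarrow> x = azero A"
begin

abbreviation sub where "sub x y \<equiv> aadd A x (ascale A (- 1) y)"

lemma add_left_comm:
  "\<lbrakk>x \<in> acarrier A; y \<in> acarrier A; z \<in> acarrier A\<rbrakk> \<Longrightarrow> aadd A x (aadd A y z) = aadd A y (aadd A x z)"
  by (metis add_assoc add_comm)

lemmas add_ac = add_assoc add_comm add_left_comm

lemma zero_add [simp]: "x \<in> acarrier A \<Longrightarrow> aadd A (azero A) x = x"
  by (simp add: add_comm[of "azero A"])

lemma sub_self [simp]: "x \<in> acarrier A \<Longrightarrow> sub x x = azero A"
  using scale_left[of x 1 "- 1"] by simp

lemma sub_self' [simp]: "x \<in> acarrier A \<Longrightarrow> aadd A (ascale A (- 1) x) x = azero A"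
  using scale_left[of x "- 1" 1] by simp

lemma cancel [simp]:
  "x \<in> acarrier A \<Longrightarrow> y \<in> acarrier A \<Longrightarrow> aadd A x (aadd A (ascale A (- 1) x) y) = y"
  "x \<in> acarrier A \<Longrightarrow> y \<in> acarrier A \<Longrightarrow> aadd A (ascale A (- 1) x) (aadd A x y) = y"
  using add_assoc[of x "ascale A (- 1) x" y] add_assoc[of "ascale A (- 1) x" x y] by simp_all

lemma scale_azero [simp]: "ascale A c (azero A) = azero A"
  using scale_scale[of "azero A" c 0] by simp

lemma norm_zero [simp]: "anorm A (azero A) = 0"
  using norm_scale[of "azero A" 0] by simp

lemma norm_nonneg [simp]: "x \<in> acarrier A \<Longrightarrow> 0 \<le> anorm A x"
  using norm_add[of x "ascale A (- 1) x"] by simp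

lemma adist_self [simp]: "x \<in> acarrier A \<Longrightarrow> adist A x x = 0"
  by (simp add: adist_def)

lemma adist_zero [simp]: "x \<in> acarrier A \<Longrightarrow> adist A x (azero A) = anorm A x"
  by (simp add: adist_def)

lemma adist_nonneg [simp]: "x \<in> acarrier A \<Longrightarrow> y \<in> acarrier A \<Longrightarrow> 0 \<le> adist A x y"
  by (simp add: adist_def)

lemma adist_commute:
  assumes "x \<in> acarrier A" "y \<in> acarrier A"
  shows "adist A x y = adist A y x"
proof -
  have "sub x y = ascale A (- 1) (sub y x)" using assms by (simp add: scale_right add_comm)
  then show ?thesis using assms by (simp add: adist_def)
qed

lemma adist_triangle:
  assumes "x \<in> acarrier A" "y \<in> acarrier A" "z \<in> acarrier A"
  shows "adist A x z \<le> adist A x y + adist A y z"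
proof -
  have "sub x z = aadd A (sub x y) (sub y z)" using assms by (simp add: add_assoc)
  then show ?thesis using assms norm_add[of "sub x y" "sub y z"] by (simp add: adist_def)
qed

lemma adist_eq_0:
  assumes "x \<in> acarrier A" "y \<in> acarrier A" "adist A x y = 0"
  shows "x = y"
proof -
  have "sub x y = azero A" using assms by (intro norm_eq_0) (simp_all add: adist_def)
  then have "aadd A (sub x y) y = y" using assms by simp
  then show ?thesis using assms by (simp add: add_assoc)
qed

lemma adist_le_0: "x \<in> acarrier A \<Longrightarrow> y \<in> acarrier A \<Longrightarrow> (\<And>e. e > 0 \<Longrightarrow> adist A x y \<le> e) \<Longrightarrow> x = y"
  by (meson adist_eq_0 adist_nonneg antisym dense_ge)

lemma adist_add:
  assumes "x \<in> acarrier A" "y \<in> acarrier A" "x' \<in> acarrier A" "y' \<in> acarrier A"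
  shows "adist A (aadd A x y) (aadd A x' y') \<le> adist A x x' + adist A y y'"
proof -
  have "sub (aadd A x y) (aadd A x' y') = aadd A (sub x x') (sub y y')"
    using assms by (simp add: scale_right add_ac)
  then show ?thesis using assms norm_add[of "sub x x'" "sub y y'"] by (simp add: adist_def)
qed

lemma adist_scale:
  assumes "x \<in> acarrier A" "y \<in> acarrier A"
  shows "adist A (ascale A c x) (ascale A c y) = cmod c * adist A x y"
proof -
  have "sub (ascale A c x) (ascale A c y) = ascale A c (sub x y)" using assms by (simp add: scale_right)
  then show ?thesis using assms by (simp add: adist_def)
qed

lemma adist_mult:
  assumes "x \<in> acarrier A" "y \<in> acarrier A" "x' \<in> acarrier A" "y' \<in> acarrier A"
  shows "adist A (amult A x y) (amult A x' y') \<le> anorm A x * adist A y y' + adist A x x' * anorm A y'"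
proof -
  have "sub (amult A x y) (amult A x' y') = aadd A (amult A x (sub y y')) (amult A (sub x x') y')"
    using assms by (simp add: mult_add_left mult_add_right mult_scale_left mult_scale_right add_assoc)
  then have "adist A (amult A x y) (amult A x' y')
      \<le> anorm A (amult A x (sub y y')) + anorm A (amult A (sub x x') y')"
    unfolding adist_def using assms by (simp add: norm_add)
  also have "\<dots> \<le> anorm A x * adist A y y' + adist A x x' * anorm A y'"
    unfolding adist_def using assms by (intro add_mono norm_mult) simp_all
  finally show ?thesis .
qed

lemma norm_diff_le:
  assumes "x \<in> acarrier A" "y \<in> acarrier A"
  shows "\<bar>anorm A x - anorm A y\<bar> \<le> adist A x y"
  using adist_triangle[of x y "azero A"] adist_triangle[of y x "azero A"] adist_commute[of x y] assms
  by simp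

definition cls where "cls s = null_rel A `` {s}"

lemma cauchyD: "s \<in> cauchy_seqs A \<Longrightarrow> s n \<in> acarrier A"
  by (simp add: cauchy_seqs_def)

lemma cauchy_dist:
  assumes "s \<in> cauchy_seqs A" "0 < e"
  obtains N where "\<And>m n. N \<le> m \<Longrightarrow> N \<le> n \<Longrightarrow> adist A (s m) (s n) < e"
  using assms unfolding cauchy_seqs_def by blast

lemma cauchy_bounded:
  assumes "s \<in> cauchy_seqs A"
  obtains K where "0 < K" "\<And>n. anorm A (s n) \<le> K"
proof -
  obtain N where N: "\<And>m n. N \<le> m \<Longrightarrow> N \<le> n \<Longrightarrow> adist A (s m) (s n) < 1"
    using cauchy_dist[OF assms, of 1] by auto
  note c = cauchyD[OF assms]
  let ?K = "(\<Sum>n\<le>N. anorm A (s n)) + 1"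
  have "anorm A (s n) \<le> ?K" for n
  proof (cases "n \<le> N")
    case True
    then have "anorm A (s n) \<le> (\<Sum>n\<le>N. anorm A (s n))" using c by (intro member_le_sum) auto
    then show ?thesis by simp
  next
    case False
    then have "anorm A (s n) \<le> anorm A (s N) + 1"
      using N[of n N] norm_diff_le[OF c c, of n N] by simp
    moreover have "anorm A (s N) \<le> (\<Sum>n\<le>N. anorm A (s n))" using c by (intro member_le_sum) auto
    ultimately show ?thesis by simp
  qed
  moreover have "0 < ?K" using c by (intro add_nonneg_pos sum_nonneg) auto
  ultimately show ?thesis by (intro that)
qed

lemma cauchy_seqsI:
  assumes "\<And>n. s n \<in> acarrier A"
    and "\<And>e. e > 0 \<Longrightarrow> \<exists>N. \<forall>m\<ge>N. \<forall>n\<ge>N. adist A (s m) (s n) < e"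
  shows "s \<in> cauchy_seqs A"
  using assms by (simp add: cauchy_seqs_def)

lemma const_cauchy [simp]: "x \<in> acarrier A \<Longrightarrow> (\<lambda>n. x) \<in> cauchy_seqs A"
  by (intro cauchy_seqsI) auto

lemma add_cauchy [simp]:
  assumes s: "s \<in> cauchy_seqs A" and t: "t \<in> cauchy_seqs A"
  shows "(\<lambda>n. aadd A (s n) (t n)) \<in> cauchy_seqs A"
proof (rule cauchy_seqsI)
  fix e :: real assume "e > 0"
  then have e: "e / 2 > 0" by simp
  obtain N1 N2 where N: "\<And>m n. N1 \<le> m \<Longrightarrow> N1 \<le> n \<Longrightarrow> adist A (s m) (s n) < e / 2"
    "\<And>m n. N2 \<le> m \<Longrightarrow> N2 \<le> n \<Longrightarrow> adist A (t m) (t n) < e / 2"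
    using cauchy_dist[OF s e] cauchy_dist[OF t e] by metis
  have "adist A (aadd A (s m) (t m)) (aadd A (s n) (t n)) < e" if "m \<ge> max N1 N2" "n \<ge> max N1 N2" for m n
    using adist_add[OF cauchyD[OF s] cauchyD[OF t] cauchyD[OF s] cauchyD[OF t], of m m n n]
      N(1)[of m n] N(2)[of m n] that by simp
  then show "\<exists>N. \<forall>m\<ge>N. \<forall>n\<ge>N. adist A (aadd A (s m) (t m)) (aadd A (s n) (t n)) < e" by blast
qed (simp add: cauchyD s t)

lemma scale_cauchy [simp]:
  assumes s: "s \<in> cauchy_seqs A"
  shows "(\<lambda>n. ascale A c (s n)) \<in> cauchy_seqs A"
proof (rule cauchy_seqsI)
  fix e :: real assume "e > 0"
  then have e: "e / (cmod c + 1) > 0" by (simp add: add_nonneg_pos)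
  obtain N where N: "\<And>m n. N \<le> m \<Longrightarrow> N \<le> n \<Longrightarrow> adist A (s m) (s n) < e / (cmod c + 1)"
    using cauchy_dist[OF s e] by metis
  have "adist A (ascale A c (s m)) (ascale A c (s n)) < e" if "m \<ge> N" "n \<ge> N" for m n
  proof -
    have "cmod c * adist A (s m) (s n) \<le> (cmod c + 1) * adist A (s m) (s n)"
      using cauchyD[OF s] by (intro mult_right_mono) auto
    also have "\<dots> < e" using N[OF that] by (simp add: pos_less_divide_eq add_nonneg_pos mult.commute)
    finally show ?thesis by (simp add: adist_scale cauchyD s)
  qed
  then show "\<exists>N. \<forall>m\<ge>N. \<forall>n\<ge>N. adist A (ascale A c (s m)) (ascale A c (s n)) < e" by blast
qed (simp add: cauchyD s)

lemma mult_cauchy [simp]: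
  assumes s: "s \<in> cauchy_seqs A" and t: "t \<in> cauchy_seqs A"
  shows "(\<lambda>n. amult A (s n) (t n)) \<in> cauchy_seqs A"
proof (rule cauchy_seqsI)
  obtain K L where KL: "0 < K" "\<And>n. anorm A (s n) \<le> K" "0 < L" "\<And>n. anorm A (t n) \<le> L"
    using cauchy_bounded[OF s] cauchy_bounded[OF t] by metis
  fix e :: real assume "e > 0"
  then have e: "e / (K + L) > 0" using KL by simp
  obtain N1 N2 where N: "\<And>m n. N1 \<le> m \<Longrightarrow> N1 \<le> n \<Longrightarrow> adist A (s m) (s n) < e / (K + L)"
    "\<And>m n. N2 \<le> m \<Longrightarrow> N2 \<le> n \<Longrightarrow> adist A (t m) (t n) < e / (K + L)"
    using cauchy_dist[OF s e] cauchy_dist[OF t e] by metis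
  have "adist A (amult A (s m) (t m)) (amult A (s n) (t n)) < e" if "m \<ge> max N1 N2" "n \<ge> max N1 N2" for m n
  proof -
    note c = cauchyD[OF s] cauchyD[OF t]
    have "adist A (amult A (s m) (t m)) (amult A (s n) (t n))
        \<le> anorm A (s m) * adist A (t m) (t n) + adist A (s m) (s n) * anorm A (t n)"
      by (rule adist_mult) (simp_all add: c)
    also have "\<dots> \<le> K * adist A (t m) (t n) + adist A (s m) (s n) * L"
      using KL c by (intro add_mono mult_mono) (auto intro: less_imp_le)
    also have "\<dots> < K * (e / (K + L)) + (e / (K + L)) * L"
      using KL N(1)[of m n] N(2)[of m n] that
      by (intro add_strict_mono mult_strict_left_mono mult_strict_right_mono) auto
    also have "\<dots> = (K + L) * (e / (K + L))" by (simp only: distrib_right mult.commute)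
    also have "\<dots> = e" using KL by simp
    finally show ?thesis .
  qed
  then show "\<exists>N. \<forall>m\<ge>N. \<forall>n\<ge>N. adist A (amult A (s m) (t m)) (amult A (s n) (t n)) < e" by blast
qed (simp add: cauchyD s t)

lemma null_relI:
  "s \<in> cauchy_seqs A \<Longrightarrow> t \<in> cauchy_seqs A \<Longrightarrow> (\<lambda>n. adist A (s n) (t n)) \<longlonglongrightarrow> 0 \<Longrightarrow> (s, t) \<in> null_rel A"
  by (simp add: null_rel_def)

lemma null_relD:
  assumes "(s, t) \<in> null_rel A"
  shows "s \<in> cauchy_seqs A" "t \<in> cauchy_seqs A" "(\<lambda>n. adist A (s n) (t n)) \<longlonglongrightarrow> 0"
  using assms by (simp_all add: null_rel_def)

lemma null_squeeze:
  assumes "u \<longlonglongrightarrow> 0" "\<And>n. adist A (s n) (t n) \<le> u n" "\<And>n. s n \<in> acarrier A" "\<And>n. t n \<in> acarrier A"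
  shows "(\<lambda>n. adist A (s n) (t n)) \<longlonglongrightarrow> 0"
  by (rule tendsto_sandwich[OF _ _ tendsto_const assms(1)]) (simp_all add: assms)

text \<open>The quotient in the definition of the completion is taken by an equivalence relation, so that operations may be
  computed on representatives.\<close>

lemma equiv_null_rel: "equiv (cauchy_seqs A) (null_rel A)"
proof (rule equivI)
  show "null_rel A \<subseteq> cauchy_seqs A \<times> cauchy_seqs A" by (auto simp: null_rel_def)
  show "refl_on (cauchy_seqs A) (null_rel A)"
    by (auto simp: refl_on_def null_rel_def cauchyD)
  show "sym (null_rel A)"
    by (rule symI) (auto simp: null_rel_def adist_commute cauchyD)
  show "trans (null_rel A)"
  proof (rule transI)
    fix s t w assume st: "(s, t) \<in> null_rel A" and tw: "(t, w) \<in> null_rel A"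
    note c = null_relD[OF st] null_relD[OF tw]
    have "(\<lambda>n. adist A (s n) (w n)) \<longlonglongrightarrow> 0"
      using tendsto_add[OF c(3) c(6)] by (intro null_squeeze) (auto intro: adist_triangle cauchyD c)
    then show "(s, w) \<in> null_rel A" using c by (intro null_relI)
  qed
qed

lemma cls_eq_iff:
  "s \<in> cauchy_seqs A \<Longrightarrow> t \<in> cauchy_seqs A \<Longrightarrow> cls s = cls t \<longleftrightarrow> (\<lambda>n. adist A (s n) (t n)) \<longlonglongrightarrow> 0"
  unfolding cls_def using eq_equiv_class_iff[OF equiv_null_rel, of s t] by (auto simp: null_rel_def)

lemma cls_eqI: "(s, t) \<in> null_rel A \<Longrightarrow> cls s = cls t"
  unfolding cls_def by (rule equiv_class_eq[OF equiv_null_rel])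

lemma carrier_completion: "acarrier (completion A) = cls ` cauchy_seqs A"
  by (auto simp: completion_def quotient_def cls_def)

lemma cls_closed [simp]: "s \<in> cauchy_seqs A \<Longrightarrow> cls s \<in> acarrier (completion A)"
  by (simp add: carrier_completion)

lemma zero_completion: "azero (completion A) = cls (\<lambda>n. azero A)"
  by (simp add: completion_def cls_def)

lemma add_completion:
  assumes "s \<in> cauchy_seqs A" "t \<in> cauchy_seqs A"
  shows "aadd (completion A) (cls s) (cls t) = cls (\<lambda>n. aadd A (s n) (t n))"
proof -
  have resp: "(\<lambda>s t. cls (\<lambda>n. aadd A (s n) (t n))) respects2 (null_rel A)"
  proof (rule congruent2I'[OF cls_eqI], rule null_relI)
    fix s s' t t' assume st: "(s, s') \<in> null_rel A" "(t, t') \<in> null_rel A"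
    note c = null_relD[OF st(1)] null_relD[OF st(2)]
    show "(\<lambda>n. adist A (aadd A (s n) (t n)) (aadd A (s' n) (t' n))) \<longlonglongrightarrow> 0"
      using tendsto_add[OF c(3) c(6)] by (intro null_squeeze) (auto intro: adist_add add_closed cauchyD c)
    show "(\<lambda>n. aadd A (s n) (t n)) \<in> cauchy_seqs A" "(\<lambda>n. aadd A (s' n) (t' n)) \<in> cauchy_seqs A"
      using c by auto
  qed
  show ?thesis
    unfolding completion_def using UN_equiv_class2[OF equiv_null_rel equiv_null_rel resp assms]
    by (simp add: cls_def)
qed

lemma scale_completion:
  assumes "s \<in> cauchy_seqs A"
  shows "ascale (completion A) c (cls s) = cls (\<lambda>n. ascale A c (s n))"
proof -
  have resp: "(\<lambda>s. cls (\<lambda>n. ascale A c (s n))) respects (null_rel A)"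
  proof (rule congruentI, rule cls_eqI, rule null_relI)
    fix s t assume st: "(s, t) \<in> null_rel A"
    note d = null_relD[OF st]
    show "(\<lambda>n. adist A (ascale A c (s n)) (ascale A c (t n))) \<longlonglongrightarrow> 0"
      using tendsto_mult_left[OF d(3), of "cmod c"] by (simp add: adist_scale cauchyD d)
    show "(\<lambda>n. ascale A c (s n)) \<in> cauchy_seqs A" "(\<lambda>n. ascale A c (t n)) \<in> cauchy_seqs A"
      using d by auto
  qed
  show ?thesis
    unfolding completion_def using UN_equiv_class[OF equiv_null_rel resp assms] by (simp add: cls_def)
qed

lemma mult_completion:
  assumes "s \<in> cauchy_seqs A" "t \<in> cauchy_seqs A"
  shows "amult (completion A) (cls s) (cls t) = cls (\<lambda>n. amult A (s n) (t n))"
proof -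
  have resp: "(\<lambda>s t. cls (\<lambda>n. amult A (s n) (t n))) respects2 (null_rel A)"
  proof (rule congruent2I'[OF cls_eqI], rule null_relI)
    fix s s' t t' assume st: "(s, s') \<in> null_rel A" "(t, t') \<in> null_rel A"
    note c = null_relD[OF st(1)] null_relD[OF st(2)]
    obtain K L where KL: "0 < K" "\<And>n. anorm A (s n) \<le> K" "0 < L" "\<And>n. anorm A (t' n) \<le> L"
      using cauchy_bounded[OF c(1)] cauchy_bounded[OF c(5)] by metis
    show "(\<lambda>n. adist A (amult A (s n) (t n)) (amult A (s' n) (t' n))) \<longlonglongrightarrow> 0"
    proof (rule null_squeeze)
      show "(\<lambda>n. K * adist A (t n) (t' n) + adist A (s n) (s' n) * L) \<longlonglongrightarrow> 0"
        using tendsto_add[OF tendsto_mult_left[OF c(6), of K] tendsto_mult_right[OF c(3), of L]] by simp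
      show "adist A (amult A (s n) (t n)) (amult A (s' n) (t' n))
          \<le> K * adist A (t n) (t' n) + adist A (s n) (s' n) * L" for n
        using KL c
        by (intro order_trans[OF adist_mult] add_mono mult_mono)
          (auto intro: cauchyD less_imp_le adist_nonneg norm_nonneg)
    qed (auto intro: cauchyD c mult_closed)
    show "(\<lambda>n. amult A (s n) (t n)) \<in> cauchy_seqs A" "(\<lambda>n. amult A (s' n) (t' n)) \<in> cauchy_seqs A"
      using c by auto
  qed
  show ?thesis
    unfolding completion_def using UN_equiv_class2[OF equiv_null_rel equiv_null_rel resp assms]
    by (simp add: cls_def)
qed

lemma norm_completion:
  assumes s: "s \<in> cauchy_seqs A"
  shows "(\<lambda>n. anorm A (s n)) \<longlonglongrightarrow> anorm (completion A) (cls s)"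
proof -
  have "Cauchy (\<lambda>n. anorm A (s n))"
  proof (rule metric_CauchyI)
    fix e :: real assume "e > 0"
    then obtain N where N: "\<And>m n. N \<le> m \<Longrightarrow> N \<le> n \<Longrightarrow> adist A (s m) (s n) < e"
      using cauchy_dist[OF s] by metis
    show "\<exists>M. \<forall>m\<ge>M. \<forall>n\<ge>M. dist (anorm A (s m)) (anorm A (s n)) < e"
      using N norm_diff_le[OF cauchyD[OF s] cauchyD[OF s]] by (metis dist_real_def order_le_less_trans)
  qed
  then obtain l where l: "(\<lambda>n. anorm A (s n)) \<longlonglongrightarrow> l"
    using real_Cauchy_convergent convergent_def by blast
  have "(\<lambda>n. anorm A (t n)) \<longlonglongrightarrow> l" if "t \<in> cls s" for t
  proof -
    have st: "(s, t) \<in> null_rel A" using that by (simp add: cls_def)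
    note d = null_relD[OF st]
    have "(\<lambda>n. anorm A (s n) - anorm A (t n)) \<longlonglongrightarrow> 0"
      by (rule Lim_null_comparison[OF always_eventually d(3)]) (simp add: norm_diff_le cauchyD d)
    from tendsto_diff[OF l this] show ?thesis by simp
  qed
  moreover have "s \<in> cls s" unfolding cls_def using s by (simp add: null_rel_def cauchyD)
  ultimately have "anorm (completion A) (cls s) = l" unfolding completion_def
    using l by (auto intro!: the_equality dest: LIMSEQ_unique)
  then show ?thesis using l by simp
qed

lemma norm_completion_eqI:
  "s \<in> cauchy_seqs A \<Longrightarrow> (\<lambda>n. anorm A (s n)) \<longlonglongrightarrow> l \<Longrightarrow> anorm (completion A) (cls s) = l"
  using norm_completion LIMSEQ_unique by blast

lemma adist_completion:
  assumes "s \<in> cauchy_seqs A" "t \<in> cauchy_seqs A"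
  shows "(\<lambda>n. adist A (s n) (t n)) \<longlonglongrightarrow> adist (completion A) (cls s) (cls t)"
  unfolding adist_def using assms
  by (simp add: scale_completion add_completion norm_completion)

theorem normed_nalg_completion: "normed_nalg (completion A)"
proof
  note ops = add_completion scale_completion mult_completion zero_completion cauchyD
  have ex: "\<exists>s\<in>cauchy_seqs A. X = cls s" if "X \<in> acarrier (completion A)" for X
    using that by (auto simp: carrier_completion)
  have cong: "cls s = cls t" if "\<And>n. s n = t n" for s t
    using that by (metis ext)
  fix X Y Z b c
  show "azero (completion A) \<in> acarrier (completion A)" by (simp add: ops)
  {
    assume "X \<in> acarrier (completion A)"
    then obtain s where s: "s \<in> cauchy_seqs A" "X = cls s" using ex by blast
    show "ascale (completion A) c X \<in> acarrier (completion A)"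
      "aadd (completion A) X (azero (completion A)) = X"
      "ascale (completion A) (b + c) X = aadd (completion A) (ascale (completion A) b X) (ascale (completion A) c X)"
      "ascale (completion A) b (ascale (completion A) c X) = ascale (completion A) (b * c) X"
      "ascale (completion A) 1 X = X" "ascale (completion A) 0 X = azero (completion A)"
      using s by (simp_all add: ops scale_left)
    show "anorm (completion A) (ascale (completion A) c X) = cmod c * anorm (completion A) X"
      unfolding s(2) scale_completion[OF s(1)] using s(1)
      by (intro norm_completion_eqI) (simp_all add: cauchyD tendsto_mult_left norm_completion)
    show "X = azero (completion A)" if "anorm (completion A) X = 0"
      unfolding s(2) zero_completion using norm_completion[OF s(1)] that s
      by (subst cls_eq_iff) (simp_all add: cauchyD)
    assume "Y \<in> acarrier (completion A)"
    then obtain t where t: "t \<in> cauchy_seqs A" "Y = cls t" using ex by blast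
    show "aadd (completion A) X Y \<in> acarrier (completion A)"
      "amult (completion A) X Y \<in> acarrier (completion A)"
      using s t by (simp_all add: ops)
    show "aadd (completion A) X Y = aadd (completion A) Y X"
      using s t by (simp add: ops add_comm[of "s _" "t _"])
    show
      "ascale (completion A) c (aadd (completion A) X Y)
        = aadd (completion A) (ascale (completion A) c X) (ascale (completion A) c Y)"
      "amult (completion A) (ascale (completion A) c X) Y = ascale (completion A) c (amult (completion A) X Y)"
      "amult (completion A) X (ascale (completion A) c Y) = ascale (completion A) c (amult (completion A) X Y)"
      using s t by (simp_all add: ops scale_right mult_scale_left mult_scale_right)
    show "anorm (completion A) (aadd (completion A) X Y) \<le> anorm (completion A) X + anorm (completion A) Y"
      unfolding s(2) t(2) add_completion[OF s(1) t(1)]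
      by (rule LIMSEQ_le[OF norm_completion tendsto_add[OF norm_completion[OF s(1)] norm_completion[OF t(1)]]])
        (auto intro!: exI[of _ 0] norm_add cauchyD s t add_cauchy)
    show "anorm (completion A) (amult (completion A) X Y) \<le> anorm (completion A) X * anorm (completion A) Y"
      unfolding s(2) t(2) mult_completion[OF s(1) t(1)]
      by (rule LIMSEQ_le[OF norm_completion tendsto_mult[OF norm_completion[OF s(1)] norm_completion[OF t(1)]]])
        (auto intro!: exI[of _ 0] norm_mult cauchyD s t mult_cauchy)
    assume "Z \<in> acarrier (completion A)"
    then obtain w where w: "w \<in> cauchy_seqs A" "Z = cls w" using ex by blast
    show "aadd (completion A) (aadd (completion A) X Y) Z = aadd (completion A) X (aadd (completion A) Y Z)"
      "amult (completion A) (aadd (completion A) X Y) Z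
        = aadd (completion A) (amult (completion A) X Z) (amult (completion A) Y Z)"
      "amult (completion A) X (aadd (completion A) Y Z)
        = aadd (completion A) (amult (completion A) X Y) (amult (completion A) X Z)"
      using s t w by (simp_all add: ops add_assoc mult_add_left mult_add_right)
  }
qed

definition emb where "emb x = cls (\<lambda>n. x)"

lemma emb_closed [simp]: "x \<in> acarrier A \<Longrightarrow> emb x \<in> acarrier (completion A)"
  by (simp add: emb_def)

lemma norm_emb [simp]: "x \<in> acarrier A \<Longrightarrow> anorm (completion A) (emb x) = anorm A x"
  unfolding emb_def by (rule norm_completion_eqI) simp_all

lemma adist_emb [simp]: "x \<in> acarrier A \<Longrightarrow> y \<in> acarrier A \<Longrightarrow> adist (completion A) (emb x) (emb y) = adist A x y"
  unfolding emb_def using adist_completion[of "\<lambda>n. x" "\<lambda>n. y"] by (simp add: LIMSEQ_const_iff)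

lemma emb_add: "x \<in> acarrier A \<Longrightarrow> y \<in> acarrier A \<Longrightarrow> aadd (completion A) (emb x) (emb y) = emb (aadd A x y)"
  and emb_mult: "x \<in> acarrier A \<Longrightarrow> y \<in> acarrier A \<Longrightarrow> amult (completion A) (emb x) (emb y) = emb (amult A x y)"
  and emb_zero: "azero (completion A) = emb (azero A)"
  by (simp_all add: emb_def add_completion scale_completion mult_completion zero_completion)

lemma adist_cls_emb:
  assumes "s \<in> cauchy_seqs A" "0 < e"
  obtains N where "\<And>n. N \<le> n \<Longrightarrow> adist (completion A) (cls s) (emb (s n)) < e"
proof -
  obtain N where N: "\<And>m n. N \<le> m \<Longrightarrow> N \<le> n \<Longrightarrow> adist A (s m) (s n) < e / 2"
    using cauchy_dist[OF assms(1), of "e / 2"] assms(2) by auto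
  have "adist (completion A) (cls s) (emb (s n)) < e" if "N \<le> n" for n
  proof -
    have "(\<lambda>m. adist A (s m) (s n)) \<longlonglongrightarrow> adist (completion A) (cls s) (emb (s n))"
      unfolding emb_def using assms(1) by (intro adist_completion) (auto simp: cauchyD)
    then have "adist (completion A) (cls s) (emb (s n)) \<le> e / 2"
      by (rule LIMSEQ_le_const2) (use N that in \<open>force intro: less_imp_le\<close>)
    then show ?thesis using assms(2) by simp
  qed
  then show ?thesis by (rule that)
qed

lemma emb_dense:
  assumes "X \<in> acarrier (completion A)" "0 < e"
  obtains x where "x \<in> acarrier A" "adist (completion A) X (emb x) < e"
proof -
  obtain s where s: "s \<in> cauchy_seqs A" "X = cls s" using assms(1) by (auto simp: carrier_completion)
  obtain N where "\<And>n. N \<le> n \<Longrightarrow> adist (completion A) (cls s) (emb (s n)) < e"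
    using adist_cls_emb[OF s(1) assms(2)] by blast
  then show ?thesis using that[of "s N"] s by (auto simp: cauchyD)
qed

end

definition complete_nalg :: "'a nalg \<Rightarrow> bool" where
  "complete_nalg A \<longleftrightarrow> (\<forall>s\<in>cauchy_seqs A. \<exists>x\<in>acarrier A. (\<lambda>n. adist A (s n) x) \<longlonglongrightarrow> 0)"

context normed_nalg
begin

text \<open>For a Cauchy sequence \<open>X\<close> this gives completeness; for a constant \<open>X\<close> it represents a point of a closure by a
  sequence from the set whose closure is taken.\<close>

lemma cls_approximation:
  assumes X: "\<And>n. X n \<in> acarrier (completion A)" and a: "\<And>n. a n \<in> acarrier A"
    and XC: "X \<in> cauchy_seqs (completion A)"
    and le: "\<And>n. adist (completion A) (X n) (emb (a n)) < 1 / real (Suc n)"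
  shows "a \<in> cauchy_seqs A" "(\<lambda>n. adist (completion A) (X n) (cls a)) \<longlonglongrightarrow> 0"
proof -
  interpret C: normed_nalg "completion A" by (rule normed_nalg_completion)
  show aC: "a \<in> cauchy_seqs A"
  proof (rule cauchy_seqsI[OF a])
    fix e :: real assume "e > 0"
    then have e: "e / 3 > 0" by simp
    obtain N where N: "\<And>m n. N \<le> m \<Longrightarrow> N \<le> n \<Longrightarrow> adist (completion A) (X m) (X n) < e / 3"
      using C.cauchy_dist[OF XC e] by metis
    obtain M where M: "1 / real (Suc M) < e / 3" using nat_approx_posE[OF e] by metis
    have "adist A (a m) (a n) < e" if "m \<ge> max M N" "n \<ge> max M N" for m n
    proof -
      have small: "adist (completion A) (X k) (emb (a k)) < e / 3" if "k \<ge> M" for k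
      proof -
        have "1 / real (Suc k) \<le> 1 / real (Suc M)" using that by (simp add: frac_le)
        then show ?thesis using le[of k] M by linarith
      qed
      have "adist A (a m) (a n) = adist (completion A) (emb (a m)) (emb (a n))" by (simp add: a)
      also have "\<dots> \<le> adist (completion A) (emb (a m)) (X m) + adist (completion A) (X m) (emb (a n))"
        by (intro C.adist_triangle) (simp_all add: a X)
      also have "adist (completion A) (X m) (emb (a n))
          \<le> adist (completion A) (X m) (X n) + adist (completion A) (X n) (emb (a n))"
        by (intro C.adist_triangle) (simp_all add: a X)
      also have "adist (completion A) (emb (a m)) (X m) = adist (completion A) (X m) (emb (a m))"
        by (intro C.adist_commute) (simp_all add: a X)
      finally show ?thesis using N[of m n] small[of m] small[of n] that by auto
    qed
    then show "\<exists>N. \<forall>m\<ge>N. \<forall>n\<ge>N. adist A (a m) (a n) < e" by blast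
  qed
  show "(\<lambda>n. adist (completion A) (X n) (cls a)) \<longlonglongrightarrow> 0"
  proof (rule C.null_squeeze)
    have "(\<lambda>n. adist (completion A) (emb (a n)) (cls a)) \<longlonglongrightarrow> 0"
    proof (rule LIMSEQ_I)
      fix e :: real assume "e > 0"
      then obtain N where "\<And>n. N \<le> n \<Longrightarrow> adist (completion A) (cls a) (emb (a n)) < e"
        using adist_cls_emb[OF aC] by metis
      then show "\<exists>N. \<forall>n\<ge>N. norm (adist (completion A) (emb (a n)) (cls a) - 0) < e"
        by (auto simp: C.adist_commute[of "emb _" "cls a"] a aC intro!: exI[of _ N])
    qed
    moreover have "(\<lambda>n. 1 / real (Suc n)) \<longlonglongrightarrow> 0"
      using LIMSEQ_inverse_real_of_nat by (simp add: inverse_eq_divide)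
    ultimately show "(\<lambda>n. 1 / real (Suc n) + adist (completion A) (emb (a n)) (cls a)) \<longlonglongrightarrow> 0"
      using tendsto_add by fastforce
    show "adist (completion A) (X n) (cls a)
        \<le> 1 / real (Suc n) + adist (completion A) (emb (a n)) (cls a)" for n
      using C.adist_triangle[of "X n" "emb (a n)" "cls a"] le[of n] X a aC by simp
  qed (simp_all add: X aC)
qed

theorem complete_completion: "complete_nalg (completion A)"
  unfolding complete_nalg_def
proof
  interpret C: normed_nalg "completion A" by (rule normed_nalg_completion)
  fix X assume X: "X \<in> cauchy_seqs (completion A)"
  have "\<exists>x\<in>acarrier A. adist (completion A) (X n) (emb x) < 1 / real (Suc n)" for n
    using emb_dense[of "X n" "1 / real (Suc n)"] C.cauchyD[OF X] by auto
  then obtain a where a: "\<And>n. a n \<in> acarrier A"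
    "\<And>n. adist (completion A) (X n) (emb (a n)) < 1 / real (Suc n)" by metis
  note ap = cls_approximation[OF C.cauchyD[OF X] a(1) X a(2)]
  show "\<exists>x\<in>acarrier (completion A). (\<lambda>n. adist (completion A) (X n) x) \<longlonglongrightarrow> 0"
    by (rule bexI[of _ "cls a"]) (simp_all add: ap)
qed

lemma approximation_sequence:
  assumes X: "X \<in> acarrier (completion A)" and S: "S \<subseteq> acarrier A"
    and ap: "\<And>e. e > 0 \<Longrightarrow> \<exists>f\<in>S. adist (completion A) X (emb f) < e"
  obtains a where "\<And>n. a n \<in> S" "a \<in> cauchy_seqs A" "X = cls a"
proof -
  interpret C: normed_nalg "completion A" by (rule normed_nalg_completion)
  have "\<exists>f\<in>S. adist (completion A) X (emb f) < 1 / real (Suc n)" for n by (rule ap) simp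
  then obtain a where a: "\<And>n. a n \<in> S" "\<And>n. adist (completion A) X (emb (a n)) < 1 / real (Suc n)" by metis
  have aA: "a n \<in> acarrier A" for n using a(1) S by blast
  note ap = cls_approximation[of "\<lambda>n. X", OF X aA C.const_cauchy[OF X] a(2)]
  have "adist (completion A) X (cls a) = 0" using ap(2) LIMSEQ_unique tendsto_const by blast
  then have "X = cls a" using C.adist_eq_0[OF X] ap(1) by simp
  then show ?thesis using that a(1) ap(1) by blast
qed

definition emb_closure :: "'a set \<Rightarrow> (nat \<Rightarrow> 'a) set set" where
  "emb_closure S = {X \<in> acarrier (completion A). \<forall>e>0. \<exists>f\<in>S. adist (completion A) X (emb f) < e}"

text \<open>Elements of the closure are classes of Cauchy sequences in \<open>S\<close>, on which the ideal properties hold termwise.\<close>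

lemma closed_ideal_emb_closure:
  assumes S: "S \<subseteq> acarrier A" "azero A \<in> S" "\<And>x y. x \<in> S \<Longrightarrow> y \<in> S \<Longrightarrow> aadd A x y \<in> S"
    "\<And>c x. x \<in> S \<Longrightarrow> ascale A c x \<in> S"
    "\<And>a x. a \<in> acarrier A \<Longrightarrow> x \<in> S \<Longrightarrow> amult A a x \<in> S \<and> amult A x a \<in> S"
  shows "closed_ideal (completion A) (emb_closure S)"
proof -
  interpret C: normed_nalg "completion A" by (rule normed_nalg_completion)
  have cls_in: "cls a \<in> emb_closure S" if a: "\<And>n. a n \<in> S" "a \<in> cauchy_seqs A" for a
    unfolding emb_closure_def
  proof (intro CollectI conjI allI impI)
    show "cls a \<in> acarrier (completion A)" using a by simp
    fix e :: real assume "e > 0"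
    then obtain N where "\<And>n. N \<le> n \<Longrightarrow> adist (completion A) (cls a) (emb (a n)) < e"
      using adist_cls_emb[OF a(2)] by metis
    then show "\<exists>f\<in>S. adist (completion A) (cls a) (emb f) < e" using a(1) by blast
  qed
  have ex: "\<exists>a. (\<forall>n. a n \<in> S) \<and> a \<in> cauchy_seqs A \<and> X = cls a" if "X \<in> emb_closure S" for X
    using that approximation_sequence[OF _ S(1), of X] unfolding emb_closure_def by blast
  show ?thesis unfolding closed_ideal_def
  proof (intro conjI ballI allI impI)
    show "emb_closure S \<subseteq> acarrier (completion A)" by (auto simp: emb_closure_def)
    show "azero (completion A) \<in> emb_closure S"
      unfolding zero_completion by (rule cls_in) (use S in auto)
    fix X assume "X \<in> emb_closure S"
    then obtain a where a: "\<And>n. a n \<in> S" "a \<in> cauchy_seqs A" "X = cls a" using ex by blast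
    show "ascale (completion A) c X \<in> emb_closure S" for c
      unfolding a(3) scale_completion[OF a(2)] by (rule cls_in) (use S a in auto)
    show "aadd (completion A) X Y \<in> emb_closure S" if Y: "Y \<in> emb_closure S" for Y
    proof -
      obtain b where b: "\<And>n. b n \<in> S" "b \<in> cauchy_seqs A" "Y = cls b" using ex[OF Y] by blast
      show ?thesis unfolding a(3) b(3) add_completion[OF a(2) b(2)] by (rule cls_in) (use S a b in auto)
    qed
    fix Y assume "Y \<in> acarrier (completion A)"
    then obtain b where b: "b \<in> cauchy_seqs A" "Y = cls b" by (auto simp: carrier_completion)
    show "amult (completion A) Y X \<in> emb_closure S"
      unfolding a(3) b(2) mult_completion[OF b(1) a(2)] by (rule cls_in) (use S a b cauchyD in auto)
    show "amult (completion A) X Y \<in> emb_closure S"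
      unfolding a(3) b(2) mult_completion[OF a(2) b(1)] by (rule cls_in) (use S a b cauchyD in auto)
  next
    fix X assume X: "X \<in> acarrier (completion A)" "\<forall>e>0. \<exists>Y\<in>emb_closure S. adist (completion A) X Y < e"
    show "X \<in> emb_closure S" unfolding emb_closure_def
    proof (intro CollectI conjI allI impI X(1))
      fix e :: real assume "e > 0"
      then have e: "e / 2 > 0" by simp
      obtain Y where Y: "Y \<in> emb_closure S" "adist (completion A) X Y < e / 2" using X(2) e by blast
      obtain f where f: "f \<in> S" "adist (completion A) Y (emb f) < e / 2"
        using Y(1) e unfolding emb_closure_def by blast
      have "adist (completion A) X (emb f) < e"
        using C.adist_triangle[of X Y "emb f"] X(1) Y f S(1) by (auto simp: emb_closure_def)
      then show "\<exists>f\<in>S. adist (completion A) X (emb f) < e" using f(1) by blast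
    qed
  qed
qed

end


section \<open>Contractive homomorphisms and closed ideals\<close>

locale contractive_hom = A: normed_nalg A + B: normed_nalg B
  for A :: "'a nalg" and B :: "'b nalg" and \<phi> :: "'a \<Rightarrow> 'b" +
  assumes closed [simp]: "x \<in> acarrier A \<Longrightarrow> \<phi> x \<in> acarrier B"
    and hom_add: "\<lbrakk>x \<in> acarrier A; y \<in> acarrier A\<rbrakk> \<Longrightarrow> \<phi> (aadd A x y) = aadd B (\<phi> x) (\<phi> y)"
    and hom_scale: "x \<in> acarrier A \<Longrightarrow> \<phi> (ascale A c x) = ascale B c (\<phi> x)"
    and hom_mult: "\<lbrakk>x \<in> acarrier A; y \<in> acarrier A\<rbrakk> \<Longrightarrow> \<phi> (amult A x y) = amult B (\<phi> x) (\<phi> y)"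
    and contractive: "x \<in> acarrier A \<Longrightarrow> anorm B (\<phi> x) \<le> anorm A x"
begin

lemma hom_zero [simp]: "\<phi> (azero A) = azero B"
  using hom_scale[of "azero A" 0] by simp

lemma hom_sub: "x \<in> acarrier A \<Longrightarrow> y \<in> acarrier A \<Longrightarrow> \<phi> (A.sub x y) = B.sub (\<phi> x) (\<phi> y)"
  by (simp add: hom_add hom_scale)

lemma adist_le: "x \<in> acarrier A \<Longrightarrow> y \<in> acarrier A \<Longrightarrow> adist B (\<phi> x) (\<phi> y) \<le> adist A x y"
  using contractive[of "A.sub x y"] by (simp add: adist_def hom_sub)

lemma hom_cauchy [simp]:
  assumes s: "s \<in> cauchy_seqs A"
  shows "(\<lambda>n. \<phi> (s n)) \<in> cauchy_seqs B"
proof (rule B.cauchy_seqsI)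
  fix e :: real assume "e > 0"
  then obtain N where "\<And>m n. N \<le> m \<Longrightarrow> N \<le> n \<Longrightarrow> adist A (s m) (s n) < e"
    using A.cauchy_dist[OF s] by metis
  then show "\<exists>N. \<forall>m\<ge>N. \<forall>n\<ge>N. adist B (\<phi> (s m)) (\<phi> (s n)) < e"
    using adist_le[OF A.cauchyD[OF s] A.cauchyD[OF s]] by (meson order_le_less_trans)
qed (simp add: A.cauchyD s)

lemma induced_cls:
  assumes s: "s \<in> cauchy_seqs A"
  shows "induced_map A B \<phi> (A.cls s) = B.cls (\<lambda>n. \<phi> (s n))"
proof -
  have resp: "(\<lambda>s. B.cls (\<lambda>n. \<phi> (s n))) respects (null_rel A)"
  proof (rule congruentI, rule B.cls_eqI, rule B.null_relI)
    fix s t assume st: "(s, t) \<in> null_rel A"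
    note d = A.null_relD[OF st]
    show "(\<lambda>n. adist B (\<phi> (s n)) (\<phi> (t n))) \<longlonglongrightarrow> 0"
      by (rule B.null_squeeze[OF d(3)]) (simp_all add: adist_le A.cauchyD d)
    show "(\<lambda>n. \<phi> (s n)) \<in> cauchy_seqs B" "(\<lambda>n. \<phi> (t n)) \<in> cauchy_seqs B"
      by (rule hom_cauchy[OF d(1)], rule hom_cauchy[OF d(2)])
  qed
  show ?thesis unfolding induced_map_def A.cls_def B.cls_def
    using UN_equiv_class[OF A.equiv_null_rel resp s] by (simp add: B.cls_def)
qed

lemma induced_emb: "x \<in> acarrier A \<Longrightarrow> induced_map A B \<phi> (A.emb x) = B.emb (\<phi> x)"
  unfolding A.emb_def B.emb_def by (simp add: induced_cls)

theorem contractive_hom_induced: "contractive_hom (completion A) (completion B) (induced_map A B \<phi>)"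
proof -
  interpret CA: normed_nalg "completion A" by (rule A.normed_nalg_completion)
  interpret CB: normed_nalg "completion B" by (rule B.normed_nalg_completion)
  note opsA = A.add_completion A.scale_completion A.mult_completion
  note opsB = B.add_completion B.scale_completion B.mult_completion
  show ?thesis
  proof
    fix X Y c assume "X \<in> acarrier (completion A)"
    then obtain s where s: "s \<in> cauchy_seqs A" "X = A.cls s" by (auto simp: A.carrier_completion)
    show "induced_map A B \<phi> X \<in> acarrier (completion B)" using s by (simp add: induced_cls)
    show "induced_map A B \<phi> (ascale (completion A) c X) = ascale (completion B) c (induced_map A B \<phi> X)"
      using s by (simp add: opsA opsB induced_cls hom_scale A.cauchyD)
    show "anorm (completion B) (induced_map A B \<phi> X) \<le> anorm (completion A) X"
      unfolding s(2) induced_cls[OF s(1)]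
      by (rule LIMSEQ_le[OF B.norm_completion A.norm_completion])
        (auto intro!: exI[of _ 0] contractive A.cauchyD hom_cauchy s)
    assume "Y \<in> acarrier (completion A)"
    then obtain t where t: "t \<in> cauchy_seqs A" "Y = A.cls t" by (auto simp: A.carrier_completion)
    show "induced_map A B \<phi> (aadd (completion A) X Y)
        = aadd (completion B) (induced_map A B \<phi> X) (induced_map A B \<phi> Y)"
      "induced_map A B \<phi> (amult (completion A) X Y)
        = amult (completion B) (induced_map A B \<phi> X) (induced_map A B \<phi> Y)"
      using s t by (simp_all add: opsA opsB induced_cls hom_add hom_mult A.cauchyD)
  qed
qed

lemma induced_isometric:
  assumes iso: "\<And>x. x \<in> acarrier A \<Longrightarrow> anorm B (\<phi> x) = anorm A x"
    and X: "X \<in> acarrier (completion A)"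
  shows "anorm (completion B) (induced_map A B \<phi> X) = anorm (completion A) X"
proof -
  obtain s where s: "s \<in> cauchy_seqs A" "X = A.cls s" using X by (auto simp: A.carrier_completion)
  show ?thesis unfolding s(2) induced_cls[OF s(1)]
    using A.norm_completion[OF s(1)] s(1) by (intro B.norm_completion_eqI) (simp_all add: iso A.cauchyD)
qed

lemma isometric_inj:
  assumes iso: "\<And>x. x \<in> acarrier A \<Longrightarrow> anorm B (\<phi> x) = anorm A x"
  shows "inj_on \<phi> (acarrier A)"
proof (rule inj_onI)
  fix x y assume xy: "x \<in> acarrier A" "y \<in> acarrier A" "\<phi> x = \<phi> y"
  have "adist A x y = anorm B (\<phi> (A.sub x y))" using xy by (simp add: adist_def iso)
  also have "\<dots> = 0" using xy by (simp add: hom_sub)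
  finally show "x = y" using xy A.adist_eq_0 by blast
qed

text \<open>An isometry reflects Cauchy sequences, so the limits of sequences in the image come from the completion of the
  source.\<close>

lemma induced_isometric_image:
  assumes iso: "\<And>x. x \<in> acarrier A \<Longrightarrow> anorm B (\<phi> x) = anorm A x"
  shows "induced_map A B \<phi> ` acarrier (completion A) = B.emb_closure (\<phi> ` acarrier A)"
proof
  interpret I: contractive_hom "completion A" "completion B" "induced_map A B \<phi>"
    by (rule contractive_hom_induced)
  show "induced_map A B \<phi> ` acarrier (completion A) \<subseteq> B.emb_closure (\<phi> ` acarrier A)"
  proof
    fix Y assume "Y \<in> induced_map A B \<phi> ` acarrier (completion A)"
    then obtain X where X: "X \<in> acarrier (completion A)" "Y = induced_map A B \<phi> X" by blast
    have "\<exists>f\<in>\<phi> ` acarrier A. adist (completion B) Y (B.emb f) < e" if e: "e > 0" for e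
    proof -
      obtain x where x: "x \<in> acarrier A" "adist (completion A) X (A.emb x) < e"
        using A.emb_dense[OF X(1) e] by blast
      have "adist (completion B) Y (B.emb (\<phi> x)) \<le> adist (completion A) X (A.emb x)"
        using I.adist_le[of X "A.emb x"] X x by (simp add: induced_emb)
      with x show ?thesis by (intro bexI[of _ "\<phi> x"]) auto
    qed
    then show "Y \<in> B.emb_closure (\<phi> ` acarrier A)" using X by (simp add: B.emb_closure_def)
  qed
  show "B.emb_closure (\<phi> ` acarrier A) \<subseteq> induced_map A B \<phi> ` acarrier (completion A)"
  proof
    fix Y assume Y: "Y \<in> B.emb_closure (\<phi> ` acarrier A)"
    obtain b where b: "\<And>n. b n \<in> \<phi> ` acarrier A" "b \<in> cauchy_seqs B" "Y = B.cls b"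
      by (rule B.approximation_sequence[of Y "\<phi> ` acarrier A"]) (use Y in \<open>auto simp: B.emb_closure_def\<close>)
    have "\<exists>a\<in>acarrier A. b n = \<phi> a" for n using b(1)[of n] by blast
    then obtain a where a: "\<And>n. a n \<in> acarrier A" "\<And>n. b n = \<phi> (a n)" by metis
    have "adist A (a m) (a n) = adist B (b m) (b n)" for m n
      using iso[of "A.sub (a m) (a n)"] by (simp add: adist_def hom_sub a)
    then have "a \<in> cauchy_seqs A"
      using b(2) by (intro A.cauchy_seqsI a(1)) (simp add: cauchy_seqs_def)
    moreover have "b = (\<lambda>n. \<phi> (a n))" using a(2) by auto
    ultimately show "Y \<in> induced_map A B \<phi> ` acarrier (completion A)"
      unfolding b(3) by (metis A.cls_closed imageI induced_cls)
  qed
qed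

lemma closed_ideal_preimage:
  assumes J: "closed_ideal B J"
  shows "closed_ideal A {x \<in> acarrier A. \<phi> x \<in> J}"
  unfolding closed_ideal_def
proof (intro conjI ballI allI impI)
  fix x assume x: "x \<in> acarrier A" "\<forall>e>0. \<exists>y\<in>{x \<in> acarrier A. \<phi> x \<in> J}. adist A x y < e"
  have "\<exists>y\<in>J. adist B (\<phi> x) y < e" if e: "e > 0" for e
  proof -
    obtain y where "y \<in> acarrier A" "\<phi> y \<in> J" "adist A x y < e" using x(2) e by blast
    then show ?thesis using adist_le[OF x(1), of y] by (intro bexI[of _ "\<phi> y"]) auto
  qed
  then show "x \<in> {x \<in> acarrier A. \<phi> x \<in> J}" using J x(1) by (auto simp: closed_ideal_def)
qed (use J in \<open>auto simp: closed_ideal_def hom_add hom_scale hom_mult\<close>)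

end

lemma (in normed_nalg) closed_ideal_zero: "closed_ideal A {azero A}"
  unfolding closed_ideal_def
proof (intro conjI ballI allI impI)
  fix x assume x: "x \<in> acarrier A" "\<forall>e>0. \<exists>y\<in>{azero A}. adist A x y < e"
  then have "x = azero A" by (intro adist_le_0) (auto intro: less_imp_le)
  then show "x \<in> {azero A}" by simp
next
  fix a x assume "a \<in> acarrier A" "x \<in> {azero A}"
  then show "amult A a x \<in> {azero A}" "amult A x a \<in> {azero A}"
    using mult_scale_right[of a "azero A" 0] mult_scale_left[of "azero A" a 0] by simp_all
qed auto

text \<open>An approximate lift with a fixed relative error \<open>\<rho> < 1\<close> can be applied again to the error that it leaves.  The
  corrections form a geometric series, which converges if the source is complete.\<close>

locale approximate_quotient = contractive_hom A B \<phi>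
  for A :: "'a nalg" and B :: "'b nalg" and \<phi> +
  fixes K \<rho> :: real
  assumes complete: "complete_nalg A"
    and \<rho>: "0 \<le> \<rho>" "\<rho> < 1" and K: "0 \<le> K"
    and approximate_lift: "y \<in> acarrier B
      \<Longrightarrow> \<exists>x\<in>acarrier A. anorm A x \<le> K * anorm B y \<and> adist B (\<phi> x) y \<le> \<rho> * anorm B y"
begin

lemma exact_lift:
  assumes y: "y \<in> acarrier B"
  shows "\<exists>x\<in>acarrier A. \<phi> x = y \<and> anorm A x \<le> K / (1 - \<rho>) * anorm B y"
proof -
  obtain g where g: "\<And>z. z \<in> acarrier B \<Longrightarrow> g z \<in> acarrier A"
    "\<And>z. z \<in> acarrier B \<Longrightarrow> anorm A (g z) \<le> K * anorm B z"
    "\<And>z. z \<in> acarrier B \<Longrightarrow> adist B (\<phi> (g z)) z \<le> \<rho> * anorm B z"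
    using approximate_lift by metis
  \<comment> \<open>\<open>res n\<close> is the error that remains after \<open>n\<close> corrections, and \<open>S n\<close> is the sum of these corrections\<close>
  define res where "res = rec_nat y (\<lambda>n z. B.sub z (\<phi> (g z)))"
  have res0: "res 0 = y" and resS: "res (Suc n) = B.sub (res n) (\<phi> (g (res n)))" for n
    by (simp_all add: res_def)
  have resB: "res n \<in> acarrier B" for n
    by (induction n) (simp_all add: res0 resS y g)
  define S where "S = rec_nat (azero A) (\<lambda>n x. aadd A x (g (res n)))"
  have S0: "S 0 = azero A" and SS: "S (Suc n) = aadd A (S n) (g (res n))" for n
    by (simp_all add: S_def)
  have SA: "S n \<in> acarrier A" for n
    by (induction n) (simp_all add: S0 SS g resB)
  have res_norm: "anorm B (res n) \<le> \<rho> ^ n * anorm B y" for n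
  proof (induction n)
    case (Suc n)
    have "anorm B (res (Suc n)) = adist B (\<phi> (g (res n))) (res n)"
      using B.adist_commute[of "res n" "\<phi> (g (res n))"] by (simp add: adist_def resS resB g)
    also have "\<dots> \<le> \<rho> * anorm B (res n)" by (rule g(3)[OF resB])
    also have "\<dots> \<le> \<rho> * (\<rho> ^ n * anorm B y)" by (intro mult_left_mono Suc \<rho>)
    finally show ?case by (simp add: mult.assoc)
  qed (simp add: res0)
  have phiS: "aadd B (\<phi> (S n)) (res n) = y" for n
  proof (induction n)
    case (Suc n)
    let ?p = "\<phi> (g (res n))"
    have p: "?p \<in> acarrier B" by (simp add: g resB)
    have "aadd B (\<phi> (S (Suc n))) (res (Suc n)) = aadd B (aadd B (\<phi> (S n)) ?p) (B.sub (res n) ?p)"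
      by (simp add: SS resS hom_add SA g resB)
    also have "\<dots> = aadd B (\<phi> (S n)) (aadd B (res n) (B.sub ?p ?p))"
      using p resB[of n] SA[of n] by (simp add: B.add_ac del: B.sub_self B.cancel)
    also have "\<dots> = y" using Suc p resB[of n] by simp
    finally show ?case .
  qed (simp add: S0 res0 y)
  define c where "c = K * anorm B y / (1 - \<rho>)"
  have c0: "0 \<le> c" using K \<rho> y by (simp add: c_def)
  have step: "anorm A (g (res n)) \<le> c * (1 - \<rho>) * \<rho> ^ n" for n
  proof -
    have "anorm A (g (res n)) \<le> K * anorm B (res n)" by (rule g(2)[OF resB])
    also have "\<dots> \<le> K * (\<rho> ^ n * anorm B y)" by (intro mult_left_mono res_norm K)
    finally show ?thesis using \<rho> by (simp add: c_def mult_ac)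
  qed
  have dist_S: "adist A (S (n + k)) (S n) \<le> c * \<rho> ^ n * (1 - \<rho> ^ k)" for n k
  proof (induction k)
    case (Suc k)
    have "adist A (S (n + Suc k)) (S n) \<le> adist A (S (Suc (n + k))) (S (n + k)) + adist A (S (n + k)) (S n)"
      using A.adist_triangle[OF SA SA SA] by simp
    also have "adist A (S (Suc (n + k))) (S (n + k)) = anorm A (g (res (n + k)))"
    proof -
      have "A.sub (aadd A (S (n + k)) (g (res (n + k)))) (S (n + k)) = g (res (n + k))"
        using SA[of "n + k"] g(1)[OF resB] by (simp add: A.add_comm[of "S (n + k)"] A.add_assoc)
      then show ?thesis by (simp add: adist_def SS)
    qed
    also have "anorm A (g (res (n + k))) + adist A (S (n + k)) (S n)
        \<le> c * (1 - \<rho>) * \<rho> ^ (n + k) + c * \<rho> ^ n * (1 - \<rho> ^ k)"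
      by (intro add_mono step Suc)
    also have "\<dots> = c * \<rho> ^ n * (1 - \<rho> ^ Suc k)" by (simp add: algebra_simps power_add)
    finally show ?case .
  qed (simp add: SA)
  have dist_S': "adist A (S m) (S n) \<le> c * \<rho> ^ n" if "n \<le> m" for m n
  proof -
    have "adist A (S m) (S n) \<le> c * \<rho> ^ n * (1 - \<rho> ^ (m - n))" using dist_S[of n "m - n"] that by simp
    also have "\<dots> \<le> c * \<rho> ^ n * 1" using c0 \<rho> by (intro mult_left_mono) auto
    finally show ?thesis by simp
  qed
  have pow0: "(\<lambda>n. b * \<rho> ^ n) \<longlonglongrightarrow> 0" for b
    using tendsto_mult_left[OF LIMSEQ_realpow_zero[OF \<rho>], of b] by simp
  have "S \<in> cauchy_seqs A"
  proof (rule A.cauchy_seqsI[OF SA])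
    fix e :: real assume "e > 0"
    then have "\<forall>\<^sub>F n in sequentially. c * \<rho> ^ n < e" using order_tendstoD(2)[OF pow0] by blast
    then obtain N where N: "\<And>n. n \<ge> N \<Longrightarrow> c * \<rho> ^ n < e" by (auto simp: eventually_sequentially)
    have "adist A (S m) (S n) < e" if "m \<ge> N" "n \<ge> N" for m n
    proof (cases "n \<le> m")
      case True then show ?thesis using dist_S'[of n m] N[of n] that by simp
    next
      case False
      then show ?thesis using dist_S'[of m n] N[of m] that A.adist_commute[OF SA SA, of m n] by simp
    qed
    then show "\<exists>N. \<forall>m\<ge>N. \<forall>n\<ge>N. adist A (S m) (S n) < e" by blast
  qed
  then obtain x where x: "x \<in> acarrier A" "(\<lambda>n. adist A (S n) x) \<longlonglongrightarrow> 0"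
    using complete by (auto simp: complete_nalg_def)
  have "adist B (\<phi> x) y \<le> adist A (S n) x + anorm B y * \<rho> ^ n" for n
  proof -
    have "adist B (\<phi> x) y \<le> adist B (\<phi> x) (\<phi> (S n)) + adist B (\<phi> (S n)) y"
      using B.adist_triangle x y SA by simp
    also have "adist B (\<phi> x) (\<phi> (S n)) \<le> adist A (S n) x"
      using adist_le[of x "S n"] A.adist_commute[of x "S n"] x SA by simp
    also have "adist B (\<phi> (S n)) y = anorm B (res n)"
    proof -
      have "B.sub y (\<phi> (S n)) = res n"
        using SA[of n] resB[of n] by (subst phiS[of n, symmetric]) (simp add: B.add_comm[of "\<phi> (S n)"] B.add_assoc)
      then show ?thesis using B.adist_commute[of y "\<phi> (S n)"] y SA by (simp add: adist_def)
    qed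
    finally show ?thesis using res_norm[of n] by (simp add: mult.commute)
  qed
  then have "adist B (\<phi> x) y \<le> 0"
    using tendsto_add[OF x(2) pow0[of "anorm B y"]] by (intro LIMSEQ_le_const[of _ 0]) auto
  then have "\<phi> x = y" using x y by (intro B.adist_le_0) auto
  moreover have "anorm A x \<le> c"
  proof -
    have "anorm A x \<le> adist A (S n) x + c" for n
    proof -
      have "anorm A x \<le> adist A x (S n) + adist A (S n) (azero A)"
        using A.adist_triangle[of x "S n" "azero A"] x SA by simp
      then show ?thesis using dist_S'[of 0 n] A.adist_commute[of x "S n"] x SA by (simp add: S0)
    qed
    then show ?thesis using tendsto_add[OF x(2) tendsto_const[of c]]
      by (intro LIMSEQ_le_const[of "\<lambda>n. adist A (S n) x + c" c]) auto
  qed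
  ultimately show ?thesis using x(1) by (auto simp: c_def)
qed

lemma surjective: "\<phi> ` acarrier A = acarrier B"
  using exact_lift by force

text \<open>If \<open>\<phi> x\<close> is close to \<open>\<phi> w\<close> with \<open>w\<close> in the ideal, the small difference has a small lift \<open>v\<close>, and \<open>x - v\<close>
  differs from \<open>w\<close> by an element of the kernel; so \<open>x\<close> is close to the ideal.\<close>

lemma closed_ideal_image:
  assumes I: "closed_ideal A I" and ker: "{x \<in> acarrier A. \<phi> x = azero B} \<subseteq> I"
  shows "closed_ideal B (\<phi> ` I)"
  unfolding closed_ideal_def
proof (intro conjI ballI allI impI)
  note I' = I[unfolded closed_ideal_def]
  have IA: "I \<subseteq> acarrier A" using I' by blast
  show "\<phi> ` I \<subseteq> acarrier B" using IA by auto
  show "azero B \<in> \<phi> ` I" using I' by (intro image_eqI[of _ _ "azero A"]) auto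
  show "aadd B x y \<in> \<phi> ` I" if xy: "x \<in> \<phi> ` I" "y \<in> \<phi> ` I" for x y
  proof -
    obtain a b where ab: "a \<in> I" "b \<in> I" "x = \<phi> a" "y = \<phi> b" using xy by blast
    then show ?thesis using I' IA by (intro image_eqI[of _ _ "aadd A a b"]) (auto simp: hom_add subsetD[OF IA])
  qed
  show "ascale B c x \<in> \<phi> ` I" if cx: "x \<in> \<phi> ` I" for c x
  proof -
    obtain a where ab: "a \<in> I" "x = \<phi> a" using cx by blast
    then show ?thesis using I' IA by (intro image_eqI[of _ _ "ascale A c a"]) (auto simp: hom_scale subsetD[OF IA])
  qed
  fix b x assume b: "b \<in> acarrier B" and x: "x \<in> \<phi> ` I"
  obtain a w where aw: "a \<in> acarrier A" "\<phi> a = b" "w \<in> I" "x = \<phi> w"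
    using b x surjective by (metis imageE)
  show "amult B b x \<in> \<phi> ` I"
    using I' IA aw by (intro image_eqI[of _ _ "amult A a w"]) (auto simp: hom_mult subsetD[OF IA])
  show "amult B x b \<in> \<phi> ` I"
    using I' IA aw by (intro image_eqI[of _ _ "amult A w a"]) (auto simp: hom_mult subsetD[OF IA])
next
  note I' = I[unfolded closed_ideal_def]
  have IA: "I \<subseteq> acarrier A" using I' by blast
  fix y assume y: "y \<in> acarrier B" "\<forall>e>0. \<exists>z\<in>\<phi> ` I. adist B y z < e"
  obtain x where x: "x \<in> acarrier A" "\<phi> x = y" using y(1) unfolding surjective[symmetric] by blast
  define L where "L = K / (1 - \<rho>) + 1"
  have L: "0 < L" "K / (1 - \<rho>) \<le> L" using K \<rho> by (simp_all add: L_def add_nonneg_pos)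
  have "\<exists>k\<in>I. adist A x k < e" if e: "e > 0" for e
  proof -
    have "e / L > 0" using e L by simp
    then obtain w where w: "w \<in> I" "adist B y (\<phi> w) < e / L" using y(2) by blast
    have wA: "w \<in> acarrier A" using w IA by blast
    obtain v where v: "v \<in> acarrier A" "\<phi> v = \<phi> (A.sub x w)"
      "anorm A v \<le> K / (1 - \<rho>) * anorm B (\<phi> (A.sub x w))"
      using exact_lift[of "\<phi> (A.sub x w)"] x wA by auto
    let ?k = "A.sub (A.sub x w) v"
    have "\<phi> ?k = azero B" using x wA v by (subst hom_sub) simp_all
    then have kI: "?k \<in> I" using ker x wA v by auto
    then have wk: "aadd A w ?k \<in> I" using I' w by blast
    have "A.sub x (aadd A w ?k) = v"
    proof -
      have "aadd A w ?k = A.sub x v"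
        using x(1) wA v(1) A.add_left_comm[of w "A.sub x w" "ascale A (- 1) v"] by (simp add: A.add_assoc)
      moreover have "A.sub x (A.sub x v) = v"
        using x(1) v(1) by (simp add: A.scale_right)
      ultimately show ?thesis by simp
    qed
    then have "adist A x (aadd A w ?k) = anorm A v" by (simp add: adist_def)
    also have "\<dots> \<le> K / (1 - \<rho>) * anorm B (\<phi> (A.sub x w))" by (rule v(3))
    also have "anorm B (\<phi> (A.sub x w)) = adist B y (\<phi> w)" using x wA by (simp add: hom_sub adist_def)
    also have "K / (1 - \<rho>) * adist B y (\<phi> w) \<le> L * adist B y (\<phi> w)"
      using L y(1) wA by (intro mult_right_mono) auto
    also have "\<dots> < e" using w(2) L by (simp add: pos_less_divide_eq mult.commute)
    finally show ?thesis using wk by blast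
  qed
  then have "x \<in> I" using I' x(1) by blast
  then show "y \<in> \<phi> ` I" using x(2) by blast
qed

end


section \<open>Locally compact Hausdorff spaces\<close>

lemma continuous_map_complex_mult:
  fixes f g :: "'a \<Rightarrow> complex"
  shows "continuous_map X euclidean f \<Longrightarrow> continuous_map X euclidean g \<Longrightarrow> continuous_map X euclidean (\<lambda>x. f x * g x)"
  by (simp add: continuous_map_atin tendsto_mult)

lemma continuous_map_complex_of_real:
  "continuous_map X euclidean f \<Longrightarrow> continuous_map X euclidean (\<lambda>x. complex_of_real (f x))"
  by (simp add: continuous_map_atin tendsto_of_real)

lemma continuous_map_cnj:
  "continuous_map X euclidean f \<Longrightarrow> continuous_map X euclidean (\<lambda>x. cnj (f x))"
  by (simp add: continuous_map_atin tendsto_cnj)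

lemma continuous_map_open_cover2:
  assumes "openin X W1" "openin X W2" "W1 \<union> W2 = topspace X"
    and "continuous_map (subtopology X W1) Y f" "continuous_map (subtopology X W2) Y f"
  shows "continuous_map X Y f"
  by (rule pasting_lemma[of "{W1, W2}" X "\<lambda>i. i" Y "\<lambda>_. f"]) (use assms in auto)

lemma bump_function:
  assumes X: "locally_compact_space X" "Hausdorff_space X" and K: "compactin X K" "K \<subseteq> V" and V: "openin X V"
  obtains \<phi> L where "continuous_map X euclideanreal \<phi>" "\<And>x. x \<in> topspace X \<Longrightarrow> 0 \<le> \<phi> x \<and> \<phi> x \<le> 1"
    "\<And>x. x \<in> K \<Longrightarrow> \<phi> x = 1" "compactin X L" "L \<subseteq> V" "\<And>x. x \<in> topspace X - L \<Longrightarrow> \<phi> x = 0"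
proof -
  have XV: "locally_compact_space (subtopology X V)" "Hausdorff_space (subtopology X V)"
    using X V by (simp_all add: locally_compact_space_open_subset Hausdorff_space_subtopology)
  have "compactin (subtopology X V) K" using K by (simp add: compactin_subtopology)
  then obtain W L where WL: "openin (subtopology X V) W" "compactin (subtopology X V) L" "K \<subseteq> W" "W \<subseteq> L"
    using XV locally_compact_space_compact_closed_compact by metis
  have W: "openin X W" using WL(1) V by (rule openin_trans_full)
  have L: "compactin X L" "L \<subseteq> V" using WL(2) by (simp_all add: compactin_subtopology)
  obtain \<phi> where \<phi>: "continuous_map X (top_of_set {0..1::real}) \<phi>"
    "\<phi> ` (topspace X - W) \<subseteq> {0}" "\<phi> ` K \<subseteq> {1}"
  proof (rule Urysohn_completely_regular_compact_closed[of "0::real" 1 X K "topspace X - W"])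
    show "completely_regular_space X"
      using X locally_compact_regular_imp_completely_regular_space by blast
    show "disjnt K (topspace X - W)" using WL(3) by (auto simp: disjnt_def)
  qed (use K W in auto)
  show ?thesis
  proof (rule that[of \<phi> L])
    show "continuous_map X euclideanreal \<phi>" using \<phi>(1) continuous_map_in_subtopology by blast
    show "0 \<le> \<phi> x \<and> \<phi> x \<le> 1" if "x \<in> topspace X" for x
      using \<phi>(1) that by (auto simp: continuous_map_in_subtopology Pi_iff)
    show "\<phi> x = 1" if "x \<in> K" for x using \<phi>(3) that by auto
    show "\<phi> x = 0" if "x \<in> topspace X - L" for x using \<phi>(2) that WL(4) by auto
  qed (use L in auto)
qed


section \<open>Etale groupoids\<close>

locale etale_groupoid =
  fixes G :: "'g groupoid"
  assumes locally_compact: "locally_compact_groupoid G" and etale: "etale G"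

sublocale etale_groupoid \<subseteq> groupoid_algebraic
  using locally_compact by unfold_locales (simp add: locally_compact_groupoid_def)

context etale_groupoid
begin

abbreviation X where "X \<equiv> gtop G"

lemma topspace_X [simp]: "topspace X = C"
  by (simp add: gcarrier_def)

lemma lc: "locally_compact_space X" and hausdorff: "Hausdorff_space X"
  and continuous_inv: "continuous_map X X (ginv G)"
  and continuous_mult: "continuous_map (subtopology (prod_topology X X) (composable G)) X (\<lambda>(g, h). g \<cdot> h)"
  using locally_compact by (simp_all add: locally_compact_groupoid_def)

lemma compact_closed: "compactin X K \<Longrightarrow> closedin X K"
  by (rule compactin_imp_closedin[OF hausdorff])

lemma compact_subset: "compactin X K \<Longrightarrow> K \<subseteq> C"
  using compactin_subset_topspace by fastforce

lemma continuous_times: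
  assumes "continuous_map Y X a" "continuous_map Y X b" "\<And>y. y \<in> topspace Y \<Longrightarrow> d (a y) = r (b y)"
  shows "continuous_map Y X (\<lambda>y. a y \<cdot> b y)"
proof -
  have "continuous_map Y (subtopology (prod_topology X X) (composable G)) (\<lambda>y. (a y, b y))"
    using assms continuous_map_image_subset_topspace[OF assms(1)] continuous_map_image_subset_topspace[OF assms(2)]
    by (intro continuous_map_into_subtopology continuous_map_pairedI) (auto simp: composable_def)
  from continuous_map_compose[OF this continuous_mult] show ?thesis by (simp add: o_def)
qed

lemma continuous_rng: "continuous_map X X r"
proof -
  have "continuous_map X X (\<lambda>g. g \<cdot> inv' g)" by (rule continuous_times[OF _ continuous_inv]) simp_all
  then show ?thesis by (simp add: rng_def[abs_def])
qed

lemma continuous_dm: "continuous_map X X d"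
proof -
  have "continuous_map X X (\<lambda>g. inv' g \<cdot> g)" by (rule continuous_times[OF continuous_inv]) simp_all
  then show ?thesis by (simp add: dm_def[abs_def])
qed

lemma unit_space_subset: "unit_space G \<subseteq> C"
  by (auto simp: unit_space_iff)

lemma closedin_unit_space: "closedin X (unit_space G)"
proof -
  have "closedin X {g \<in> topspace X. d g = id g}"
    by (rule closedin_continuous_maps_eq[OF hausdorff continuous_dm continuous_map_id])
  moreover have "{g \<in> topspace X. d g = id g} = unit_space G"
    by (rule set_eqI) (simp add: unit_space_iff)
  ultimately show ?thesis by simp
qed

lemma local_homeomorphism_nbhd:
  assumes "local_homeomorphism X Y f" "g \<in> C"
  obtains U V where "openin X U" "g \<in> U" "openin Y V" "homeomorphic_map (subtopology X U) (subtopology Y V) f"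
  using assms unfolding local_homeomorphism_def by (metis topspace_X)

lemma homeomorphic_map_inj:
  assumes "homeomorphic_map (subtopology X U) Z f" "openin X U"
  shows "inj_on f U"
proof -
  have "topspace (subtopology X U) = U" using openin_subset[OF assms(2)] by auto
  then show ?thesis using assms(1) by (simp add: homeomorphic_eq_everything_map)
qed

text \<open>On a neighbourhood where the domain map is injective, any \<open>g\<close> whose domain is also in that neighbourhood must
  equal its domain, since both have the same domain.\<close>

lemma openin_unit_space: "openin X (unit_space G)"
proof (subst openin_subopen, intro ballI)
  fix u assume u: "u \<in> unit_space G"
  then have uC: "u \<in> C" by (simp add: unitD)
  obtain U V where U: "openin X U" "u \<in> U" "homeomorphic_map (subtopology X U) (subtopology (unit_top G) V) d"
    using local_homeomorphism_nbhd[of "unit_top G" d u] etale uC unfolding etale_def by metis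
  have inj: "inj_on d U" by (rule homeomorphic_map_inj[OF U(3,1)])
  let ?W = "U \<inter> {g \<in> topspace X. d g \<in> U}"
  have "openin X ?W" by (intro openin_Int U openin_continuous_map_preimage[OF continuous_dm])
  moreover have "u \<in> ?W" using U u uC by simp
  moreover have "?W \<subseteq> unit_space G"
  proof
    fix g assume "g \<in> ?W"
    then have g: "g \<in> C" "g \<in> U" "d g \<in> U" by auto
    then have "d g = g" using inj_onD[OF inj, of "d g" g] by simp
    then show "g \<in> unit_space G" using g by (simp add: unit_space_iff)
  qed
  ultimately show "\<exists>T. openin X T \<and> u \<in> T \<and> T \<subseteq> unit_space G" by blast
qed

lemma openin_unit_top: "openin (unit_top G) U \<longleftrightarrow> openin X U \<and> U \<subseteq> unit_space G"
  unfolding unit_top_def by (rule openin_open_subtopology[OF openin_unit_space])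

lemma topspace_unit_top [simp]: "topspace (unit_top G) = unit_space G"
  using unit_space_subset by (auto simp: unit_top_def)

text \<open>The section \<open>s\<close>, inverse to the range map on \<open>V\<close>, belongs to the notion because the convolution of a
  function on \<open>V\<close> with another function is written in terms of it.\<close>

definition bisection :: "'g set \<Rightarrow> ('g \<Rightarrow> 'g) \<Rightarrow> bool" where
  "bisection V s \<longleftrightarrow> openin X V \<and> inj_on r V \<and> inj_on d V \<and> openin X (r ` V) \<and>
     continuous_map (subtopology X (r ` V)) X s \<and> (\<forall>g\<in>V. s (r g) = g)"

lemma bisection_nbhd:
  assumes g: "g \<in> C"
  obtains V s where "bisection V s" "g \<in> V"
proof -
  obtain U V where U: "openin X U" "g \<in> U" "openin (unit_top G) V"
    "homeomorphic_map (subtopology X U) (subtopology (unit_top G) V) r"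
    using local_homeomorphism_nbhd[of "unit_top G" r g] etale g unfolding etale_def by metis
  obtain U' V' where U': "openin X U'" "g \<in> U'"
    "homeomorphic_map (subtopology X U') (subtopology (unit_top G) V') d"
    using local_homeomorphism_nbhd[of "unit_top G" d g] etale g unfolding etale_def by metis
  let ?W = "U \<inter> U'"
  have W: "openin X ?W" using U U' by auto
  have "openin (subtopology X U) ?W" using U(1) W by (simp add: openin_open_subtopology)
  then have "openin (subtopology (unit_top G) V) (r ` ?W)"
    using homeomorphic_imp_open_map[OF U(4)] by (simp add: open_map_def)
  then have "openin (unit_top G) (r ` ?W)" and rWV: "r ` ?W \<subseteq> V"
    using openin_trans_full[OF _ U(3)] openin_imp_subset by metis+
  then have rW: "openin X (r ` ?W)" by (simp only: openin_unit_top)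
  obtain s where s: "homeomorphic_maps (subtopology X U) (subtopology (unit_top G) V) r s"
    using U(4) homeomorphic_map_maps by blast
  have VX: "subtopology (unit_top G) V = subtopology X V"
    using U(3) unfolding openin_unit_top
    by (simp add: unit_top_def[of G] subtopology_subtopology Int_absorb1)
  have "continuous_map (subtopology X V) X s"
    using s unfolding homeomorphic_maps_def VX by (simp add: continuous_map_in_subtopology)
  then have "continuous_map (subtopology X (r ` ?W)) X s"
    using rWV by (rule continuous_map_from_subtopology_mono)
  moreover have "s (r g) = g" if "g \<in> ?W" for g
    using s that openin_subset[OF U(1)] unfolding homeomorphic_maps_def by auto
  moreover have "inj_on r ?W" "inj_on d ?W"
    using homeomorphic_map_inj[OF U(4,1)] homeomorphic_map_inj[OF U'(3,1)] by (auto intro: inj_on_subset)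
  ultimately have "bisection ?W s" using W rW by (simp add: bisection_def)
  then show ?thesis using that U U' by blast
qed

lemma bisection_subset: "bisection V s \<Longrightarrow> V \<subseteq> C"
  unfolding bisection_def using openin_subset by fastforce


section \<open>Compactly supported functions\<close>

lemma Cc_iff: "f \<in> Cc G \<longleftrightarrow> (\<forall>g. g \<notin> C \<longrightarrow> f g = 0) \<and> continuous_map X euclidean f \<and>
    (\<exists>K. compactin X K \<and> (\<forall>g. g \<notin> K \<longrightarrow> f g = 0))"
proof
  assume f: "f \<in> Cc G"
  let ?K = "X closure_of {g \<in> C. f g \<noteq> 0}"
  have "{g \<in> C. f g \<noteq> 0} \<subseteq> ?K" by (rule closure_of_subset) auto
  then have "\<forall>g. g \<notin> ?K \<longrightarrow> f g = 0" using f unfolding Cc_def by blast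
  then show "(\<forall>g. g \<notin> C \<longrightarrow> f g = 0) \<and> continuous_map X euclidean f \<and>
    (\<exists>K. compactin X K \<and> (\<forall>g. g \<notin> K \<longrightarrow> f g = 0))" using f unfolding Cc_def by blast
next
  assume f: "(\<forall>g. g \<notin> C \<longrightarrow> f g = 0) \<and> continuous_map X euclidean f \<and>
    (\<exists>K. compactin X K \<and> (\<forall>g. g \<notin> K \<longrightarrow> f g = 0))"
  then obtain K where K: "compactin X K" "\<forall>g. g \<notin> K \<longrightarrow> f g = 0" by blast
  have "X closure_of {g \<in> C. f g \<noteq> 0} \<subseteq> K"
    by (rule closure_of_minimal) (use K compact_closed in auto)
  then have "compactin X (X closure_of {g \<in> C. f g \<noteq> 0})"
    by (intro closed_compactin[OF K(1)]) auto
  then show "f \<in> Cc G" using f by (simp add: Cc_def)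
qed

lemma CcI:
  assumes "continuous_map X euclidean f" "compactin X K" "\<And>g. g \<notin> K \<Longrightarrow> f g = 0"
  shows "f \<in> Cc G"
  unfolding Cc_iff using assms compact_subset[OF assms(2)] by blast

lemma CcE:
  assumes "f \<in> Cc G"
  obtains K where "continuous_map X euclidean f" "compactin X K" "\<And>g. g \<notin> K \<Longrightarrow> f g = 0"
  using assms unfolding Cc_iff by blast

lemma Cc_zero: "(\<lambda>g. 0) \<in> Cc G"
  by (rule CcI[of _ "{}"]) auto

lemma Cc_add:
  assumes "f1 \<in> Cc G" "f2 \<in> Cc G"
  shows "(\<lambda>g. f1 g + f2 g) \<in> Cc G"
proof -
  obtain K1 where 1: "continuous_map X euclidean f1" "compactin X K1" "\<And>g. g \<notin> K1 \<Longrightarrow> f1 g = 0"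
    using CcE[OF assms(1)] by blast
  obtain K2 where 2: "continuous_map X euclidean f2" "compactin X K2" "\<And>g. g \<notin> K2 \<Longrightarrow> f2 g = 0"
    using CcE[OF assms(2)] by blast
  show ?thesis
    by (rule CcI[of _ "K1 \<union> K2"]) (use 1 2 in \<open>auto intro: continuous_map_add compactin_Un\<close>)
qed

lemma Cc_continuous_mult:
  assumes "f \<in> Cc G" "continuous_map X euclidean h"
  shows "(\<lambda>g. h g * f g) \<in> Cc G"
proof -
  obtain K where 1: "continuous_map X euclidean f" "compactin X K" "\<And>g. g \<notin> K \<Longrightarrow> f g = 0"
    using CcE[OF assms(1)] by blast
  show ?thesis
    by (rule CcI[of _ K]) (use 1 assms(2) in \<open>auto intro: continuous_map_complex_mult\<close>)
qed

lemma Cc_scale: "f \<in> Cc G \<Longrightarrow> (\<lambda>g. c * f g) \<in> Cc G"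
  by (rule Cc_continuous_mult) auto

lemma Cc_sum:
  "finite T \<Longrightarrow> (\<And>x. x \<in> T \<Longrightarrow> f x \<in> Cc G) \<Longrightarrow> (\<lambda>g. \<Sum>x\<in>T. f x g) \<in> Cc G"
  by (induction T rule: finite_induct) (simp_all add: Cc_zero Cc_add)

lemma Cc_bounded:
  assumes "f \<in> Cc G"
  obtains m where "\<And>g. cmod (f g) \<le> m"
proof -
  obtain K where K: "continuous_map X euclidean f" "compactin X K" "\<And>g. g \<notin> K \<Longrightarrow> f g = 0"
    using CcE[OF assms] by blast
  have "compact (f ` K)" using image_compactin[OF K(2,1)] by simp
  then obtain m where m: "\<And>x. x \<in> f ` K \<Longrightarrow> cmod x \<le> m"
    using compact_imp_bounded bounded_iff by metis
  have "cmod (f g) \<le> max m 0" for g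
    using m[of "f g"] K(3)[of g] by (cases "g \<in> K") auto
  then show ?thesis by (rule that)
qed

text \<open>For these functions boundedness of the convolution operator and continuity of convolution products are visible,
  as each range fibre contains at most one point where they do not vanish.\<close>

definition elementary :: "('g \<Rightarrow> complex) \<Rightarrow> bool" where
  "elementary f \<longleftrightarrow> f \<in> Cc G \<and>
     (\<exists>V s K. bisection V s \<and> compactin X K \<and> K \<subseteq> V \<and> (\<forall>g. g \<notin> K \<longrightarrow> f g = 0))"

text \<open>The summands come from bump functions \<open>\<phi> x\<close> divided by their sum.  Dividing by the maximum of the sum
  and \<open>1/2\<close> keeps the quotient continuous everywhere, and changes nothing on the support of \<open>f\<close>, where the sum
  exceeds \<open>1/2\<close>.\<close>

lemma Cc_elementary_sum:
  assumes f: "f \<in> Cc G"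
  obtains T and F :: "'g \<Rightarrow> 'g \<Rightarrow> complex"
  where "finite T" "\<And>x. x \<in> T \<Longrightarrow> elementary (F x)" "f = (\<lambda>g. \<Sum>x\<in>T. F x g)"
proof -
  obtain K where K: "continuous_map X euclidean f" "compactin X K" "\<And>g. g \<notin> K \<Longrightarrow> f g = 0"
    using CcE[OF f] by blast
  note KC = compact_subset[OF K(2)]
  define Q where "Q x p \<longleftrightarrow> (case p of (\<phi>, V, s, L) \<Rightarrow>
      bisection V s \<and> continuous_map X euclideanreal \<phi> \<and> (\<forall>y\<in>C. 0 \<le> \<phi> y) \<and> \<phi> x = 1 \<and>
      compactin X L \<and> L \<subseteq> V \<and> (\<forall>y\<in>C - L. \<phi> y = 0))" for x p
  have "\<exists>p. Q x p" if "x \<in> K" for x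
  proof -
    have xC: "x \<in> C" using that KC by blast
    obtain V s where V: "bisection V s" "x \<in> V" using bisection_nbhd[OF xC] by blast
    obtain \<phi> L where "continuous_map X euclideanreal \<phi>" "\<And>y. y \<in> topspace X \<Longrightarrow> 0 \<le> \<phi> y \<and> \<phi> y \<le> 1"
      "\<And>y. y \<in> {x} \<Longrightarrow> \<phi> y = 1" "compactin X L" "L \<subseteq> V" "\<And>y. y \<in> topspace X - L \<Longrightarrow> \<phi> y = 0"
      by (rule bump_function[OF lc hausdorff, of "{x}" V]) (use V xC in \<open>auto simp: bisection_def\<close>)
    then show ?thesis using V(1) unfolding Q_def by (intro exI[of _ "(\<phi>, V, s, L)"]) auto
  qed
  then obtain p where p: "\<And>x. x \<in> K \<Longrightarrow> Q x (p x)" by metis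
  define \<phi> V s L where "\<phi> x = fst (p x)" and "V x = fst (snd (p x))"
    and "s x = fst (snd (snd (p x)))" and "L x = snd (snd (snd (p x)))" for x
  have P: "\<And>x. x \<in> K \<Longrightarrow> bisection (V x) (s x)"
    "\<And>x. x \<in> K \<Longrightarrow> continuous_map X euclideanreal (\<phi> x)" "\<And>x y. x \<in> K \<Longrightarrow> y \<in> C \<Longrightarrow> 0 \<le> \<phi> x y"
    "\<And>x. x \<in> K \<Longrightarrow> \<phi> x x = (1::real)" "\<And>x. x \<in> K \<Longrightarrow> compactin X (L x)" "\<And>x. x \<in> K \<Longrightarrow> L x \<subseteq> V x"
    "\<And>x y. x \<in> K \<Longrightarrow> y \<in> C - L x \<Longrightarrow> \<phi> x y = 0"
    using p unfolding Q_def \<phi>_def V_def s_def L_def by (force simp: split_beta)+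
  let ?U = "\<lambda>x. {y \<in> topspace X. \<phi> x y \<in> {1/2<..}}"
  have "\<exists>\<F>. finite \<F> \<and> \<F> \<subseteq> ?U ` K \<and> K \<subseteq> \<Union>\<F>"
  proof (rule compactinD[OF K(2)])
    show "openin X U" if U: "U \<in> ?U ` K" for U
    proof -
      obtain x where x: "x \<in> K" "U = ?U x" using U by blast
      show ?thesis unfolding x(2) by (rule openin_continuous_map_preimage[OF P(2)[OF x(1)]]) simp
    qed
    show "K \<subseteq> \<Union>(?U ` K)" using P(4) KC by force
  qed
  then obtain T where T: "finite T" "T \<subseteq> K" "K \<subseteq> (\<Union>x\<in>T. ?U x)"
    by (metis (no_types, lifting) finite_subset_image)
  define \<sigma> where "\<sigma> y = max (\<Sum>x\<in>T. \<phi> x y) (1/2)" for y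
  have \<sigma>pos: "0 < \<sigma> y" for y by (simp add: \<sigma>_def less_max_iff_disj)
  have \<sigma>cont: "continuous_map X euclideanreal \<sigma>" unfolding \<sigma>_def[abs_def]
    by (intro continuous_map_real_max continuous_map_sum T(1)) (use P(2) T(2) in auto)
  have \<sigma>K: "\<sigma> y = (\<Sum>x\<in>T. \<phi> x y)" if y: "y \<in> K" for y
  proof -
    obtain x where x: "x \<in> T" "1/2 < \<phi> x y" using T(3) y by auto
    have "\<phi> x y \<le> (\<Sum>x\<in>T. \<phi> x y)" using P(3) T(2) y KC by (intro member_le_sum x T(1)) auto
    with x(2) show ?thesis by (simp add: \<sigma>_def)
  qed
  define F where "F x y = complex_of_real (\<phi> x y / \<sigma> y) * f y" for x y
  have "elementary (F x)" if x: "x \<in> T" for x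
  proof -
    have xK: "x \<in> K" using x T(2) by blast
    have "continuous_map X euclidean (\<lambda>y. complex_of_real (\<phi> x y / \<sigma> y))"
      using \<sigma>pos
      by (intro continuous_map_complex_of_real continuous_map_real_divide P(2) \<sigma>cont xK) (simp add: less_imp_neq[symmetric])
    then have "F x \<in> Cc G" unfolding F_def[abs_def] by (rule Cc_continuous_mult[OF f])
    moreover have "F x g = 0" if "g \<notin> L x" for g
      using P(7)[OF xK, of g] that K(3)[of g] KC by (cases "g \<in> C") (auto simp: F_def)
    ultimately show ?thesis unfolding elementary_def using P(1,5,6)[OF xK] by blast
  qed
  moreover have "f y = (\<Sum>x\<in>T. F x y)" for y
  proof (cases "y \<in> K")
    case True
    have "(\<Sum>x\<in>T. F x y) = complex_of_real ((\<Sum>x\<in>T. \<phi> x y) / \<sigma> y) * f y"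
      by (simp add: F_def sum_distrib_right sum_divide_distrib)
    then show ?thesis using \<sigma>K[OF True] \<sigma>pos[of y] by simp
  next
    case False
    then show ?thesis by (simp add: F_def K(3))
  qed
  ultimately show ?thesis using T(1) that[of T F] by blast
qed

lemma Cc_induct [consumes 1, case_names zero add elementary]:
  assumes f: "f \<in> Cc G" and zero: "P (\<lambda>g. 0)"
    and add: "\<And>f1 f2. f1 \<in> Cc G \<Longrightarrow> f2 \<in> Cc G \<Longrightarrow> P f1 \<Longrightarrow> P f2 \<Longrightarrow> P (\<lambda>g. f1 g + f2 g)"
    and elem: "\<And>f. elementary f \<Longrightarrow> P f"
  shows "P f"
proof -
  obtain T and F :: "'g \<Rightarrow> 'g \<Rightarrow> complex"
    where T: "finite T" "\<And>x. x \<in> T \<Longrightarrow> elementary (F x)" "f = (\<lambda>g. \<Sum>x\<in>T. F x g)"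
    using Cc_elementary_sum[OF f] by blast
  have FC: "F x \<in> Cc G" if "x \<in> T" for x using T(2)[OF that] by (simp add: elementary_def)
  have "P (\<lambda>g. \<Sum>x\<in>T'. F x g)" if "T' \<subseteq> T" for T'
    using finite_subset[OF that T(1)] that
  proof (induction T' rule: finite_induct)
    case (insert x T')
    then have "P (\<lambda>g. F x g + (\<Sum>x\<in>T'. F x g))"
      using FC by (intro add elem[OF T(2)] Cc_sum) auto
    then show ?case using insert by simp
  qed (simp add: zero)
  then show ?thesis unfolding T(3) by blast
qed

lemma elementary_bounded_function:
  assumes "elementary f"
  shows "f \<in> bounded_functions G"
proof -
  obtain V s K where V: "f \<in> Cc G" "bisection V s" "K \<subseteq> V" "\<forall>g. g \<notin> K \<longrightarrow> f g = 0"
    using assms unfolding elementary_def by blast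
  obtain m where m: "\<And>g. cmod (f g) \<le> m" using Cc_bounded[OF V(1)] by blast
  show ?thesis
    by (rule bisection_bounded(1)[OF bisection_subset[OF V(2)] _ _ _ m]) (use V in \<open>auto simp: bisection_def\<close>)
qed

lemma Cc_bounded_function: "f \<in> Cc G \<Longrightarrow> f \<in> bounded_functions G"
proof (induction rule: Cc_induct)
  case (add f1 f2)
  then show ?case using bounded_functions_add[of f1 f2 1] by simp
qed (simp_all add: bounded_functions_zero elementary_bounded_function)

lemma Cc_involution:
  assumes "f \<in> Cc G"
  shows "involution G f \<in> Cc G"
proof -
  obtain K where K: "continuous_map X euclidean f" "compactin X K" "\<And>g. g \<notin> K \<Longrightarrow> f g = 0"
    using CcE[OF assms] by blast
  show ?thesis
  proof (rule CcI[of _ "ginv G ` K"])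
    have "continuous_map X euclidean (\<lambda>g. cnj ((f \<circ> ginv G) g))"
      by (rule continuous_map_cnj[OF continuous_map_compose[OF continuous_inv K(1)]])
    then show "continuous_map X euclidean (involution G f)"
      by (rule continuous_map_eq) (simp add: involution_def extend0_def)
    show "compactin X (ginv G ` K)" by (rule image_compactin[OF K(2) continuous_inv])
    show "involution G f g = 0" if "g \<notin> ginv G ` K" for g
    proof (cases "g \<in> C")
      case True
      then have "inv' g \<notin> K" using that imageI[of "inv' g" K "ginv G"] by auto
      then show ?thesis by (simp add: involution_def extend0_def K(3))
    qed (simp add: involution_def extend0_def)
  qed
qed

lemma compact_product:
  assumes "compactin X K1" "compactin X K2"
  shows "compactin X ((\<lambda>(g, h). g \<cdot> h) ` ((K1 \<times> K2) \<inter> composable G))"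
proof (rule image_compactin[OF _ continuous_mult])
  let ?P = "prod_topology X X"
  have "closedin ?P {p \<in> topspace ?P. (d \<circ> fst) p = (r \<circ> snd) p}"
    by (rule closedin_continuous_maps_eq[OF hausdorff]; rule continuous_map_compose)
      (auto intro: continuous_dm continuous_rng continuous_map_fst continuous_map_snd)
  moreover have "{p \<in> topspace ?P. (d \<circ> fst) p = (r \<circ> snd) p} = composable G"
    by (auto simp: composable_def)
  ultimately have cl: "closedin ?P (composable G)" by simp
  have "compactin ?P (K1 \<times> K2)" using assms by (simp add: compactin_Times)
  then have "compactin ?P ((K1 \<times> K2) \<inter> composable G)"
    by (subst Int_commute) (rule closed_Int_compactin[OF cl])
  then show "compactin (subtopology ?P (composable G)) ((K1 \<times> K2) \<inter> composable G)"
    by (simp add: compactin_subtopology)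
qed

lemma conv_support_compact:
  assumes "f1 \<in> bounded_functions G" "\<And>g. g \<notin> K1 \<Longrightarrow> f1 g = 0" "\<And>g. g \<notin> K2 \<Longrightarrow> f2 g = 0"
    "g \<notin> (\<lambda>(g, h). g \<cdot> h) ` ((K1 \<times> K2) \<inter> composable G)"
  shows "conv G f1 f2 g = 0"
proof (rule ccontr)
  assume "conv G f1 f2 g \<noteq> 0"
  then obtain h k where hk: "h \<in> C" "k \<in> C" "d h = r k" "g = h \<cdot> k" "f1 h \<noteq> 0" "f2 k \<noteq> 0"
    using conv_support[OF bounded_functionsD(1)[OF assms(1)]] by blast
  then have "(h, k) \<in> (K1 \<times> K2) \<inter> composable G" using assms(2,3) by (auto simp: composable_def)
  then show False using assms(4) hk(4) by force
qed

text \<open>Over the open set of ranges of the bisection the product is \<open>f1 (s (r g)) * f2 (s (r g)\<^sup>-\<^sup>1 g)\<close>, and off the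
  closed set of ranges of the support it is zero; the two open regions cover \<open>G\<close>.\<close>

lemma conv_elementary:
  assumes f1: "elementary f1" and f2: "f2 \<in> Cc G"
  shows "conv G f1 f2 \<in> Cc G"
proof -
  obtain V s K1 where V: "f1 \<in> Cc G" "bisection V s" "compactin X K1" "K1 \<subseteq> V" "\<And>g. g \<notin> K1 \<Longrightarrow> f1 g = 0"
    using f1 unfolding elementary_def by blast
  obtain K2 where K2: "continuous_map X euclidean f2" "compactin X K2" "\<And>g. g \<notin> K2 \<Longrightarrow> f2 g = 0"
    using CcE[OF f2] by blast
  have cf1: "continuous_map X euclidean f1" using V(1) by (simp add: Cc_def)
  note b = V(2)[unfolded bisection_def]
  have VC: "V \<subseteq> C" by (rule bisection_subset[OF V(2)])
  let ?W1 = "{g \<in> topspace X. r g \<in> r ` V}" and ?W2 = "{g \<in> topspace X. r g \<in> topspace X - r ` K1}"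
  have formula: "conv G f1 f2 g = f1 (s (r g)) * f2 (inv' (s (r g)) \<cdot> g)" if g: "g \<in> ?W1" for g
  proof -
    obtain h where h: "h \<in> V" "r g = r h" using g by auto
    have sh: "s (r g) = h" using h b by simp
    have "conv G f1 f2 g = (\<Sum>h\<in>{h}. f1 h * f2 (inv' h \<cdot> g))"
    proof (rule conv_row)
      show "{h} \<subseteq> {h \<in> C. r h = r g}" using h VC by auto
      fix k assume k: "k \<in> C" "r k = r g" "k \<notin> {h}"
      show "f1 k = 0"
      proof (rule ccontr)
        assume "f1 k \<noteq> 0"
        then have "k \<in> V" using V(4,5) by blast
        then have "k = h" using k h b by (metis inj_onD)
        then show False using k by simp
      qed
    qed (use g in auto)
    then show ?thesis by (simp add: sh)
  qed
  have zero: "conv G f1 f2 g = 0" if g: "g \<in> ?W2" for g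
  proof (rule ccontr)
    assume "conv G f1 f2 g \<noteq> 0"
    then obtain h k where hk: "h \<in> C" "k \<in> C" "d h = r k" "g = h \<cdot> k" "f1 h \<noteq> 0"
      using conv_support[OF bounded_functionsD(1)[OF Cc_bounded_function[OF V(1)]]] by blast
    then have "r g = r h" "h \<in> K1" using V(5) by auto
    then show False using g by auto
  qed
  show ?thesis
  proof (rule CcI[OF _ compact_product[OF V(3) K2(2)]])
    show "conv G f1 f2 g = 0" if "g \<notin> (\<lambda>(g, h). g \<cdot> h) ` ((K1 \<times> K2) \<inter> composable G)" for g
      using conv_support_compact[OF Cc_bounded_function[OF V(1)] V(5) K2(3) that] .
    show "continuous_map X euclidean (conv G f1 f2)"
    proof (rule continuous_map_open_cover2)
      show "openin X ?W1" by (rule openin_continuous_map_preimage[OF continuous_rng]) (use b in blast)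
      have "closedin X (r ` K1)" by (rule compact_closed[OF image_compactin[OF V(3) continuous_rng]])
      then show "openin X ?W2"
        by (intro openin_continuous_map_preimage[OF continuous_rng]) (simp add: closedin_def)
      show "?W1 \<union> ?W2 = topspace X" using V(4) by auto
      have cr: "continuous_map (subtopology X ?W1) (subtopology X (r ` V)) r"
        by (rule continuous_map_into_subtopology[OF continuous_map_from_subtopology[OF continuous_rng]]) auto
      have "continuous_map (subtopology X ?W1) X (s \<circ> r)"
        by (rule continuous_map_compose[OF cr]) (use b in blast)
      then have csr: "continuous_map (subtopology X ?W1) X (\<lambda>g. s (r g))" by (simp add: o_def)
      have srC: "s (r g) \<in> C" "r (s (r g)) = r g" if "g \<in> ?W1" for g
        using that b VC by auto
      have cinv: "continuous_map (subtopology X ?W1) X (\<lambda>g. inv' (s (r g)))"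
        using continuous_map_compose[OF csr continuous_inv] by (simp add: o_def)
      have cid: "continuous_map (subtopology X ?W1) X (\<lambda>g. g)"
        by (rule continuous_map_from_subtopology) simp
      have "continuous_map (subtopology X ?W1) X (\<lambda>g. inv' (s (r g)) \<cdot> g)"
        by (rule continuous_times[OF cinv cid]) (use srC in auto)
      from continuous_map_compose[OF this K2(1)] continuous_map_compose[OF csr cf1]
      have "continuous_map (subtopology X ?W1) euclidean (\<lambda>g. f1 (s (r g)) * f2 (inv' (s (r g)) \<cdot> g))"
        by (intro continuous_map_complex_mult) (simp_all add: o_def)
      then show "continuous_map (subtopology X ?W1) euclidean (conv G f1 f2)"
        by (rule continuous_map_eq) (use formula in auto)
      have "continuous_map (subtopology X ?W2) euclidean (\<lambda>g. 0 :: complex)" by simp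
      then show "continuous_map (subtopology X ?W2) euclidean (conv G f1 f2)"
        by (rule continuous_map_eq) (use zero in auto)
    qed
  qed
qed

end

context groupoid_algebraic
begin

lemma conv_add_left:
  assumes "f1 \<in> bounded_functions G" "f2 \<in> bounded_functions G" "h \<in> bounded_functions G"
  shows "conv G (\<lambda>g. f1 g + c * f2 g) h = (\<lambda>g. conv G f1 h g + c * conv G f2 h g)"
  by (rule fun_eq_lconv)
    (simp_all add: assms bounded_functions_add bounded_functions_conv lconv_conv lconv_add bounded_functionsD)

lemma conv_add_right:
  assumes "f1 \<in> bounded_functions G" "f2 \<in> bounded_functions G" "h \<in> bounded_functions G"
  shows "conv G h (\<lambda>g. f1 g + c * f2 g) = (\<lambda>g. conv G h f1 g + c * conv G h f2 g)"
  by (rule fun_eq_lconv)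
    (simp_all add: assms bounded_functions_add bounded_functions_conv lconv_conv lconv_add
      bounded_functionsD lconv_add_cscale)

lemma conv_zero [simp]: "conv G (\<lambda>g. 0) f = (\<lambda>g. 0)" "conv G f (\<lambda>g. 0) = (\<lambda>g. 0)"
  by (simp_all add: conv_def extend0_def fun_eq_iff)

end

context etale_groupoid
begin

lemma Cc_conv:
  assumes "f1 \<in> Cc G" and f2: "f2 \<in> Cc G"
  shows "conv G f1 f2 \<in> Cc G"
  using assms(1)
proof (induction rule: Cc_induct)
  case zero
  show ?case by (simp add: Cc_zero)
next
  case (add g1 g2)
  then show ?case
    using conv_add_left[of g1 g2 f2 1] Cc_add[of "conv G g1 f2" "conv G g2 f2"] by (simp add: Cc_bounded_function f2)
next
  case (elementary f)
  then show ?case by (rule conv_elementary[OF _ f2])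
qed

theorem normed_nalg_Cc_alg: "normed_nalg (Cc_alg G)"
proof
  fix x y z b c
  show "azero (Cc_alg G) \<in> acarrier (Cc_alg G)" by (simp add: Cc_alg_def Cc_zero)
  {
    assume x: "x \<in> acarrier (Cc_alg G)"
    show "ascale (Cc_alg G) c x \<in> acarrier (Cc_alg G)" using x by (simp add: Cc_alg_def Cc_scale)
    show "anorm (Cc_alg G) (ascale (Cc_alg G) c x) = cmod c * anorm (Cc_alg G) x"
      using x by (simp add: Cc_alg_def reduced_norm_scale Cc_bounded_function)
    show "x = azero (Cc_alg G)" if "anorm (Cc_alg G) x = 0"
      using x that by (simp add: Cc_alg_def reduced_norm_eq_0 Cc_bounded_function)
    assume y: "y \<in> acarrier (Cc_alg G)"
    show "aadd (Cc_alg G) x y \<in> acarrier (Cc_alg G)" "amult (Cc_alg G) x y \<in> acarrier (Cc_alg G)"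
      using x y by (simp_all add: Cc_alg_def Cc_add Cc_conv)
    show "anorm (Cc_alg G) (aadd (Cc_alg G) x y) \<le> anorm (Cc_alg G) x + anorm (Cc_alg G) y"
      using x y reduced_norm_add[of x y 1] by (simp add: Cc_alg_def Cc_bounded_function)
    show "anorm (Cc_alg G) (amult (Cc_alg G) x y) \<le> anorm (Cc_alg G) x * anorm (Cc_alg G) y"
      using x y by (simp add: Cc_alg_def Cc_bounded_function reduced_norm_conv)
    show "amult (Cc_alg G) (ascale (Cc_alg G) c x) y = ascale (Cc_alg G) c (amult (Cc_alg G) x y)"
      using x y conv_add_left[of "\<lambda>g. 0" x y c]
      by (simp add: Cc_alg_def Cc_bounded_function bounded_functions_zero)
    show "amult (Cc_alg G) x (ascale (Cc_alg G) c y) = ascale (Cc_alg G) c (amult (Cc_alg G) x y)"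
      using x y conv_add_right[of "\<lambda>g. 0" y x c]
      by (simp add: Cc_alg_def Cc_bounded_function bounded_functions_zero)
    assume z: "z \<in> acarrier (Cc_alg G)"
    show "amult (Cc_alg G) (aadd (Cc_alg G) x y) z = aadd (Cc_alg G) (amult (Cc_alg G) x z) (amult (Cc_alg G) y z)"
      using x y z conv_add_left[of x y z 1] by (simp add: Cc_alg_def Cc_bounded_function)
    show "amult (Cc_alg G) x (aadd (Cc_alg G) y z) = aadd (Cc_alg G) (amult (Cc_alg G) x y) (amult (Cc_alg G) x z)"
      using x y z conv_add_right[of y z x 1] by (simp add: Cc_alg_def Cc_bounded_function)
  }
qed (simp_all add: Cc_alg_def algebra_simps fun_eq_iff)

end


section \<open>Functions on the unit space and supports of ideals\<close>

context groupoid_algebraic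
begin

lemma conv_unit_left:
  assumes "\<And>g. g \<notin> unit_space G \<Longrightarrow> \<phi> g = 0" "g \<in> C"
  shows "conv G \<phi> f g = \<phi> (r g) * f g"
proof -
  have "conv G \<phi> f g = (\<Sum>h\<in>{r g}. \<phi> h * f (inv' h \<cdot> g))"
  proof (rule conv_row[OF _ _ _ assms(2)])
    fix h assume h: "h \<in> C" "r h = r g" "h \<notin> {r g}"
    have "h \<notin> unit_space G" using h unitD(3)[of h] by auto
    then show "\<phi> h = 0" by (rule assms(1))
  qed (use assms(2) in auto)
  also have "\<dots> = \<phi> (r g) * f g" using assms(2) by (simp add: unitD)
  finally show ?thesis .
qed

lemma conv_unit_right:
  assumes "row_finite G f" "\<And>g. g \<notin> unit_space G \<Longrightarrow> \<phi> g = 0" "g \<in> C"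
  shows "conv G f \<phi> g = f g * \<phi> (d g)"
proof -
  let ?R = "{h \<in> C. r h = r g \<and> f h \<noteq> 0}"
  have R: "finite ?R" using assms(1) by (simp add: row_finite_def)
  have "conv G f \<phi> g = (\<Sum>h\<in>?R. f h * \<phi> (inv' h \<cdot> g))"
    by (rule conv_row[OF R _ _ assms(3)]) auto
  also have "\<dots> = (\<Sum>h\<in>?R. if h = g then f g * \<phi> (d g) else 0)"
  proof (rule sum.cong[OF refl])
    fix h assume h: "h \<in> ?R"
    show "f h * \<phi> (inv' h \<cdot> g) = (if h = g then f g * \<phi> (d g) else 0)"
    proof (cases "h = g")
      case True
      then show ?thesis by (simp add: dm_def)
    next
      case False
      have "inv' h \<cdot> g \<notin> unit_space G"
      proof
        assume "inv' h \<cdot> g \<in> unit_space G"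
        then have "inv' h \<cdot> g = r (inv' h \<cdot> g)" by simp
        also have "\<dots> = d h" using h assms(3) by simp
        finally have "h \<cdot> (inv' h \<cdot> g) = h" using h by simp
        then show False using False h assms(3) by simp
      qed
      then show ?thesis using False assms(2) by simp
    qed
  qed
  also have "\<dots> = f g * \<phi> (d g)" using R assms(3) by (simp add: sum.delta)
  finally show ?thesis .
qed

lemma unit_function_bounded:
  assumes "\<And>g. g \<notin> unit_space G \<Longrightarrow> f g = 0" "\<And>g. cmod (f g) \<le> m"
  shows "f \<in> bounded_functions G" "reduced_norm G f \<le> m"
proof -
  have "unit_space G \<subseteq> C" "inj_on r (unit_space G)" "inj_on d (unit_space G)"
    by (auto simp: inj_on_def unitD)
  note b = bisection_bounded[OF this assms]
  show "f \<in> bounded_functions G" by (rule b(1))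
  show "reduced_norm G f \<le> m" by (rule b(2))
qed

end

sublocale etale_groupoid \<subseteq> alg: normed_nalg "Cc_alg G"
  by (rule normed_nalg_Cc_alg)

sublocale etale_groupoid \<subseteq> cr: normed_nalg "Cr G"
  unfolding Cr_def by (rule alg.normed_nalg_completion)

context etale_groupoid
begin

lemma alg_simps [simp]:
  "acarrier (Cc_alg G) = Cc G" "azero (Cc_alg G) = (\<lambda>g. 0)" "anorm (Cc_alg G) f = reduced_norm G f"
  "aadd (Cc_alg G) f1 f2 = (\<lambda>g. f1 g + f2 g)" "ascale (Cc_alg G) c f = (\<lambda>g. c * f g)"
  "amult (Cc_alg G) f1 f2 = conv G f1 f2"
  by (simp_all add: Cc_alg_def)

lemma adist_alg: "adist (Cc_alg G) f1 f2 = reduced_norm G (\<lambda>g. f1 g + (- 1) * f2 g)"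
  by (simp add: adist_def)

lemma unit_function_continuous:
  assumes "\<And>g. g \<notin> unit_space G \<Longrightarrow> f g = 0" "continuous_map (unit_top G) euclidean f"
  shows "continuous_map X euclidean (f :: 'g \<Rightarrow> complex)"
proof (rule continuous_map_open_cover2)
  show "openin X (unit_space G)" by (rule openin_unit_space)
  show "openin X (topspace X - unit_space G)" using closedin_unit_space by (simp add: closedin_def)
  show "unit_space G \<union> (topspace X - unit_space G) = topspace X" using unit_space_subset by auto
  show "continuous_map (subtopology X (unit_space G)) euclidean f" using assms(2) by (simp add: unit_top_def)
  have "continuous_map (subtopology X (topspace X - unit_space G)) euclidean (\<lambda>g. 0 :: complex)" by simp
  then show "continuous_map (subtopology X (topspace X - unit_space G)) euclidean f"
    by (rule continuous_map_eq) (use assms(1) in auto)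
qed

lemma C0_unitD:
  assumes "f \<in> C0_unit G"
  shows "g \<notin> unit_space G \<Longrightarrow> f g = 0" "continuous_map X euclidean f"
    "e > 0 \<Longrightarrow> compactin X {u \<in> unit_space G. e \<le> cmod (f u)}"
proof -
  show z: "g \<notin> unit_space G \<Longrightarrow> f g = 0" for g using assms by (simp add: C0_unit_def)
  show "continuous_map X euclidean f"
    using assms by (intro unit_function_continuous z) (simp_all add: C0_unit_def)
  show "e > 0 \<Longrightarrow> compactin X {u \<in> unit_space G. e \<le> cmod (f u)}"
    using assms by (simp add: C0_unit_def unit_top_def compactin_subtopology)
qed

lemma C0_unit_bounded_function:
  assumes f: "f \<in> C0_unit G"
  shows "f \<in> bounded_functions G"
proof -
  let ?K = "{u \<in> unit_space G. 1 \<le> cmod (f u)}"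
  have "compactin X ?K" by (rule C0_unitD(3)[OF f]) simp
  then have "compact (f ` ?K)" using image_compactin[OF _ C0_unitD(2)[OF f]] by fastforce
  then obtain m where m: "\<And>x. x \<in> f ` ?K \<Longrightarrow> cmod x \<le> m" using compact_imp_bounded bounded_iff by metis
  have "cmod (f g) \<le> max m 1" for g
  proof (cases "g \<in> ?K")
    case True
    then show ?thesis using m[of "f g"] by auto
  next
    case False
    then show ?thesis using C0_unitD(1)[OF f, of g] by (cases "g \<in> unit_space G") auto
  qed
  then show ?thesis using C0_unitD(1)[OF f] by (intro unit_function_bounded(1)) auto
qed

definition unit_functions :: "('g \<Rightarrow> complex) set" where
  "unit_functions = {f \<in> Cc G. \<forall>g. g \<notin> unit_space G \<longrightarrow> f g = 0}"

lemma unit_functions_C0: "f \<in> unit_functions \<Longrightarrow> f \<in> C0_unit G"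
proof -
  assume "f \<in> unit_functions"
  then have f: "f \<in> Cc G" "\<And>g. g \<notin> unit_space G \<Longrightarrow> f g = 0" by (auto simp: unit_functions_def)
  obtain K where K: "continuous_map X euclidean f" "compactin X K" "\<And>g. g \<notin> K \<Longrightarrow> f g = 0"
    using CcE[OF f(1)] by blast
  have "compactin (unit_top G) {u \<in> unit_space G. e \<le> cmod (f u)}" if e: "e > 0" for e
  proof -
    have "closedin X {u \<in> topspace X. norm (f u) \<in> {e..}}"
      by (rule closedin_continuous_map_preimage[OF continuous_map_norm[OF K(1)]]) simp
    moreover have "{u \<in> topspace X. cmod (f u) \<in> {e..}} = {u \<in> unit_space G. e \<le> cmod (f u)}"
      using f(2) e unit_space_subset by force
    moreover have "{u \<in> unit_space G. e \<le> cmod (f u)} \<subseteq> K" using K(3) e by force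
    ultimately show ?thesis
      using closed_compactin[OF K(2)] by (auto simp: unit_top_def compactin_subtopology)
  qed
  then show "f \<in> C0_unit G"
    using f K(1) by (auto simp: C0_unit_def unit_top_def continuous_map_from_subtopology)
qed

lemma unit_bump:
  assumes K: "compactin X K" "K \<subseteq> V" and V: "openin X V" "V \<subseteq> unit_space G"
  obtains \<kappa> where "\<kappa> \<in> unit_functions" "\<And>u. u \<in> K \<Longrightarrow> \<kappa> u = 1" "\<And>g. cmod (1 - \<kappa> g) \<le> 1"
    "\<exists>L. compactin X L \<and> L \<subseteq> V \<and> (\<forall>g. g \<notin> L \<longrightarrow> \<kappa> g = 0)"
proof -
  obtain \<phi> L where \<phi>: "continuous_map X euclideanreal \<phi>" "\<And>x. x \<in> topspace X \<Longrightarrow> 0 \<le> \<phi> x \<and> \<phi> x \<le> 1"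
    "\<And>x. x \<in> K \<Longrightarrow> \<phi> x = 1" "compactin X L" "L \<subseteq> V" "\<And>x. x \<in> topspace X - L \<Longrightarrow> \<phi> x = 0"
    using bump_function[OF lc hausdorff K V(1)] by blast
  define \<kappa> where "\<kappa> g = (if g \<in> C then complex_of_real (\<phi> g) else 0)" for g
  have LC: "L \<subseteq> C" by (rule compact_subset[OF \<phi>(4)])
  have zero: "\<kappa> g = 0" if "g \<notin> L" for g using \<phi>(6) that by (simp add: \<kappa>_def)
  have "continuous_map X euclidean \<kappa>"
    by (rule continuous_map_eq[OF continuous_map_complex_of_real[OF \<phi>(1)]]) (simp add: \<kappa>_def)
  then have "\<kappa> \<in> Cc G" using \<phi>(4) zero by (rule CcI)
  then have "\<kappa> \<in> unit_functions" using zero \<phi>(5) V(2) by (auto simp: unit_functions_def)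
  moreover have "\<kappa> u = 1" if "u \<in> K" for u
    using \<phi>(3) that compact_subset[OF K(1)] by (auto simp: \<kappa>_def)
  moreover have "cmod (1 - \<kappa> g) \<le> 1" for g
  proof (cases "g \<in> C")
    case True
    then have "1 - \<kappa> g = complex_of_real (1 - \<phi> g)" by (simp add: \<kappa>_def)
    then show ?thesis using \<phi>(2)[of g] True by (simp only: norm_of_real) simp
  qed (simp add: \<kappa>_def)
  ultimately show ?thesis using that zero \<phi>(4,5) by blast
qed

text \<open>Cutting \<open>f\<close> off outside of the compact sets where it is not small gives approximations of compact support; on the
  unit space the reduced norm is dominated by the supremum norm.\<close>

lemma C0_unit_approx:
  assumes f: "f \<in> C0_unit G" and e: "e > 0"
  obtains h where "h \<in> Cc G" "adist (Cc_alg G) h f \<le> e"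
proof -
  let ?K = "{u \<in> unit_space G. e \<le> cmod (f u)}"
  have K: "compactin X ?K" by (rule C0_unitD(3)[OF f e])
  obtain \<kappa> where \<kappa>: "\<kappa> \<in> unit_functions" "\<And>u. u \<in> ?K \<Longrightarrow> \<kappa> u = 1" "\<And>g. cmod (1 - \<kappa> g) \<le> 1"
  proof -
    have "?K \<subseteq> unit_space G" by blast
    show thesis
      by (rule unit_bump[OF K \<open>?K \<subseteq> unit_space G\<close> openin_unit_space order_refl]) (rule that; assumption)
  qed
  let ?h = "\<lambda>g. f g * \<kappa> g"
  have "?h \<in> Cc G" using \<kappa>(1) C0_unitD(2)[OF f] by (intro Cc_continuous_mult) (simp_all add: unit_functions_def)
  moreover have "adist (Cc_alg G) ?h f \<le> e" unfolding adist_alg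
  proof (rule unit_function_bounded(2))
    show "?h g + (- 1) * f g = 0" if "g \<notin> unit_space G" for g using C0_unitD(1)[OF f that] by simp
    show "cmod (?h g + (- 1) * f g) \<le> e" for g
    proof -
      have "?h g + (- 1) * f g = - ((1 - \<kappa> g) * f g)" by (simp add: algebra_simps)
      then have "cmod (?h g + (- 1) * f g) = cmod (1 - \<kappa> g) * cmod (f g)" by (simp add: norm_mult)
      also have "\<dots> \<le> e"
      proof (cases "g \<in> ?K")
        case True then show ?thesis using \<kappa>(2) e by simp
      next
        case False
        then have "cmod (f g) \<le> e" using C0_unitD(1)[OF f, of g] e by (cases "g \<in> unit_space G") auto
        then show ?thesis using mult_mono[OF \<kappa>(3)[of g], of "cmod (f g)" e] by simp
      qed
      finally show ?thesis .
    qed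
  qed
  ultimately show ?thesis by (rule that)
qed

lemma bounded_dist_triangle:
  assumes "f1 \<in> bounded_functions G" "f2 \<in> bounded_functions G" "f3 \<in> bounded_functions G"
  shows "adist (Cc_alg G) f1 f2 \<le> adist (Cc_alg G) f1 f3 + adist (Cc_alg G) f2 f3"
proof -
  have b: "(\<lambda>g. f g + (- 1) * f3 g) \<in> bounded_functions G" if "f \<in> bounded_functions G" for f
    by (rule bounded_functions_add[OF that assms(3)])
  show ?thesis unfolding adist_alg
    using reduced_norm_add[OF b[OF assms(1)] b[OF assms(2)], of "- 1"] by (simp add: algebra_simps)
qed

lemma bounded_dist_commute:
  assumes "f1 \<in> bounded_functions G" "f2 \<in> bounded_functions G"
  shows "adist (Cc_alg G) f1 f2 = adist (Cc_alg G) f2 f1"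
  using reduced_norm_scale[OF bounded_functions_add[OF assms], of "- 1" "- 1"]
  unfolding adist_alg by (simp add: algebra_simps)

lemma C0_embed_nonempty:
  assumes f: "f \<in> C0_unit G"
  obtains s where "s \<in> C0_embed G f"
proof -
  have "\<exists>h\<in>Cc G. adist (Cc_alg G) h f \<le> 1 / real (Suc n)" for n
    using C0_unit_approx[OF f, of "1 / real (Suc n)"] by auto
  then obtain s where s: "\<And>n. s n \<in> Cc G" "\<And>n. adist (Cc_alg G) (s n) f \<le> 1 / real (Suc n)" by metis
  note b = Cc_bounded_function[OF s(1)] C0_unit_bounded_function[OF f]
  have lim: "(\<lambda>n. 1 / real (Suc n)) \<longlonglongrightarrow> 0"
    using LIMSEQ_inverse_real_of_nat by (simp add: inverse_eq_divide)
  have "s \<in> cauchy_seqs (Cc_alg G)"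
  proof (rule alg.cauchy_seqsI)
    fix e :: real assume "e > 0"
    then have e: "e / 2 > 0" by simp
    obtain N where N: "\<And>n. n \<ge> N \<Longrightarrow> 1 / real (Suc n) < e / 2"
      using order_tendstoD(2)[OF lim e] by (auto simp: eventually_sequentially)
    have "adist (Cc_alg G) (s m) (s n) < e" if "m \<ge> N" "n \<ge> N" for m n
      using bounded_dist_triangle[OF b(1) b(1) b(2), of m n] s(2)[of m] s(2)[of n] N[of m] N[of n] that by linarith
    then show "\<exists>N. \<forall>m\<ge>N. \<forall>n\<ge>N. adist (Cc_alg G) (s m) (s n) < e" by blast
  qed (simp add: s)
  moreover have "(\<lambda>n. adist (Cc_alg G) (s n) f) \<longlonglongrightarrow> 0"
  proof (rule tendsto_sandwich[OF _ _ tendsto_const lim])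
    show "\<forall>\<^sub>F n in sequentially. 0 \<le> adist (Cc_alg G) (s n) f"
      unfolding adist_alg by (intro always_eventually allI reduced_norm_nonneg bounded_functions_add b)
  qed (use s(2) in \<open>simp del: of_nat_Suc\<close>)
  ultimately show ?thesis using that by (simp add: C0_embed_def)
qed

lemma C0_embed_cls:
  assumes f: "f \<in> C0_unit G" and s: "s \<in> C0_embed G f"
  shows "s \<in> cauchy_seqs (Cc_alg G)" "(\<lambda>n. adist (Cc_alg G) (s n) f) \<longlonglongrightarrow> 0" "C0_embed G f = alg.cls s"
proof -
  show sc: "s \<in> cauchy_seqs (Cc_alg G)" and sl: "(\<lambda>n. adist (Cc_alg G) (s n) f) \<longlonglongrightarrow> 0"
    using s by (simp_all add: C0_embed_def)
  have bs: "t n \<in> bounded_functions G" if "t \<in> cauchy_seqs (Cc_alg G)" for t n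
    using alg.cauchyD[OF that, of n] by (simp add: Cc_bounded_function)
  note bf = C0_unit_bounded_function[OF f]
  have "t \<in> C0_embed G f \<longleftrightarrow> (s, t) \<in> null_rel (Cc_alg G)" for t
  proof
    assume "t \<in> C0_embed G f"
    then have t: "t \<in> cauchy_seqs (Cc_alg G)" "(\<lambda>n. adist (Cc_alg G) (t n) f) \<longlonglongrightarrow> 0"
      by (simp_all add: C0_embed_def)
    have "(\<lambda>n. adist (Cc_alg G) (s n) (t n)) \<longlonglongrightarrow> 0"
    proof (rule alg.null_squeeze)
      show "(\<lambda>n. adist (Cc_alg G) (s n) f + adist (Cc_alg G) (t n) f) \<longlonglongrightarrow> 0"
        using tendsto_add[OF sl t(2)] by simp
    qed (simp_all add: bounded_dist_triangle bs sc t bf alg.cauchyD[simplified])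
    then show "(s, t) \<in> null_rel (Cc_alg G)" using sc t by (intro alg.null_relI)
  next
    assume st: "(s, t) \<in> null_rel (Cc_alg G)"
    note t = alg.null_relD[OF st]
    have "(\<lambda>n. adist (Cc_alg G) (t n) f) \<longlonglongrightarrow> 0"
    proof (rule tendsto_sandwich[OF _ _ tendsto_const])
      show "(\<lambda>n. adist (Cc_alg G) (s n) (t n) + adist (Cc_alg G) (s n) f) \<longlonglongrightarrow> 0"
        using tendsto_add[OF t(3) sl] by simp
      show "\<forall>\<^sub>F n in sequentially. 0 \<le> adist (Cc_alg G) (t n) f"
        unfolding adist_alg by (intro always_eventually allI reduced_norm_nonneg bounded_functions_add bs t bf)
      have "adist (Cc_alg G) (t n) f \<le> adist (Cc_alg G) (s n) (t n) + adist (Cc_alg G) (s n) f" for n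
        using bounded_dist_triangle[OF bs[OF t(2), of n] bf bs[OF t(1), of n]]
          bounded_dist_commute[OF bs[OF t(2), of n] bs[OF t(1), of n]]
          bounded_dist_commute[OF bf bs[OF t(1), of n]] by simp
      then show "\<forall>\<^sub>F n in sequentially. adist (Cc_alg G) (t n) f \<le> adist (Cc_alg G) (s n) (t n) + adist (Cc_alg G) (s n) f"
        by simp
    qed
    then show "t \<in> C0_embed G f" using t by (simp add: C0_embed_def)
  qed
  then show "C0_embed G f = alg.cls s" by (auto simp: alg.cls_def)
qed

lemma C0_embed_unit_function:
  assumes "f \<in> unit_functions"
  shows "C0_embed G f = alg.emb f"
proof -
  have f: "f \<in> Cc G" "f \<in> C0_unit G" using assms unit_functions_C0 by (auto simp: unit_functions_def)
  have "adist (Cc_alg G) f f = 0" using alg.adist_self[of f] f by simp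
  then have "(\<lambda>n. f) \<in> C0_embed G f" using f(1) by (simp add: C0_embed_def)
  then show ?thesis using C0_embed_cls(3)[OF f(2)] by (simp add: alg.emb_def)
qed

lemma emb_zero_Cr: "azero (Cr G) = alg.emb (\<lambda>g. 0)"
  using alg.emb_zero by (simp add: Cr_def)

lemma C0_embed_zero: "C0_embed G (\<lambda>g. 0) = azero (Cr G)" "(\<lambda>g. 0) \<in> C0_unit G"
proof -
  have u: "(\<lambda>g. 0) \<in> unit_functions" by (simp add: unit_functions_def Cc_zero)
  show "C0_embed G (\<lambda>g. 0) = azero (Cr G)" by (simp only: C0_embed_unit_function[OF u] emb_zero_Cr)
  show "(\<lambda>g. 0) \<in> C0_unit G" by (rule unit_functions_C0[OF u])
qed

text \<open>Convergence in the reduced norm implies pointwise convergence.  This is how membership in a closure restricts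
  where \<open>f\<close> can be non-zero.\<close>

lemma C0_embed_in_closure:
  assumes f: "f \<in> C0_unit G" and S: "S \<subseteq> Cc G" "C0_embed G f \<in> alg.emb_closure S" and e: "e > 0"
  obtains h where "h \<in> S" "cmod (f g - h g) < e"
proof -
  obtain s where s: "s \<in> C0_embed G f" using C0_embed_nonempty[OF f] by blast
  note sc = C0_embed_cls[OF f s]
  have e': "e / 3 > 0" using e by simp
  obtain h where h: "h \<in> S" "adist (Cr G) (alg.cls s) (alg.emb h) < e / 3"
    using S(2) e' unfolding sc(3) alg.emb_closure_def Cr_def by blast
  obtain N where N: "\<And>n. N \<le> n \<Longrightarrow> adist (Cr G) (alg.cls s) (alg.emb (s n)) < e / 3"
    using alg.adist_cls_emb[OF sc(1) e'] unfolding Cr_def by blast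
  obtain M where M: "\<And>n. n \<ge> M \<Longrightarrow> adist (Cc_alg G) (s n) f < e / 3"
    using order_tendstoD(2)[OF sc(2) e'] by (auto simp: eventually_sequentially)
  let ?n = "max M N"
  have sC: "s n \<in> Cc G" for n using alg.cauchyD[OF sc(1)] by simp
  have hC: "h \<in> Cc G" using h(1) S(1) by blast
  note b = Cc_bounded_function[OF sC] Cc_bounded_function[OF hC] C0_unit_bounded_function[OF f]
  have cl: "alg.cls s \<in> acarrier (Cr G)" "alg.emb h \<in> acarrier (Cr G)" "alg.emb (s ?n) \<in> acarrier (Cr G)"
    using sc(1) hC sC by (simp_all add: Cr_def)
  have "adist (Cc_alg G) (s ?n) h = adist (Cr G) (alg.emb (s ?n)) (alg.emb h)"
    using sC hC by (simp add: Cr_def)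
  also have "\<dots> \<le> adist (Cr G) (alg.emb (s ?n)) (alg.cls s) + adist (Cr G) (alg.cls s) (alg.emb h)"
    by (rule cr.adist_triangle) (use cl in auto)
  also have "\<dots> < e / 3 + e / 3"
    using h(2) N[of ?n] cr.adist_commute[OF cl(1,3)] by simp
  finally have 1: "adist (Cc_alg G) (s ?n) h < e / 3 + e / 3" .
  have "cmod (f g - h g) = cmod (f g + (- 1) * h g)" by simp
  also have "\<dots> \<le> adist (Cc_alg G) f h" unfolding adist_alg
    by (rule cmod_le_reduced_norm[OF bounded_functions_add[OF b(3) b(2)]])
  also have "\<dots> \<le> adist (Cc_alg G) f (s ?n) + adist (Cc_alg G) h (s ?n)"
    by (rule bounded_dist_triangle) (rule b)+
  also have "\<dots> = adist (Cc_alg G) (s ?n) f + adist (Cc_alg G) (s ?n) h"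
    using bounded_dist_commute b by metis
  also have "\<dots> < e" using 1 M[of ?n] by simp
  finally show ?thesis using h(1) by (rule that[rotated])
qed

text \<open>Multiplication by a bump function at \<open>u\<close> replaces \<open>f\<close>, which need not have compact support, by a function in
  \<open>C\<^sub>c(G)\<close>, and stays in the ideal.\<close>

lemma ideal_unit_function:
  assumes I: "closed_ideal (Cr G) I" and f: "f \<in> C0_unit G" "C0_embed G f \<in> I" and u: "f u \<noteq> 0"
  obtains h where "h \<in> unit_functions" "alg.emb h \<in> I" "h u \<noteq> 0"
proof -
  have uU: "u \<in> unit_space G" using C0_unitD(1)[OF f(1)] u by blast
  obtain \<kappa> where \<kappa>: "\<kappa> \<in> unit_functions" "\<And>v. v \<in> {u} \<Longrightarrow> \<kappa> v = 1"
  proof -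
    have "compactin X {u}" "{u} \<subseteq> unit_space G" using uU by (simp_all add: unitD)
    note bump = unit_bump[OF this openin_unit_space order_refl]
    show thesis by (rule bump) (rule that; assumption)
  qed
  have \<kappa>': "\<kappa> \<in> Cc G" "\<And>g. g \<notin> unit_space G \<Longrightarrow> \<kappa> g = 0" using \<kappa>(1) by (auto simp: unit_functions_def)
  let ?h = "conv G \<kappa> f"
  note bf = C0_unit_bounded_function[OF f(1)] and b\<kappa> = Cc_bounded_function[OF \<kappa>'(1)]
  have h: "?h = (\<lambda>g. f g * \<kappa> g)"
  proof
    fix g show "?h g = f g * \<kappa> g"
    proof (cases "g \<in> unit_space G")
      case True
      then show ?thesis using conv_unit_left[where \<phi> = \<kappa> and g = g and f = f, OF \<kappa>'(2)] by (simp add: unitD)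
    next
      case False
      then have "f g = 0" by (rule C0_unitD(1)[OF f(1)])
      then show ?thesis using conv_unit_left[where \<phi> = \<kappa> and g = g and f = f, OF \<kappa>'(2)]
        by (cases "g \<in> C") (auto simp: conv_def extend0_def)
    qed
  qed
  then have hU: "?h \<in> unit_functions"
    using Cc_continuous_mult[OF \<kappa>'(1) C0_unitD(2)[OF f(1)]] \<kappa>'(2) by (simp add: unit_functions_def)
  obtain s where s: "s \<in> C0_embed G f" using C0_embed_nonempty[OF f(1)] by blast
  note sc = C0_embed_cls[OF f(1) s]
  have sC: "s n \<in> Cc G" for n using alg.cauchyD[OF sc(1)] by simp
  have "amult (Cr G) (alg.emb \<kappa>) (alg.cls s) = alg.cls (\<lambda>n. conv G \<kappa> (s n))"
    unfolding Cr_def alg.emb_def using sc(1) \<kappa>'(1) by (subst alg.mult_completion) auto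
  also have "\<dots> = alg.emb ?h" unfolding alg.emb_def
  proof (subst alg.cls_eq_iff)
    show "(\<lambda>n. conv G \<kappa> (s n)) \<in> cauchy_seqs (Cc_alg G)"
      using alg.mult_cauchy[OF alg.const_cauchy[of \<kappa>] sc(1)] \<kappa>'(1) by simp
    show "(\<lambda>n. ?h) \<in> cauchy_seqs (Cc_alg G)" using hU by (simp add: unit_functions_def)
    have le: "adist (Cc_alg G) (conv G \<kappa> (s n)) ?h \<le> reduced_norm G \<kappa> * adist (Cc_alg G) (s n) f" for n
    proof -
      note bs = Cc_bounded_function[OF sC, of n]
      show ?thesis unfolding adist_alg
        using reduced_norm_conv[OF b\<kappa> bounded_functions_add[OF bs bf, of "- 1"]]
        by (simp add: conv_add_right[OF bs bf b\<kappa>, of "- 1", simplified])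
    qed
    show "(\<lambda>n. adist (Cc_alg G) (conv G \<kappa> (s n)) ?h) \<longlonglongrightarrow> 0"
    proof (rule alg.null_squeeze[OF _ le])
      show "(\<lambda>n. reduced_norm G \<kappa> * adist (Cc_alg G) (s n) f) \<longlonglongrightarrow> 0"
        using tendsto_mult_left[OF sc(2), of "reduced_norm G \<kappa>"] by simp
      show "conv G \<kappa> (s n) \<in> acarrier (Cc_alg G)" for n using Cc_conv[OF \<kappa>'(1) sC] by simp
      show "?h \<in> acarrier (Cc_alg G)" using hU by (simp add: unit_functions_def)
    qed
  qed
  finally have "amult (Cr G) (alg.emb \<kappa>) (C0_embed G f) = alg.emb ?h" by (simp add: sc(3))
  moreover have "alg.emb \<kappa> \<in> acarrier (Cr G)" using \<kappa>'(1) by (simp add: Cr_def)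
  ultimately have "alg.emb ?h \<in> I" using I f(2) unfolding closed_ideal_def by metis
  moreover have "?h u \<noteq> 0" using \<kappa>(2) u by (simp add: h)
  ultimately show ?thesis using hU that by blast
qed

lemma ideal_support_iff:
  assumes I: "closed_ideal (Cr G) I"
  shows "u \<in> ideal_support G I \<longleftrightarrow> (\<exists>h\<in>unit_functions. alg.emb h \<in> I \<and> h u \<noteq> 0)"
proof
  assume "u \<in> ideal_support G I"
  then obtain f where "f \<in> C0_unit G" "C0_embed G f \<in> I" "f u \<noteq> 0" by (auto simp: ideal_support_def)
  then show "\<exists>h\<in>unit_functions. alg.emb h \<in> I \<and> h u \<noteq> 0"
    using ideal_unit_function[OF I] by metis
next
  assume "\<exists>h\<in>unit_functions. alg.emb h \<in> I \<and> h u \<noteq> 0"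
  then obtain h where h: "h \<in> unit_functions" "alg.emb h \<in> I" "h u \<noteq> 0" by blast
  then have "C0_embed G h \<in> I" "h \<in> C0_unit G" using C0_embed_unit_function unit_functions_C0 by auto
  then show "u \<in> ideal_support G I" using h(3) by (auto simp: ideal_support_def)
qed

lemma ideal_mult_emb:
  assumes I: "closed_ideal (Cr G) I" and "a \<in> Cc G" "h \<in> Cc G" "alg.emb h \<in> I"
  shows "alg.emb (conv G a h) \<in> I" "alg.emb (conv G h a) \<in> I"
proof -
  have "alg.emb a \<in> acarrier (Cr G)" using assms(2) by (simp add: Cr_def)
  then have "amult (Cr G) (alg.emb a) (alg.emb h) \<in> I" "amult (Cr G) (alg.emb h) (alg.emb a) \<in> I"
    using I assms(4) unfolding closed_ideal_def by blast+
  then show "alg.emb (conv G a h) \<in> I" "alg.emb (conv G h a) \<in> I"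
    using assms(2,3) by (simp_all add: Cr_def alg.emb_mult)
qed

lemma ideal_support_open:
  assumes I: "closed_ideal (Cr G) I"
  shows "openin X (ideal_support G I)"
proof (subst openin_subopen, intro ballI)
  fix u assume "u \<in> ideal_support G I"
  then obtain h where h: "h \<in> unit_functions" "alg.emb h \<in> I" "h u \<noteq> 0" using ideal_support_iff[OF I] by blast
  let ?T = "{g \<in> topspace X. h g \<in> - {0}}"
  have "continuous_map X euclidean h" using h(1) by (simp add: unit_functions_def Cc_def)
  then have "openin X ?T" by (rule openin_continuous_map_preimage) (simp add: open_Compl)
  moreover have "u \<in> ?T" using h by (auto simp: unit_functions_def Cc_def)
  moreover have "?T \<subseteq> ideal_support G I" using ideal_support_iff[OF I] h by blast
  ultimately show "\<exists>T. openin X T \<and> u \<in> T \<and> T \<subseteq> ideal_support G I" by blast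
qed

lemma ideal_support_subset: "ideal_support G I \<subseteq> unit_space G"
  using C0_unitD(1) by (auto simp: ideal_support_def)

text \<open>Conjugating a function on the unit space by a function supported in a bisection moves its
  support from the domains to the ranges of the bisection.\<close>

lemma ideal_support_invariant:
  assumes I: "closed_ideal (Cr G) I"
  shows "invariant G (ideal_support G I)"
  unfolding invariant_def
proof (intro conjI ballI impI ideal_support_subset)
  fix g assume g: "g \<in> C" "d g \<in> ideal_support G I"
  obtain h where h: "h \<in> unit_functions" "alg.emb h \<in> I" "h (d g) \<noteq> 0"
    using g(2) ideal_support_iff[OF I] by blast
  have h': "h \<in> Cc G" "\<And>g. g \<notin> unit_space G \<Longrightarrow> h g = 0" using h(1) by (auto simp: unit_functions_def)
  obtain V s where V: "bisection V s" "g \<in> V" using bisection_nbhd[OF g(1)] by blast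
  note b = V(1)[unfolded bisection_def]
  have gK: "compactin X {g}" using g(1) by simp
  obtain \<psi> L where \<psi>: "continuous_map X euclideanreal \<psi>" "\<And>x. x \<in> {g} \<Longrightarrow> \<psi> x = 1"
    "compactin X L" "L \<subseteq> V" "\<And>x. x \<in> topspace X - L \<Longrightarrow> \<psi> x = 0"
  proof -
    have "{g} \<subseteq> V" "openin X V" using V(2) b by auto
    note bump = bump_function[OF lc hausdorff gK this]
    show thesis by (rule bump) (rule that; assumption)
  qed
  define \<phi> where "\<phi> x = (if x \<in> C then complex_of_real (\<psi> x) else 0)" for x
  have \<phi>L: "\<phi> x = 0" if "x \<notin> L" for x using \<psi>(5) that by (simp add: \<phi>_def)
  have "continuous_map X euclidean \<phi>"
    by (rule continuous_map_eq[OF continuous_map_complex_of_real[OF \<psi>(1)]]) (simp add: \<phi>_def)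
  then have \<phi>C: "\<phi> \<in> Cc G" using \<psi>(3) \<phi>L by (rule CcI)
  have \<phi>g: "\<phi> g = 1" using \<psi>(2) g(1) by (simp add: \<phi>_def)
  have \<phi>V: "x \<in> V" if "\<phi> x \<noteq> 0" for x using \<phi>L that \<psi>(4) by blast
  note row = bounded_functionsD(1)[OF Cc_bounded_function]
  let ?p = "conv G \<phi> h" and ?i = "involution G \<phi>"
  let ?k = "conv G ?p ?i"
  have pC: "?p \<in> Cc G" by (rule Cc_conv[OF \<phi>C h'(1)])
  have iC: "?i \<in> Cc G" by (rule Cc_involution[OF \<phi>C])
  have p: "?p a = \<phi> a * h (d a)" if "a \<in> C" for a
    by (rule conv_unit_right[OF row[OF \<phi>C] h'(2) that])
  have kI: "alg.emb ?k \<in> I"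
    using ideal_mult_emb(2)[OF I iC pC] ideal_mult_emb(1)[OF I \<phi>C h'(1) h(2)] by blast
  have "?k a = 0" if a: "a \<notin> unit_space G" for a
  proof (rule ccontr)
    assume "?k a \<noteq> 0"
    then obtain x y where xy: "x \<in> C" "y \<in> C" "d x = r y" "a = x \<cdot> y" "?p x \<noteq> 0" "?i y \<noteq> 0"
      using conv_support[OF row[OF pC]] by blast
    have "x \<in> V" "inv' y \<in> V" using \<phi>V xy p by (auto simp: involution_def extend0_def)
    moreover have "d x = d (inv' y)" using xy by simp
    ultimately have "x = inv' y" using b by (metis inj_onD)
    then have "a = d y" using xy by (simp add: dm_def)
    then show False using a xy by simp
  qed
  then have kU: "?k \<in> unit_functions" using Cc_conv[OF pC iC] by (simp add: unit_functions_def)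
  have "?k (r g) = (\<Sum>x\<in>{g}. ?p x * ?i (inv' x \<cdot> r g))"
  proof (rule conv_row)
    fix x assume x: "x \<in> C" "r x = r (r g)" "x \<notin> {g}"
    show "?p x = 0"
    proof (rule ccontr)
      assume "?p x \<noteq> 0"
      then have "x \<in> V" using \<phi>V x p by auto
      moreover have "r x = r g" using x g by simp
      ultimately have "x = g" using b V(2) by (metis inj_onD)
      then show False using x by simp
    qed
  qed (use g in auto)
  also have "\<dots> = ?p g * ?i (inv' g)"
    using mult_dm[of "inv' g"] g(1) by simp
  also have "\<dots> = h (d g)" using p[OF g(1)] \<phi>g g(1) by (simp add: involution_def extend0_def)
  finally show "r g \<in> ideal_support G I" using ideal_support_iff[OF I] kU kI h(3) by metis
qed

end


section \<open>Restriction to invariant subsets\<close>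

lemma restrict_groupoid_simps [simp]:
  "gmult (restrict_groupoid G D) = gmult G" "ginv (restrict_groupoid G D) = ginv G"
  "gtop (restrict_groupoid G D) = subtopology (gtop G) {g \<in> gcarrier G. dm G g \<in> D}"
  "rng (restrict_groupoid G D) = rng G" "dm (restrict_groupoid G D) = dm G"
  "gcarrier (restrict_groupoid G D) = {g \<in> gcarrier G. dm G g \<in> D}"
  by (auto simp: restrict_groupoid_def rng_def[abs_def] dm_def[abs_def] gcarrier_def)

context groupoid_algebraic
begin

lemma invariant_rng_iff:
  assumes "invariant G D" "g \<in> C"
  shows "r g \<in> D \<longleftrightarrow> d g \<in> D"
  using assms unfolding invariant_def by (metis dm_inv inv_closed rng_inv)

lemma unit_space_restrict:
  assumes "invariant G D"
  shows "unit_space (restrict_groupoid G D) = D"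
proof -
  have "D \<subseteq> unit_space G" using assms by (simp add: invariant_def)
  show ?thesis unfolding unit_space_def[of "restrict_groupoid G D"] restrict_groupoid_simps
  proof
    show "D \<subseteq> d ` {g \<in> C. d g \<in> D}"
    proof
      fix u assume "u \<in> D"
      then have "u \<in> C" "d u = u" using \<open>D \<subseteq> unit_space G\<close> by (auto simp: unitD)
      then show "u \<in> d ` {g \<in> C. d g \<in> D}" using \<open>u \<in> D\<close> by (intro image_eqI[of _ _ u]) simp_all
    qed
  qed auto
qed

lemma algebraic_restrict:
  assumes D: "invariant G D"
  shows "algebraic_groupoid (restrict_groupoid G D)"
  unfolding algebraic_groupoid_def composable_def restrict_groupoid_simps
  using invariant_rng_iff[OF D] by (auto intro: mult_assoc)

lemma invariant_Diff: "invariant G D \<Longrightarrow> invariant G (unit_space G - D)"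
  using invariant_rng_iff[of D] unfolding invariant_def by auto

text \<open>If the range of \<open>g\<close> lies in \<open>D\<close> then so do the domains of all arrows with the same range, so that the sums
  which define the two convolutions agree.\<close>

lemma conv_restrict:
  assumes D: "invariant G D" and f: "\<And>g. g \<in> C \<Longrightarrow> d g \<in> D \<Longrightarrow> f1' g = f1 g" "\<And>g. g \<in> C \<Longrightarrow> d g \<in> D \<Longrightarrow> f2' g = f2 g"
  shows "conv (restrict_groupoid G D) f1' f2' = extend0 (gcarrier (restrict_groupoid G D)) (conv G f1 f2)"
proof
  fix g
  show "conv (restrict_groupoid G D) f1' f2' g = extend0 (gcarrier (restrict_groupoid G D)) (conv G f1 f2) g"
  proof (cases "g \<in> C \<and> d g \<in> D")
    case True
    then have rg: "r g \<in> D" using invariant_rng_iff[OF D] by blast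
    have hD: "d h \<in> D" if "h \<in> C" "r h = r g" for h
      using invariant_rng_iff[OF D that(1)] that rg by simp
    have "(\<Sum>\<^sub>\<infinity>h\<in>{h \<in> {g \<in> C. d g \<in> D}. r h = r g}. f1' h * f2' (inv' h \<cdot> g))
        = (\<Sum>\<^sub>\<infinity>h\<in>{h \<in> C. r h = r g}. f1 h * f2 (inv' h \<cdot> g))"
    proof (rule infsum_cong_neutral)
      fix h assume "h \<in> {h \<in> {g \<in> C. d g \<in> D}. r h = r g} \<inter> {h \<in> C. r h = r g}"
      then have h: "h \<in> C" "d h \<in> D" "r h = r g" by auto
      have "f2' (inv' h \<cdot> g) = f2 (inv' h \<cdot> g)" using h True by (intro f(2)) simp_all
      then show "f1' h * f2' (inv' h \<cdot> g) = f1 h * f2 (inv' h \<cdot> g)" using f(1) h by simp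
    qed (use hD in auto)
    then show ?thesis using True by (simp add: conv_def extend0_def)
  next
    case False
    then show ?thesis by (auto simp: conv_def extend0_def)
  qed
qed

lemma restricted_function:
  assumes D: "invariant G D" and f: "f \<in> bounded_functions G"
  shows "extend0 (gcarrier (restrict_groupoid G D)) f \<in> bounded_functions (restrict_groupoid G D)"
    and "reduced_norm (restrict_groupoid G D) (extend0 (gcarrier (restrict_groupoid G D)) f) \<le> reduced_norm G f"
proof -
  interpret R: groupoid_algebraic "restrict_groupoid G D"
    by unfold_locales (rule algebraic_restrict[OF D])
  let ?R = "restrict_groupoid G D"
  let ?p = "extend0 (gcarrier ?R) f"
  note F = bounded_functionsD[OF f]
  have row: "row_finite ?R ?p" unfolding row_finite_def
    using F(1) by (auto simp: row_finite_def extend0_def intro: rev_finite_subset)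
  have col: "column_finite ?R ?p" unfolding column_finite_def
    using F(2) by (auto simp: column_finite_def extend0_def intro: rev_finite_subset)
  have le: "norm (lconv ?R ?p \<xi>) \<le> reduced_norm G f * norm \<xi>" for \<xi>
  proof -
    have "lconv ?R ?p \<xi> = mask (gcarrier ?R) (lconv G f \<xi>)"
    proof (rule fvec_eqI)
      fix g
      show "coord (lconv ?R ?p \<xi>) g = coord (mask (gcarrier ?R) (lconv G f \<xi>)) g"
        unfolding R.coord_lconv_conv[OF col] coord_mask coord_lconv_conv[OF F(2)]
        by (subst conv_restrict[OF D, of _ f _ "coord \<xi>"]) (auto simp: extend0_def)
    qed
    then show ?thesis using norm_mask_le norm_lconv_le[OF f] order_trans by metis
  qed
  show b: "?p \<in> bounded_functions ?R"
    by (rule R.bounded_functionsI[OF _ row col le]) (auto simp: extend0_def)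
  show "reduced_norm ?R ?p \<le> reduced_norm G f"
    by (rule R.reduced_norm_leI[OF b reduced_norm_nonneg[OF f] le])
qed

text \<open>If \<open>f\<close> lives over \<open>D\<close>, its products with vectors do too, so restriction loses no part of the operator.\<close>

lemma reduced_norm_restrict_eq:
  assumes D: "invariant G D" and f: "f \<in> bounded_functions G" "\<And>g. g \<notin> gcarrier (restrict_groupoid G D) \<Longrightarrow> f g = 0"
  shows "reduced_norm (restrict_groupoid G D) f = reduced_norm G f"
proof (rule antisym)
  interpret R: groupoid_algebraic "restrict_groupoid G D"
    by unfold_locales (rule algebraic_restrict[OF D])
  let ?R = "restrict_groupoid G D"
  have p: "extend0 (gcarrier ?R) f = f" using f(2) by (auto simp: extend0_def)
  note b = restricted_function[OF D f(1), unfolded p]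
  show "reduced_norm ?R f \<le> reduced_norm G f" by (rule b(2))
  show "reduced_norm G f \<le> reduced_norm ?R f"
  proof (rule reduced_norm_leI[OF f(1) R.reduced_norm_nonneg[OF b(1)]])
    fix \<xi>
    have "lconv G f \<xi> = lconv ?R f \<xi>"
    proof (rule fvec_eqI)
      fix g
      have "conv G f (coord \<xi>) g = 0" if "g \<notin> gcarrier ?R"
      proof (rule ccontr)
        assume "conv G f (coord \<xi>) g \<noteq> 0"
        then obtain h k where hk: "h \<in> C" "k \<in> C" "d h = r k" "g = h \<cdot> k" "f h \<noteq> 0"
          using conv_support[OF bounded_functionsD(1)[OF f(1)]] by blast
        then have "d h \<in> D" using f(2)[of h] by auto
        then have "d g \<in> D" using hk invariant_rng_iff[OF D, of k] by simp
        then show False using that hk by simp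
      qed
      then show "coord (lconv G f \<xi>) g = coord (lconv ?R f \<xi>) g"
        unfolding coord_lconv_conv[OF bounded_functionsD(2)[OF f(1)]] R.coord_lconv_conv[OF R.bounded_functionsD(2)[OF b(1)]]
        by (subst conv_restrict[OF D, of _ f _ "coord \<xi>"]) (auto simp: extend0_def)
    qed
    then show "norm (lconv G f \<xi>) \<le> reduced_norm ?R f * norm \<xi>" using R.norm_lconv_le[OF b(1)] by simp
  qed
qed

lemma involution_restrict:
  assumes D: "invariant G D" and f: "\<And>g. g \<in> C \<Longrightarrow> d g \<in> D \<Longrightarrow> f' g = f g"
  shows "involution (restrict_groupoid G D) f' = extend0 (gcarrier (restrict_groupoid G D)) (involution G f)"
  using invariant_rng_iff[OF D] f by (auto simp: involution_def extend0_def fun_eq_iff)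

text \<open>The function which convolves a vector \<open>\<xi>\<close> to \<open>f * (1 - f\<^sup>* f / M)\<^sup>k * \<xi>\<close>.\<close>

primrec damp :: "('g \<Rightarrow> complex) \<Rightarrow> real \<Rightarrow> nat \<Rightarrow> 'g \<Rightarrow> complex" where
  "damp f M 0 = f"
| "damp f M (Suc k) = (\<lambda>g. damp f M k g + complex_of_real (- 1 / M) * conv G (damp f M k) (conv G (involution G f) f) g)"

lemma adjoint_pair_lconv:
  assumes f: "f \<in> bounded_functions G" and M: "0 < M" "(reduced_norm G f)\<^sup>2 \<le> M"
  shows "adjoint_pair (lconv G f) (lconv G (involution G f)) M"
proof (rule adjoint_pair.intro)
  note F = bounded_functionsD[OF f]
  show "linear (lconv G f)" "linear (lconv G (involution G f))"
    using F involution_row_column by (simp_all add: linear_lconv)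
  show "lconv G f \<xi> \<bullet> \<eta> = \<xi> \<bullet> lconv G (involution G f) \<eta>" for \<xi> \<eta>
    by (rule lconv_involution[OF F(1,2)])
  show "(norm (lconv G f \<xi>))\<^sup>2 \<le> M * (norm \<xi>)\<^sup>2" for \<xi>
  proof -
    have "(norm (lconv G f \<xi>))\<^sup>2 \<le> (reduced_norm G f * norm \<xi>)\<^sup>2"
      by (intro power_mono norm_lconv_le f) simp
    also have "\<dots> \<le> M * (norm \<xi>)\<^sup>2"
      unfolding power_mult_distrib by (intro mult_right_mono M) simp
    finally show ?thesis .
  qed
qed (rule M)

lemma lconv_damp:
  assumes f: "f \<in> bounded_functions G" and M: "0 < M" "(reduced_norm G f)\<^sup>2 \<le> M"
  shows "damp f M k \<in> bounded_functions G"
    and "lconv G (damp f M k) \<xi> = lconv G f ((adjoint_pair.S (lconv G f) (lconv G (involution G f)) M ^^ k) \<xi>)"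
proof -
  interpret P: adjoint_pair "lconv G f" "lconv G (involution G f)" M
    by (rule adjoint_pair_lconv[OF assms])
  let ?ff = "conv G (involution G f) f"
  have ff: "?ff \<in> bounded_functions G" by (intro bounded_functions_conv bounded_functions_involution f)
  have b: "damp f M k \<in> bounded_functions G" for k
    by (induction k) (simp_all only: damp.simps f bounded_functions_add bounded_functions_conv ff)
  show "damp f M k \<in> bounded_functions G" by (rule b)
  show "lconv G (damp f M k) \<xi> = lconv G f ((P.S ^^ k) \<xi>)"
  proof (induction k arbitrary: \<xi>)
    case (Suc k)
    note bk = bounded_functionsD[OF b[of k]] and bc = bounded_functionsD[OF bounded_functions_conv[OF b[of k] ff]]
    note D = bounded_functionsD[OF f] bounded_functionsD[OF ff] bounded_functionsD[OF bounded_functions_involution[OF f]]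
    have "lconv G (damp f M (Suc k)) \<xi> = lconv G (damp f M k) \<xi>
        + cscale (complex_of_real (- 1 / M)) (lconv G (conv G (damp f M k) ?ff) \<xi>)"
      unfolding damp.simps by (rule lconv_add[OF bk(2) bc(2)])
    also have "lconv G (conv G (damp f M k) ?ff) \<xi> = lconv G (damp f M k) (lconv G (involution G f) (lconv G f \<xi>))"
      using bk D by (simp add: lconv_conv)
    also have "lconv G (damp f M k) \<xi> + cscale (complex_of_real (- 1 / M)) \<dots> = lconv G (damp f M k) (P.S \<xi>)"
    proof -
      interpret L: linear "lconv G (damp f M k)" by (rule linear_lconv[OF bk(2)])
      show ?thesis unfolding P.S_def scaleR_fvec_def[symmetric] by (simp add: L.diff L.scale)
    qed
    also have "\<dots> = lconv G f ((P.S ^^ Suc k) \<xi>)"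
      unfolding Suc by (simp add: funpow_swap1)
    finally show ?case .
  qed simp
qed

lemma damp_restrict:
  assumes D: "invariant G D" and f: "f' = extend0 (gcarrier (restrict_groupoid G D)) f"
  shows "groupoid_algebraic.damp (restrict_groupoid G D) f' M k
    = extend0 (gcarrier (restrict_groupoid G D)) (damp f M k)"
proof -
  interpret R: groupoid_algebraic "restrict_groupoid G D"
    by unfold_locales (rule algebraic_restrict[OF D])
  let ?R = "restrict_groupoid G D"
  show ?thesis
  proof (induction k)
    case (Suc k)
    have i: "involution ?R f' = extend0 (gcarrier ?R) (involution G f)"
      by (rule involution_restrict[OF D]) (simp add: f extend0_def)
    have ff: "conv ?R (involution ?R f') f' = extend0 (gcarrier ?R) (conv G (involution G f) f)"
      by (rule conv_restrict[OF D]) (simp_all add: i extend0_def, simp add: f extend0_def)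
    have "conv ?R (R.damp f' M k) (conv ?R (involution ?R f') f')
        = extend0 (gcarrier ?R) (conv G (damp f M k) (conv G (involution G f) f))"
      by (rule conv_restrict[OF D]) (simp_all add: Suc ff extend0_def)
    then show ?case by (simp add: Suc) (simp add: extend0_def fun_eq_iff)
  qed (simp add: f)
qed

text \<open>With \<open>c\<close> the norm of the restriction and \<open>N\<close> about \<open>M / (2 c\<^sup>2)\<close>, damping \<open>N\<close> times brings the norm
  on all of \<open>G\<close> down to the order of \<open>c\<close> and changes the restriction by at most \<open>c / 2\<close>.\<close>

lemma damp_exists:
  assumes D: "invariant G D" and f: "f \<in> bounded_functions G"
    and f': "f' = extend0 (gcarrier (restrict_groupoid G D)) f" and c: "c = reduced_norm (restrict_groupoid G D) f'" "0 < c"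
  obtains N M where "0 < M" "(reduced_norm G f)\<^sup>2 \<le> M" "reduced_norm G (damp f M N) \<le> 2 * c"
    "reduced_norm (restrict_groupoid G D)
      (\<lambda>g. extend0 (gcarrier (restrict_groupoid G D)) (damp f M N) g + (- 1) * f' g) \<le> c / 2"
proof -
  let ?R = "restrict_groupoid G D"
  interpret R: groupoid_algebraic ?R by unfold_locales (rule algebraic_restrict[OF D])
  have bf': "f' \<in> bounded_functions ?R" unfolding f' by (rule restricted_function(1)[OF D f])
  \<comment> \<open>the same \<open>M\<close> has to serve for \<open>f\<close> and for its restriction\<close>
  define M where "M = max ((reduced_norm G f)\<^sup>2) (c\<^sup>2)"
  have M: "0 < M" "(reduced_norm G f)\<^sup>2 \<le> M" "c\<^sup>2 \<le> M" using c(2) by (auto simp: M_def less_max_iff_disj)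
  define N where "N = nat \<lfloor>M / (2 * c\<^sup>2)\<rfloor>"
  have q: "0 \<le> M / (2 * c\<^sup>2)" using M c by simp
  have N: "real N \<le> M / (2 * c\<^sup>2)" "M / (2 * c\<^sup>2) \<le> real N + 1"
    using q unfolding N_def by linarith+
  interpret P: adjoint_pair "lconv G f" "lconv G (involution G f)" M
    by (rule adjoint_pair_lconv[OF f M(1,2)])
  have M': "(reduced_norm ?R f')\<^sup>2 \<le> M" using M(3) c(1) by simp
  interpret Q: adjoint_pair "lconv ?R f'" "lconv ?R (involution ?R f')" M
    by (rule R.adjoint_pair_lconv[OF bf' M(1) M'])
  show ?thesis
  proof (rule that[OF M(1,2)])
    show "reduced_norm G (damp f M N) \<le> 2 * c"
    proof (rule reduced_norm_leI[OF lconv_damp(1)[OF f M(1,2)]])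
      fix \<xi> :: "'g fvec"
      have "M \<le> 2 * c\<^sup>2 * (real N + 1)" using N(2) c(2) by (simp add: field_simps)
      also have "\<dots> \<le> 4 * c\<^sup>2 * real (2 * N + 1)" using c(2) by (simp add: field_simps)
      finally have "M / real (2 * N + 1) \<le> (2 * c)\<^sup>2" by (simp add: field_simps power2_eq_square)
      then have "M / real (2 * N + 1) * (norm \<xi>)\<^sup>2 \<le> (2 * c)\<^sup>2 * (norm \<xi>)\<^sup>2" by (rule mult_right_mono) simp
      with P.damped_bound[of N \<xi>] have "(norm (lconv G f ((P.S ^^ N) \<xi>)))\<^sup>2 \<le> (2 * c * norm \<xi>)\<^sup>2"
        by (simp add: power_mult_distrib)
      then have "norm (lconv G f ((P.S ^^ N) \<xi>)) \<le> 2 * c * norm \<xi>"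
        by (rule power2_le_imp_le) (use c(2) in simp)
      then show "norm (lconv G (damp f M N) \<xi>) \<le> 2 * c * norm \<xi>" by (simp add: lconv_damp(2)[OF f M(1,2)])
    qed (use c(2) in simp)
    have rd: "extend0 (gcarrier ?R) (damp f M N) = R.damp f' M N" by (rule damp_restrict[OF D f', symmetric])
    note bd = R.lconv_damp[OF bf' M(1) M', of N]
    show "reduced_norm ?R (\<lambda>g. extend0 (gcarrier ?R) (damp f M N) g + (- 1) * f' g) \<le> c / 2"
      unfolding rd
    proof (rule R.reduced_norm_leI[OF R.bounded_functions_add[OF bd(1) bf']])
      fix \<xi> :: "'g fvec"
      have "lconv ?R (\<lambda>g. R.damp f' M N g + (- 1) * f' g) \<xi> = lconv ?R (R.damp f' M N) \<xi> + cscale (- 1) (lconv ?R f' \<xi>)"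
        by (rule R.lconv_add[OF R.bounded_functionsD(2)[OF bd(1)] R.bounded_functionsD(2)[OF bf']])
      also have "\<dots> = - (lconv ?R f' \<xi> - lconv ?R (R.damp f' M N) \<xi>)"
        by (simp add: uminus_fvec_def[symmetric])
      also have "lconv ?R f' \<xi> - lconv ?R (R.damp f' M N) \<xi> = lconv ?R f' (\<xi> - (Q.S ^^ N) \<xi>)"
        unfolding bd(2) by (simp add: linear_diff[OF Q.linA])
      finally have "norm (lconv ?R (\<lambda>g. R.damp f' M N g + (- 1) * f' g) \<xi>) = norm (lconv ?R f' (\<xi> - (Q.S ^^ N) \<xi>))"
        by (simp only: norm_minus_cancel)
      also have "\<dots> \<le> real N * c ^ 3 / M * norm \<xi>"
        by (rule Q.damped_residual) (use R.norm_lconv_le[OF bf'] c in auto)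
      also have "\<dots> \<le> c / 2 * norm \<xi>"
      proof (rule mult_right_mono)
        have "real N * c ^ 3 / M \<le> M / (2 * c\<^sup>2) * c ^ 3 / M"
          using N(1) c(2) M(1) by (intro divide_right_mono mult_right_mono) auto
        also have "\<dots> = c / 2" using c(2) M(1) by (simp add: power3_eq_cube power2_eq_square)
        finally show "real N * c ^ 3 / M \<le> c / 2" .
      qed simp
      finally show "norm (lconv ?R (\<lambda>g. R.damp f' M N g + (- 1) * f' g) \<xi>) \<le> c / 2 * norm \<xi>" .
    qed (use c(2) in simp)
  qed
qed

end

lemma local_homeomorphism_subtopology:
  assumes f: "local_homeomorphism X Y f" and AB: "\<And>x. x \<in> topspace X \<Longrightarrow> f x \<in> B \<longleftrightarrow> x \<in> A"
  shows "local_homeomorphism (subtopology X A) (subtopology Y B) f"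
  unfolding local_homeomorphism_def
proof
  fix x assume "x \<in> topspace (subtopology X A)"
  then have x: "x \<in> topspace X" "x \<in> A" by auto
  obtain U V where UV: "openin X U" "x \<in> U" "openin Y V" "homeomorphic_map (subtopology X U) (subtopology Y V) f"
    using f x(1) unfolding local_homeomorphism_def by blast
  have "homeomorphic_map (subtopology (subtopology X U) A) (subtopology (subtopology Y V) B) f"
    by (rule homeomorphic_map_subtopologies_alt[OF UV(4)]) (use AB in auto)
  then have "homeomorphic_map (subtopology (subtopology X A) (U \<inter> A)) (subtopology (subtopology Y B) (V \<inter> B)) f"
    by (simp add: subtopology_subtopology Int_ac)
  moreover have "openin (subtopology X A) (U \<inter> A)" "openin (subtopology Y B) (V \<inter> B)"
    using UV by (auto simp: openin_subtopology)
  ultimately show "\<exists>U V. openin (subtopology X A) U \<and> x \<in> U \<and> openin (subtopology Y B) V \<and>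
      homeomorphic_map (subtopology (subtopology X A) U) (subtopology (subtopology Y B) V) f"
    using UV(2) x(2) by blast
qed

context etale_groupoid
begin

lemma etale_restrict:
  assumes D: "invariant G D" and oc: "openin (unit_top G) D \<or> closedin (unit_top G) D"
  shows "etale_groupoid (restrict_groupoid G D)"
proof
  let ?A = "{g \<in> C. d g \<in> D}" and ?R = "restrict_groupoid G D"
  have DU: "D \<subseteq> unit_space G" using D by (simp add: invariant_def)
  have A: "openin X ?A \<or> closedin X ?A"
  proof (cases "openin (unit_top G) D")
    case True
    then have "openin X D" by (simp add: openin_unit_top)
    then show ?thesis using openin_continuous_map_preimage[OF continuous_dm] by fastforce
  next
    case False
    then have "closedin (unit_top G) D" using oc by blast
    then have "closedin X D" using closedin_closed_subtopology[OF closedin_unit_space] by (simp add: unit_top_def)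
    then show ?thesis using closedin_continuous_map_preimage[OF continuous_dm] by fastforce
  qed
  have prod: "prod_topology (subtopology X ?A) (subtopology X ?A) = subtopology (prod_topology X X) (?A \<times> ?A)"
    by (simp add: subtopology_Times)
  have comp: "composable ?R = composable G \<inter> (?A \<times> ?A)" by (auto simp: composable_def)
  show "locally_compact_groupoid ?R"
    unfolding locally_compact_groupoid_def
  proof (intro conjI)
    show "algebraic_groupoid ?R" by (rule algebraic_restrict[OF D])
    show "locally_compact_space (gtop ?R)"
      using A lc hausdorff locally_compact_space_open_subset locally_compact_space_closed_subset
      by (simp only: restrict_groupoid_simps) blast
    show "Hausdorff_space (gtop ?R)" using hausdorff by (simp add: Hausdorff_space_subtopology)
    have "continuous_map (subtopology (prod_topology X X) (composable ?R)) X (\<lambda>(g, h). g \<cdot> h)"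
      by (rule continuous_map_from_subtopology_mono[OF continuous_mult]) (auto simp: comp)
    then show "continuous_map (subtopology (prod_topology (gtop ?R) (gtop ?R)) (composable ?R)) (gtop ?R) (\<lambda>(g, h). gmult ?R g h)"
      unfolding restrict_groupoid_simps prod subtopology_subtopology
      by (intro continuous_map_into_subtopology)
        (auto simp: comp composable_def Int_absorb1 Int_commute intro: continuous_map_from_subtopology_mono)
    show "continuous_map (gtop ?R) (gtop ?R) (ginv ?R)"
      unfolding restrict_groupoid_simps
      by (intro continuous_map_into_subtopology continuous_map_from_subtopology continuous_inv)
        (use invariant_rng_iff[OF D] in auto)
  qed
  have ut: "unit_top ?R = subtopology (unit_top G) D"
    unfolding unit_top_def[of ?R] unit_space_restrict[OF D] unit_top_def restrict_groupoid_simps subtopology_subtopology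
    by (rule arg_cong[of _ _ "subtopology X"]) (use DU in \<open>auto simp: unitD\<close>)
  have "local_homeomorphism (subtopology X ?A) (subtopology (unit_top G) D) r"
    by (rule local_homeomorphism_subtopology) (use etale invariant_rng_iff[OF D] in \<open>auto simp: etale_def\<close>)
  moreover have "local_homeomorphism (subtopology X ?A) (subtopology (unit_top G) D) d"
    by (rule local_homeomorphism_subtopology) (use etale in \<open>auto simp: etale_def\<close>)
  ultimately show "etale ?R" unfolding etale_def ut by simp
qed

end

text \<open>Below, \<open>K\<close> stands for the restriction to \<open>D\<close>, and \<open>H\<close> for the restriction to the complement of \<open>D\<close>,
  and \<open>q\<close> is the map of reduced algebras induced by restriction to \<open>K\<close>.\<close>

locale closed_invariant = etale_groupoid G for G :: "'g groupoid" +
  fixes D :: "'g set"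
  assumes closed_D: "closedin (unit_top G) D" and invariant_D: "invariant G D"
begin

definition K where "K = restrict_groupoid G D"
definition restrict :: "('g \<Rightarrow> complex) \<Rightarrow> 'g \<Rightarrow> complex" where "restrict = extend0 (gcarrier K)"

sublocale K: etale_groupoid K
  unfolding K_def by (rule etale_restrict) (use closed_D invariant_D in auto)

lemma carrier_K: "gcarrier K = {g \<in> C. d g \<in> D}"
  by (simp add: K_def)

lemma unit_space_K: "unit_space K = D"
  unfolding K_def by (rule unit_space_restrict[OF invariant_D])

lemma D_subset: "D \<subseteq> unit_space G"
  using invariant_D by (simp add: invariant_def)

lemma closedin_carrier_K: "closedin X (gcarrier K)"
proof -
  have "closedin X D"
    using closed_D closedin_closed_subtopology[OF closedin_unit_space] by (simp add: unit_top_def)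
  then show ?thesis unfolding carrier_K using closedin_continuous_map_preimage[OF continuous_dm] by fastforce
qed

lemma gtop_K: "gtop K = subtopology X (gcarrier K)"
  by (simp add: K_def)

lemma restrict_Cc:
  assumes "f \<in> Cc G"
  shows "restrict f \<in> Cc K"
proof -
  obtain L where L: "continuous_map X euclidean f" "compactin X L" "\<And>g. g \<notin> L \<Longrightarrow> f g = 0"
    using CcE[OF assms] by blast
  show ?thesis
  proof (rule K.CcI)
    show "continuous_map (gtop K) euclidean (restrict f)" unfolding gtop_K
      by (rule continuous_map_eq[OF continuous_map_from_subtopology[OF L(1)]]) (auto simp: restrict_def extend0_def)
    show "compactin (gtop K) (gcarrier K \<inter> L)" unfolding gtop_K
      using closed_Int_compactin[OF closedin_carrier_K L(2)] by (simp add: compactin_subtopology)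
    show "restrict f g = 0" if "g \<notin> gcarrier K \<inter> L" for g using that L(3) by (auto simp: restrict_def extend0_def)
  qed
qed

text \<open>Take a bump function that is 1 on the support of \<open>f\<close> and vanishes off a compact set \<open>E\<close>.  Tietze's theorem
  extends \<open>f\<close> from the part of \<open>E\<close> in \<open>K\<close>, and the bump function removes what the extension does off \<open>E\<close>.\<close>

lemma restrict_surj:
  assumes f: "f \<in> Cc K"
  obtains F where "F \<in> Cc G" "restrict F = f"
proof -
  obtain L where L: "continuous_map (gtop K) euclidean f" "compactin (gtop K) L" "\<And>g. g \<notin> L \<Longrightarrow> f g = 0"
    using K.CcE[OF f] by blast
  have LX: "compactin X L" "L \<subseteq> gcarrier K" using L(2) by (simp_all add: gtop_K compactin_subtopology)
  obtain \<phi> E where \<phi>: "continuous_map X euclideanreal \<phi>" "\<And>g. g \<in> L \<Longrightarrow> \<phi> g = 1" "compactin X E"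
    "\<And>g. g \<in> topspace X - E \<Longrightarrow> \<phi> g = 0"
  proof -
    note bump = bump_function[OF lc hausdorff LX(1) compactin_subset_topspace[OF LX(1)] openin_topspace]
    show thesis by (rule bump) (rule that; assumption)
  qed
  let ?Q = "gcarrier K \<inter> E"
  have Q: "compactin X ?Q" using closed_Int_compactin[OF closedin_carrier_K \<phi>(3)] .
  have cr: "completely_regular_space X" using lc hausdorff locally_compact_regular_imp_completely_regular_space by blast
  have fQ: "continuous_map (subtopology X ?Q) euclidean f"
    using L(1) unfolding gtop_K by (rule continuous_map_from_subtopology_mono) auto
  have re: "continuous_map (subtopology X ?Q) euclideanreal (\<lambda>g. Re (f g))"
    and im: "continuous_map (subtopology X ?Q) euclideanreal (\<lambda>g. Im (f g))"
    using fQ by (simp_all add: continuous_map_atin tendsto_Re tendsto_Im)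
  obtain a where a: "continuous_map X euclideanreal a" "\<And>g. g \<in> ?Q \<Longrightarrow> a g = Re (f g)"
    by (rule Tietze_extension_completely_regular[OF cr Q is_interval_univ _ re]) auto
  obtain b where b: "continuous_map X euclideanreal b" "\<And>g. g \<in> ?Q \<Longrightarrow> b g = Im (f g)"
    by (rule Tietze_extension_completely_regular[OF cr Q is_interval_univ _ im]) auto
  define F where "F g = (if g \<in> C then complex_of_real (\<phi> g) * (complex_of_real (a g) + \<i> * complex_of_real (b g)) else 0)" for g
  have "continuous_map X euclidean (\<lambda>g. complex_of_real (\<phi> g) * (complex_of_real (a g) + \<i> * complex_of_real (b g)))"
    by (intro continuous_map_complex_mult continuous_map_add continuous_map_complex_of_real \<phi> a b) simp
  then have cF: "continuous_map X euclidean F" by (rule continuous_map_eq) (simp add: F_def)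
  have "F \<in> Cc G"
    by (rule CcI[OF cF \<phi>(3)]) (use \<phi>(4) in \<open>auto simp: F_def\<close>)
  moreover have "restrict F g = f g" for g
  proof (cases "g \<in> gcarrier K")
    case True
    then have gC: "g \<in> C" by (simp add: carrier_K)
    show ?thesis
    proof (cases "g \<in> E")
      case gE: True
      have "complex_of_real (a g) + \<i> * complex_of_real (b g) = f g"
        using a(2) b(2) True gE by (simp add: complex_eq_iff)
      then have "F g = complex_of_real (\<phi> g) * f g" using gC by (simp add: F_def)
      also have "\<dots> = f g" using \<phi>(2)[of g] L(3)[of g] by (cases "g \<in> L") auto
      finally show ?thesis using True by (simp add: restrict_def extend0_def)
    next
      case False
      then have "\<phi> g = 0" using \<phi>(4) gC by simp
      moreover have "f g = 0" using \<phi>(2)[of g] L(3)[of g] \<open>\<phi> g = 0\<close> by auto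
      ultimately show ?thesis by (simp add: restrict_def extend0_def F_def)
    qed
  next
    case False
    then have "f g = 0" using LX L(3) by blast
    then show ?thesis using False by (simp add: restrict_def extend0_def)
  qed
  ultimately show ?thesis using that by blast
qed

lemma restrict_hom: "contractive_hom (Cc_alg G) (Cc_alg K) restrict"
proof
  show "restrict x \<in> acarrier (Cc_alg K)" if "x \<in> acarrier (Cc_alg G)" for x
    using that restrict_Cc by simp
  show "restrict (aadd (Cc_alg G) x y) = aadd (Cc_alg K) (restrict x) (restrict y)" for x y
    by (simp add: restrict_def extend0_def fun_eq_iff)
  show "restrict (ascale (Cc_alg G) c x) = ascale (Cc_alg K) c (restrict x)" for c x
    by (simp add: restrict_def extend0_def fun_eq_iff)
  show "restrict (amult (Cc_alg G) x y) = amult (Cc_alg K) (restrict x) (restrict y)" for x y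
    unfolding restrict_def alg_simps K.alg_simps unfolding K_def
    by (rule conv_restrict[OF invariant_D, symmetric]) (simp_all add: extend0_def)
  show "anorm (Cc_alg K) (restrict x) \<le> anorm (Cc_alg G) x" if "x \<in> acarrier (Cc_alg G)" for x
    using restricted_function(2)[OF invariant_D Cc_bounded_function, of x] that
    by (simp add: restrict_def K_def Cc_alg_def[of "restrict_groupoid G D"])
qed

lemma damp_Cc: "f \<in> Cc G \<Longrightarrow> damp f M k \<in> Cc G"
  by (induction k) (simp_all only: damp.simps Cc_add Cc_scale Cc_conv Cc_involution)

lemma approximate_lift:
  assumes f: "f \<in> Cc K"
  obtains F where "F \<in> Cc G" "reduced_norm G F \<le> 2 * reduced_norm K f"
    "adist (Cc_alg K) (restrict F) f \<le> reduced_norm K f / 2"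
proof (cases "reduced_norm K f = 0")
  case True
  then have f0: "f = (\<lambda>g. 0)" by (rule K.reduced_norm_eq_0[OF K.Cc_bounded_function[OF f]])
  have "restrict (\<lambda>g. 0) = (\<lambda>g. 0)" by (simp add: restrict_def extend0_def)
  then show ?thesis using f0 that[of "\<lambda>g. 0"] Cc_zero
    by (simp add: reduced_norm_zero K.reduced_norm_zero K.adist_alg)
next
  case False
  then have c: "0 < reduced_norm K f" using K.reduced_norm_nonneg[OF K.Cc_bounded_function[OF f]] by simp
  obtain F0 where F0: "F0 \<in> Cc G" "restrict F0 = f" using restrict_surj[OF f] by blast
  obtain N M where NM: "reduced_norm G (damp F0 M N) \<le> 2 * reduced_norm K f"
    "reduced_norm K (\<lambda>g. extend0 (gcarrier K) (damp F0 M N) g + (- 1) * f g) \<le> reduced_norm K f / 2"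
    by (rule damp_exists[OF invariant_D Cc_bounded_function[OF F0(1)], of f "reduced_norm K f"])
      (use c F0 in \<open>auto simp: K_def[symmetric] restrict_def\<close>)
  show ?thesis
    by (rule that[OF damp_Cc[OF F0(1)] NM(1)]) (use NM(2) in \<open>simp add: K.adist_alg restrict_def\<close>)
qed

definition q where "q = induced_map (Cc_alg G) (Cc_alg K) restrict"

sublocale q: contractive_hom "Cr G" "Cr K" q
proof -
  interpret h: contractive_hom "Cc_alg G" "Cc_alg K" restrict by (rule restrict_hom)
  show "contractive_hom (Cr G) (Cr K) q" unfolding Cr_def q_def by (rule h.contractive_hom_induced)
qed

lemma q_emb: "f \<in> Cc G \<Longrightarrow> q (alg.emb f) = K.alg.emb (restrict f)"
proof -
  interpret h: contractive_hom "Cc_alg G" "Cc_alg K" restrict by (rule restrict_hom)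
  assume "f \<in> Cc G"
  then show ?thesis unfolding q_def using h.induced_emb by simp
qed

text \<open>Approximating \<open>Y\<close> by an element of \<open>C\<^sub>c\<close> within \<open>1/8\<close> of the norm of \<open>Y\<close> leaves \<open>9/8\<close> of that norm, so the lift
  has relative norm at most \<open>9/4\<close> and relative error at most \<open>9/16 + 1/8\<close>.\<close>

sublocale q: approximate_quotient "Cr G" "Cr K" q 3 "3 / 4"
proof
  show "complete_nalg (Cr G)" unfolding Cr_def by (rule alg.complete_completion)
  fix Y assume Y: "Y \<in> acarrier (Cr K)"
  let ?n = "anorm (Cr K) Y"
  show "\<exists>x\<in>acarrier (Cr G). anorm (Cr G) x \<le> 3 * ?n \<and> adist (Cr K) (q x) Y \<le> 3 / 4 * ?n"
  proof (cases "?n = 0")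
    case True
    then have "Y = azero (Cr K)" using K.cr.norm_eq_0[OF Y] by simp
    then show ?thesis by (intro bexI[of _ "azero (Cr G)"]) simp_all
  next
    case False
    then have "0 < ?n / 8" using K.cr.norm_nonneg[OF Y] by simp
    then obtain f where f: "f \<in> Cc K" "adist (Cr K) Y (K.alg.emb f) < ?n / 8"
      using K.alg.emb_dense[of Y "?n / 8"] Y by (auto simp: Cr_def)
    have ef: "K.alg.emb f \<in> acarrier (Cr K)" using f(1) by (simp add: Cr_def)
    have nf: "anorm (Cr K) (K.alg.emb f) = reduced_norm K f" using f(1) by (simp add: Cr_def)
    have fn: "reduced_norm K f \<le> 9 / 8 * ?n" using K.cr.norm_diff_le[OF Y ef] f(2) nf by simp
    obtain F where F: "F \<in> Cc G" "reduced_norm G F \<le> 2 * reduced_norm K f"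
      "adist (Cc_alg K) (restrict F) f \<le> reduced_norm K f / 2"
      using approximate_lift[OF f(1)] by blast
    have eF: "alg.emb F \<in> acarrier (Cr G)" using F(1) by (simp add: Cr_def)
    have "anorm (Cr G) (alg.emb F) = reduced_norm G F" using F(1) by (simp add: Cr_def)
    moreover have "adist (Cr K) (q (alg.emb F)) Y
        \<le> adist (Cr K) (q (alg.emb F)) (K.alg.emb f) + adist (Cr K) (K.alg.emb f) Y"
      using eF ef Y by (intro K.cr.adist_triangle) simp_all
    moreover have "adist (Cr K) (q (alg.emb F)) (K.alg.emb f) = adist (Cc_alg K) (restrict F) f"
      using F(1) f(1) by (simp add: q_emb Cr_def restrict_Cc)
    moreover have "adist (Cr K) (K.alg.emb f) Y = adist (Cr K) Y (K.alg.emb f)"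
      by (rule K.cr.adist_commute[OF ef Y])
    ultimately show ?thesis using fn F f(2) eF K.cr.norm_nonneg[OF Y]
      by (intro bexI[of _ "alg.emb F"]) auto
  qed
qed simp_all

end


section \<open>Ideals and open invariant sets\<close>

context etale_groupoid
begin

lemma emb_sum_in_ideal:
  assumes I: "closed_ideal (Cr G) I" and T: "finite T" "\<And>x. x \<in> T \<Longrightarrow> f x \<in> Cc G \<and> alg.emb (f x) \<in> I"
  shows "alg.emb (\<lambda>g. \<Sum>x\<in>T. f x g) \<in> I"
  using T
proof (induction T rule: finite_induct)
  case empty
  then show ?case using I emb_zero_Cr unfolding closed_ideal_def by simp
next
  case (insert x T)
  have c: "f x \<in> Cc G" "(\<lambda>g. \<Sum>x\<in>T. f x g) \<in> Cc G" using insert Cc_sum[of T f] by auto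
  have "aadd (Cr G) (alg.emb (f x)) (alg.emb (\<lambda>g. \<Sum>x\<in>T. f x g)) \<in> I"
    using I insert unfolding closed_ideal_def by blast
  moreover have "aadd (Cr G) (alg.emb (f x)) (alg.emb (\<lambda>g. \<Sum>x\<in>T. f x g)) = alg.emb (\<lambda>g. f x g + (\<Sum>x\<in>T. f x g))"
    unfolding Cr_def using c by (subst alg.emb_add) simp_all
  ultimately show ?case using insert by simp
qed

text \<open>A finite sum of functions \<open>|h|\<^sup>2\<close> in the ideal is bounded below on a compact subset of the support, so
  that it can be inverted there.\<close>

lemma ideal_contains_bump:
  assumes I: "closed_ideal (Cr G) I" and P: "compactin X P" "P \<subseteq> ideal_support G I"
  obtains \<kappa> where "\<kappa> \<in> unit_functions" "alg.emb \<kappa> \<in> I" "\<And>u. u \<in> P \<Longrightarrow> \<kappa> u = 1"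
proof -
  have PU: "P \<subseteq> unit_space G" using P(2) ideal_support_subset by blast
  have "\<exists>h. h \<in> unit_functions \<and> alg.emb h \<in> I \<and> h x \<noteq> 0" if "x \<in> P" for x
    using that P(2) ideal_support_iff[OF I] by blast
  then obtain h where h: "\<And>x. x \<in> P \<Longrightarrow> h x \<in> unit_functions" "\<And>x. x \<in> P \<Longrightarrow> alg.emb (h x) \<in> I"
    "\<And>x. x \<in> P \<Longrightarrow> h x x \<noteq> 0" by metis
  have hC: "h x \<in> Cc G" "\<And>g. g \<notin> unit_space G \<Longrightarrow> h x g = 0" "continuous_map X euclidean (h x)" if "x \<in> P" for x
    using h(1)[OF that] by (auto simp: unit_functions_def Cc_def)
  \<comment> \<open>normalised to have value 2 at \<open>x\<close>, so that the sets where \<open>k x > 1\<close> cover \<open>P\<close>\<close>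
  define k where "k x g = 2 / (cmod (h x x))\<^sup>2 * (cmod (h x g))\<^sup>2" for x g
  have k0: "0 \<le> k x g" for x g by (simp add: k_def)
  have kcont: "continuous_map X euclideanreal (k x)" if "x \<in> P" for x
    unfolding k_def[abs_def]
    by (intro continuous_map_real_mult continuous_map_real_pow continuous_map_norm hC(3)[OF that]) simp
  have kC: "(\<lambda>g. complex_of_real (k x g)) \<in> Cc G \<and> alg.emb (\<lambda>g. complex_of_real (k x g)) \<in> I" if x: "x \<in> P" for x
  proof -
    let ?a = "\<lambda>g. complex_of_real (2 / (cmod (h x x))\<^sup>2) * cnj (h x g)"
    have "continuous_map X euclidean ?a"
      by (intro continuous_map_complex_mult continuous_map_cnj hC(3)[OF x]) simp
    then have aC: "?a \<in> Cc G"
      using hC(1)[OF x] unfolding Cc_iff by (metis complex_cnj_zero mult_zero_right)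
    have "conv G ?a (h x) = (\<lambda>g. complex_of_real (k x g))"
    proof
      fix g
      show "conv G ?a (h x) g = complex_of_real (k x g)"
      proof (cases "g \<in> C")
        case True
        have "conv G ?a (h x) g = ?a (r g) * h x g"
          by (rule conv_unit_left[OF _ True]) (simp add: hC(2)[OF x])
        also have "\<dots> = ?a g * h x g"
          using hC(2)[OF x, of g] by (cases "g \<in> unit_space G") (simp_all add: unitD)
        also have "\<dots> = complex_of_real (2 / (cmod (h x x))\<^sup>2) * (h x g * cnj (h x g))" by (simp only: mult_ac)
        also have "\<dots> = complex_of_real (k x g)"
          unfolding k_def complex_norm_square[symmetric] by simp
        finally show ?thesis .
      next
        case False
        then have "h x g = 0" using hC(1)[OF x] by (simp add: Cc_def)
        then show ?thesis using False by (simp add: conv_def extend0_def k_def)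
      qed
    qed
    then show ?thesis using ideal_mult_emb(1)[OF I aC hC(1)[OF x] h(2)[OF x]] Cc_conv[OF aC hC(1)[OF x]] by simp
  qed
  let ?V = "\<lambda>x. {y \<in> topspace X. k x y \<in> {1<..}}"
  have "\<exists>\<F>. finite \<F> \<and> \<F> \<subseteq> ?V ` P \<and> P \<subseteq> \<Union>\<F>"
  proof (rule compactinD[OF P(1)])
    show "openin X V" if V: "V \<in> ?V ` P" for V
    proof -
      obtain x where x: "x \<in> P" "V = ?V x" using V by blast
      show ?thesis unfolding x(2) by (rule openin_continuous_map_preimage[OF kcont[OF x(1)]]) simp
    qed
    show "P \<subseteq> \<Union>(?V ` P)"
    proof
      fix x assume x: "x \<in> P"
      then have "k x x = 2" using h(3) by (simp add: k_def)
      then show "x \<in> \<Union>(?V ` P)" using x compact_subset[OF P(1)] by (intro UN_I[of x]) auto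
    qed
  qed
  then obtain T where T: "finite T" "T \<subseteq> P" "P \<subseteq> (\<Union>x\<in>T. ?V x)"
    by (metis (no_types, lifting) finite_subset_image)
  \<comment> \<open>\<open>S\<close> exceeds 1 on \<open>P\<close>, so \<open>S / max S 1\<close> is 1 there\<close>
  define S where "S y = (\<Sum>x\<in>T. k x y)" for y
  have Scont: "continuous_map X euclideanreal S" unfolding S_def[abs_def]
    by (intro continuous_map_sum T(1)) (use kcont T(2) in auto)
  have S1: "1 < S y" if y: "y \<in> P" for y
  proof -
    obtain x where x: "x \<in> T" "1 < k x y" using T(3) y by auto
    have "k x y \<le> S y" unfolding S_def using k0 by (intro member_le_sum x T(1)) auto
    with x(2) show ?thesis by simp
  qed
  have SI: "alg.emb (\<lambda>g. complex_of_real (S g)) \<in> I" "(\<lambda>g. complex_of_real (S g)) \<in> Cc G"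
    using emb_sum_in_ideal[OF I T(1), of "\<lambda>x g. complex_of_real (k x g)"]
      Cc_sum[OF T(1), of "\<lambda>x g. complex_of_real (k x g)"] kC T(2) by (auto simp: S_def)
  obtain \<kappa> where \<kappa>: "\<kappa> \<in> unit_functions" "\<And>u. u \<in> P \<Longrightarrow> \<kappa> u = 1"
    by (rule unit_bump[OF P(1) PU openin_unit_space order_refl]) (rule that; assumption)
  let ?w = "\<lambda>g. complex_of_real (1 / max (S g) 1) * \<kappa> g"
  have "continuous_map X euclidean (\<lambda>g. complex_of_real (1 / max (S g) 1))"
    by (intro continuous_map_complex_of_real continuous_map_real_divide continuous_map_real_max Scont)
      (simp_all add: max_def)
  then have wC: "?w \<in> Cc G" using \<kappa>(1) by (intro Cc_continuous_mult) (simp_all add: unit_functions_def)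
  have w0: "?w g = 0" if "g \<notin> unit_space G" for g using that \<kappa>(1) by (simp add: unit_functions_def)
  let ?f = "conv G ?w (\<lambda>g. complex_of_real (S g))"
  have fv: "?f g = ?w (r g) * complex_of_real (S g)" if "g \<in> C" for g
    by (rule conv_unit_left[OF w0 that])
  have S0: "S g = 0" if g: "g \<notin> unit_space G" for g
    unfolding S_def by (rule sum.neutral) (use T(2) hC(2)[OF _ g] in \<open>auto simp: k_def\<close>)
  have "?f g = 0" if "g \<notin> unit_space G" for g
    using fv[of g] S0[OF that] by (cases "g \<in> C") (auto simp: conv_def extend0_def)
  then have "?f \<in> unit_functions" using Cc_conv[OF wC SI(2)] by (simp add: unit_functions_def)
  moreover have "alg.emb ?f \<in> I" by (rule ideal_mult_emb(1)[OF I wC SI(2,1)])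
  moreover have "?f u = 1" if u: "u \<in> P" for u
  proof -
    have "u \<in> C" "r u = u" using u PU by (auto simp: unitD)
    then show ?thesis using fv[of u] \<kappa>(2)[OF u] S1[OF u] by (simp add: max_def)
  qed
  ultimately show ?thesis by (rule that)
qed

lemma closure_subset_ideal:
  assumes I: "closed_ideal (Cr G) I" and S: "S \<subseteq> Cc G" "\<And>f. f \<in> S \<Longrightarrow> alg.emb f \<in> I"
  shows "alg.emb_closure S \<subseteq> I"
proof
  fix Y assume Y: "Y \<in> alg.emb_closure S"
  then have YC: "Y \<in> acarrier (Cr G)" by (simp add: alg.emb_closure_def Cr_def)
  have "\<forall>e>0. \<exists>z\<in>I. adist (Cr G) Y z < e"
    using Y S(2) unfolding alg.emb_closure_def Cr_def by blast
  then show "Y \<in> I" using I YC unfolding closed_ideal_def by blast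
qed

lemma emb_in_closure: "f \<in> S \<Longrightarrow> S \<subseteq> Cc G \<Longrightarrow> alg.emb f \<in> alg.emb_closure S"
  unfolding alg.emb_closure_def by (auto intro!: bexI[of _ f])

lemma emb_eq_0:
  assumes "f \<in> Cc G" "alg.emb f = azero (Cr G)"
  shows "f = (\<lambda>g. 0)"
proof -
  have "reduced_norm G f = anorm (Cr G) (alg.emb f)" using assms(1) by (simp add: Cr_def)
  also have "\<dots> = 0" by (simp add: assms(2))
  finally show ?thesis by (rule reduced_norm_eq_0[OF Cc_bounded_function[OF assms(1)]])
qed

lemma ideal_support_mono: "I \<subseteq> J \<Longrightarrow> ideal_support G I \<subseteq> ideal_support G J"
  by (auto simp: ideal_support_def)

end

context closed_invariant
begin

definition H where "H = restrict_groupoid G (unit_space G - D)"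

lemma open_complement: "openin X (unit_space G - D)"
proof -
  have "openin (unit_top G) (unit_space G - D)" using closed_D by (simp add: closedin_def)
  then show ?thesis by (simp add: openin_unit_top)
qed

lemma invariant_complement: "invariant G (unit_space G - D)"
  by (rule invariant_Diff[OF invariant_D])

sublocale H: etale_groupoid H
  unfolding H_def
  by (rule etale_restrict[OF invariant_complement]) (simp add: openin_unit_top open_complement)

lemma carrier_H: "gcarrier H = {g \<in> C. d g \<notin> D}"
  by (auto simp: H_def)

lemma openin_carrier_H: "openin X (gcarrier H)"
proof -
  have "gcarrier H = {g \<in> topspace X. d g \<in> unit_space G - D}" by (auto simp: H_def)
  then show ?thesis using openin_continuous_map_preimage[OF continuous_dm open_complement] by simp
qed

lemma gtop_H: "gtop H = subtopology X (gcarrier H)"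
  by (simp add: H_def)

text \<open>Extension by zero from an open set is continuous for functions of compact support there.\<close>

lemma Cc_H_iff: "f \<in> Cc H \<longleftrightarrow> f \<in> Cc G \<and> (\<exists>L. compactin X L \<and> L \<subseteq> gcarrier H \<and> (\<forall>g. g \<notin> L \<longrightarrow> f g = 0))"
proof
  assume "f \<in> Cc H"
  then obtain L where L: "continuous_map (gtop H) euclidean f" "compactin (gtop H) L" "\<And>g. g \<notin> L \<Longrightarrow> f g = 0"
    using H.CcE by blast
  have LX: "compactin X L" "L \<subseteq> gcarrier H" using L(2) by (simp_all add: gtop_H compactin_subtopology)
  have "continuous_map X euclidean f"
  proof (rule continuous_map_open_cover2)
    show "openin X (gcarrier H)" by (rule openin_carrier_H)
    show "openin X (topspace X - L)" using compact_closed[OF LX(1)] by (simp add: closedin_def)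
    show "gcarrier H \<union> (topspace X - L) = topspace X" using LX(2) by (auto simp: carrier_H)
    show "continuous_map (subtopology X (gcarrier H)) euclidean f" using L(1) by (simp add: gtop_H)
    have "continuous_map (subtopology X (topspace X - L)) euclidean (\<lambda>g. 0 :: complex)" by simp
    then show "continuous_map (subtopology X (topspace X - L)) euclidean f"
      by (rule continuous_map_eq) (use L(3) in auto)
  qed
  then have "f \<in> Cc G" using LX(1) L(3) by (rule CcI)
  then show "f \<in> Cc G \<and> (\<exists>L. compactin X L \<and> L \<subseteq> gcarrier H \<and> (\<forall>g. g \<notin> L \<longrightarrow> f g = 0))"
    using LX L(3) by blast
next
  assume "f \<in> Cc G \<and> (\<exists>L. compactin X L \<and> L \<subseteq> gcarrier H \<and> (\<forall>g. g \<notin> L \<longrightarrow> f g = 0))"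
  then obtain L where L: "f \<in> Cc G" "compactin X L" "L \<subseteq> gcarrier H" "\<And>g. g \<notin> L \<Longrightarrow> f g = 0" by blast
  show "f \<in> Cc H"
  proof (rule H.CcI)
    show "continuous_map (gtop H) euclidean f"
      using L(1) unfolding gtop_H by (simp add: Cc_def continuous_map_from_subtopology)
    show "compactin (gtop H) L" using L(2,3) by (simp add: gtop_H compactin_subtopology)
  qed (rule L(4))
qed

lemma Cc_H_subset: "Cc H \<subseteq> Cc G"
  using Cc_H_iff by blast

lemma Cc_H_outside: "f \<in> Cc H \<Longrightarrow> g \<notin> gcarrier H \<Longrightarrow> f g = 0"
  by (simp add: Cc_def)

lemma extend_H: "f \<in> Cc H \<Longrightarrow> extend0 (gcarrier H) f = f"
  using Cc_H_outside by (auto simp: extend0_def)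

lemma norm_H: "f \<in> Cc H \<Longrightarrow> reduced_norm H f = reduced_norm G f"
  using reduced_norm_restrict_eq[OF invariant_complement, of f] Cc_H_outside[of f] Cc_H_subset Cc_bounded_function
  unfolding H_def by blast

lemma conv_H:
  assumes "f1 \<in> Cc H" "f2 \<in> Cc H"
  shows "conv G f1 f2 = conv H f1 f2"
proof -
  have "conv H f1 f2 = extend0 (gcarrier H) (conv G f1 f2)"
    unfolding H_def by (rule conv_restrict[OF invariant_complement]) simp_all
  moreover have "conv G f1 f2 g = 0" if "g \<notin> gcarrier H" for g
  proof (rule ccontr)
    assume "conv G f1 f2 g \<noteq> 0"
    then obtain h k where hk: "h \<in> C" "k \<in> C" "d h = r k" "g = h \<cdot> k" "f2 k \<noteq> 0"
      using conv_support[OF bounded_functionsD(1)[OF Cc_bounded_function]] assms(1) Cc_H_subset by blast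
    then have "k \<in> gcarrier H" using Cc_H_outside[OF assms(2)] by blast
    then show False using that hk by (simp add: carrier_H)
  qed
  ultimately show ?thesis by (auto simp: extend0_def)
qed

lemma extend_hom: "contractive_hom (Cc_alg H) (Cc_alg G) (extend0 (gcarrier H))"
proof
  fix f1 f2 c assume "f1 \<in> acarrier (Cc_alg H)"
  then have f1: "f1 \<in> Cc H" by simp
  show "extend0 (gcarrier H) f1 \<in> acarrier (Cc_alg G)" using f1 Cc_H_subset by (auto simp: extend_H)
  show "extend0 (gcarrier H) (ascale (Cc_alg H) c f1) = ascale (Cc_alg G) c (extend0 (gcarrier H) f1)"
    using f1 H.Cc_scale[OF f1, of c] by (simp add: extend_H)
  show "anorm (Cc_alg G) (extend0 (gcarrier H) f1) \<le> anorm (Cc_alg H) f1"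
    using f1 by (simp add: extend_H norm_H)
  assume "f2 \<in> acarrier (Cc_alg H)"
  then have f2: "f2 \<in> Cc H" by simp
  show "extend0 (gcarrier H) (aadd (Cc_alg H) f1 f2) = aadd (Cc_alg G) (extend0 (gcarrier H) f1) (extend0 (gcarrier H) f2)"
    using f1 f2 H.Cc_add[OF f1 f2] by (simp add: extend_H)
  show "extend0 (gcarrier H) (amult (Cc_alg H) f1 f2) = amult (Cc_alg G) (extend0 (gcarrier H) f1) (extend0 (gcarrier H) f2)"
    using f1 f2 H.Cc_conv[OF f1 f2] by (simp add: extend_H conv_H)
qed

lemma Cc_H_ideal:
  assumes a: "a \<in> Cc G" and f: "f \<in> Cc H"
  shows "conv G a f \<in> Cc H" "conv G f a \<in> Cc H"
proof -
  obtain L where L: "f \<in> Cc G" "compactin X L" "L \<subseteq> gcarrier H" "\<And>g. g \<notin> L \<Longrightarrow> f g = 0"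
    using f Cc_H_iff by blast
  obtain P where P: "compactin X P" "\<And>g. g \<notin> P \<Longrightarrow> a g = 0" using CcE[OF a] by blast
  have "(\<lambda>(g, h). g \<cdot> h) ` (P \<times> L \<inter> composable G) \<subseteq> gcarrier H"
    using L(3) by (auto simp: composable_def carrier_H)
  moreover have "conv G a f g = 0" if "g \<notin> (\<lambda>(g, h). g \<cdot> h) ` (P \<times> L \<inter> composable G)" for g
    using conv_support_compact[OF Cc_bounded_function[OF a] P(2) L(4) that] .
  ultimately show "conv G a f \<in> Cc H"
    unfolding Cc_H_iff using Cc_conv[OF a L(1)] compact_product[OF P(1) L(2)] by blast
  have "(\<lambda>(g, h). g \<cdot> h) ` (L \<times> P \<inter> composable G) \<subseteq> gcarrier H"
  proof (clarsimp simp: composable_def)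
    fix h k assume hk: "h \<in> L" "k \<in> P" "h \<in> C" "k \<in> C" "d h = r k"
    then have "d k \<notin> D" using L(3) invariant_rng_iff[OF invariant_D hk(4)] by (auto simp: carrier_H)
    then show "h \<cdot> k \<in> gcarrier H" using hk by (simp add: carrier_H)
  qed
  moreover have "conv G f a g = 0" if "g \<notin> (\<lambda>(g, h). g \<cdot> h) ` (L \<times> P \<inter> composable G)" for g
    using conv_support_compact[OF Cc_bounded_function[OF L(1)] L(4) P(2) that] .
  ultimately show "conv G f a \<in> Cc H"
    unfolding Cc_H_iff using Cc_conv[OF L(1) a] compact_product[OF L(2) P(1)] by blast
qed

definition J where "J = alg.emb_closure (Cc H)"

lemma closed_ideal_J: "closed_ideal (Cr G) J"
  unfolding J_def Cr_def
  by (rule alg.closed_ideal_emb_closure) (simp_all add: Cc_H_subset H.Cc_zero H.Cc_add H.Cc_scale Cc_H_ideal)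

lemma induced_extend:
  defines "\<epsilon> \<equiv> induced_map (Cc_alg H) (Cc_alg G) (extend0 (gcarrier H))"
  shows "inj_on \<epsilon> (acarrier (Cr H))" "\<epsilon> ` acarrier (Cr H) = J"
proof -
  interpret e: contractive_hom "Cc_alg H" "Cc_alg G" "extend0 (gcarrier H)" by (rule extend_hom)
  interpret E: contractive_hom "Cr H" "Cr G" \<epsilon> unfolding Cr_def \<epsilon>_def by (rule e.contractive_hom_induced)
  have iso: "anorm (Cc_alg G) (extend0 (gcarrier H) f) = anorm (Cc_alg H) f" if "f \<in> acarrier (Cc_alg H)" for f
    using that by (simp add: extend_H norm_H)
  show "inj_on \<epsilon> (acarrier (Cr H))"
    by (rule E.isometric_inj) (unfold Cr_def \<epsilon>_def, rule e.induced_isometric[OF iso])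
  have "extend0 (gcarrier H) ` acarrier (Cc_alg H) = Cc H" using extend_H by (force simp: image_iff)
  then show "\<epsilon> ` acarrier (Cr H) = J"
    using e.induced_isometric_image[OF iso] by (simp add: Cr_def \<epsilon>_def J_def)
qed

lemma support_J_superset: "unit_space G - D \<subseteq> ideal_support G J"
proof
  fix u assume u: "u \<in> unit_space G - D"
  have cu: "compactin X {u}" and uU: "{u} \<subseteq> unit_space G - D" using u by (simp_all add: unitD)
  obtain \<kappa> where \<kappa>: "\<kappa> \<in> unit_functions" "\<And>v. v \<in> {u} \<Longrightarrow> \<kappa> v = 1"
    "\<exists>L. compactin X L \<and> L \<subseteq> unit_space G - D \<and> (\<forall>g. g \<notin> L \<longrightarrow> \<kappa> g = 0)"
    by (rule unit_bump[OF cu uU open_complement Diff_subset]) (rule that; assumption)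
  have "unit_space G - D \<subseteq> gcarrier H" by (auto simp: carrier_H unitD)
  then have "\<kappa> \<in> Cc H" unfolding Cc_H_iff using \<kappa>(1,3) unfolding unit_functions_def by blast
  then have "alg.emb \<kappa> \<in> J" unfolding J_def using Cc_H_subset by (rule emb_in_closure)
  moreover have "\<kappa> u \<noteq> 0" using \<kappa>(2) by simp
  ultimately show "u \<in> ideal_support G J" using ideal_support_iff[OF closed_ideal_J] \<kappa>(1) by blast
qed

lemma support_J: "ideal_support G J = unit_space G - D"
proof
  show "ideal_support G J \<subseteq> unit_space G - D"
  proof
    fix u assume u: "u \<in> ideal_support G J"
    then obtain f where f: "f \<in> C0_unit G" "C0_embed G f \<in> J" "f u \<noteq> 0" by (auto simp: ideal_support_def)
    have uU: "u \<in> unit_space G" using u ideal_support_subset by blast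
    have "u \<notin> D"
    proof
      assume "u \<in> D"
      then have out: "u \<notin> gcarrier H" using uU by (simp add: carrier_H unitD)
      have "0 < cmod (f u)" using f(3) by simp
      then obtain h where h: "h \<in> Cc H" "cmod (f u - h u) < cmod (f u)"
        using C0_embed_in_closure[OF f(1) Cc_H_subset f(2)[unfolded J_def]] by blast
      then show False using Cc_H_outside[OF h(1) out] by simp
    qed
    then show "u \<in> unit_space G - D" using uU by simp
  qed
qed (rule support_J_superset)

text \<open>An element \<open>f\<close> of \<open>C\<^sub>c\<close> over the complement of \<open>D\<close> is unchanged by multiplication with a function on the unit space that
  is 1 on the ranges of its support, and the ideal contains such a function.\<close>

lemma J_minimal:
  assumes I: "closed_ideal (Cr G) I" and U: "unit_space G - D \<subseteq> ideal_support G I"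
  shows "J \<subseteq> I"
  unfolding J_def
proof (rule closure_subset_ideal[OF I Cc_H_subset])
  fix f assume f: "f \<in> Cc H"
  obtain L where L: "f \<in> Cc G" "compactin X L" "L \<subseteq> gcarrier H" "\<And>g. g \<notin> L \<Longrightarrow> f g = 0"
    using f Cc_H_iff by blast
  have rL: "compactin X (r ` L)" by (rule image_compactin[OF L(2) continuous_rng])
  have "r ` L \<subseteq> unit_space G - D"
    using L(3) invariant_rng_iff[OF invariant_D] by (auto simp: carrier_H)
  then have rLs: "r ` L \<subseteq> ideal_support G I" using U by blast
  obtain \<kappa> where \<kappa>: "\<kappa> \<in> unit_functions" "alg.emb \<kappa> \<in> I" "\<And>u. u \<in> r ` L \<Longrightarrow> \<kappa> u = 1"
    by (rule ideal_contains_bump[OF I rL rLs]) (rule that; assumption)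
  have \<kappa>': "\<kappa> \<in> Cc G" "\<And>g. g \<notin> unit_space G \<Longrightarrow> \<kappa> g = 0" using \<kappa>(1) by (auto simp: unit_functions_def)
  have "conv G \<kappa> f g = f g" for g
  proof (cases "g \<in> C")
    case True
    have "conv G \<kappa> f g = \<kappa> (r g) * f g" by (rule conv_unit_left[OF \<kappa>'(2) True])
    also have "\<dots> = f g" using \<kappa>(3)[of "r g"] L(4)[of g] by (cases "g \<in> L") auto
    finally show ?thesis .
  next
    case False
    then show ?thesis using L(1) by (simp add: conv_def extend0_def Cc_def)
  qed
  then have "conv G \<kappa> f = f" by blast
  then show "alg.emb f \<in> I" using ideal_mult_emb(2)[OF I L(1) \<kappa>'(1) \<kappa>(2)] by simp
qed

definition kernel where "kernel = {Y \<in> acarrier (Cr G). q Y = azero (Cr K)}"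

lemma closed_ideal_kernel: "closed_ideal (Cr G) kernel"
  using q.closed_ideal_preimage[OF K.cr.closed_ideal_zero] by (simp add: kernel_def)

lemma J_subset_kernel: "J \<subseteq> kernel"
  unfolding J_def
proof (rule closure_subset_ideal[OF closed_ideal_kernel Cc_H_subset])
  fix f assume f: "f \<in> Cc H"
  then have fC: "f \<in> Cc G" using Cc_H_subset by blast
  have "restrict f = (\<lambda>g. 0)"
    using Cc_H_outside[OF f] by (auto simp: restrict_def extend0_def carrier_K carrier_H)
  then show "alg.emb f \<in> kernel" using fC by (simp add: kernel_def q_emb K.emb_zero_Cr) (simp add: Cr_def)
qed

lemma restrict_unit_function:
  assumes "f \<in> unit_functions"
  shows "restrict f \<in> K.unit_functions"
proof -
  have "restrict f g = 0" if "g \<notin> unit_space K" for g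
    using that assms by (auto simp: restrict_def extend0_def unit_space_K carrier_K unit_functions_def unitD(2))
      (metis unitD(2))
  then show ?thesis using assms restrict_Cc by (auto simp: K.unit_functions_def unit_functions_def)
qed

lemma support_eqI:
  assumes I: "closed_ideal (Cr G) I" and J: "J \<subseteq> I"
    and zero: "\<And>f. f \<in> unit_functions \<Longrightarrow> alg.emb f \<in> I \<Longrightarrow> restrict f = (\<lambda>g. 0)"
  shows "ideal_support G I = unit_space G - D"
proof
  show "unit_space G - D \<subseteq> ideal_support G I"
    using support_J_superset ideal_support_mono[OF J] by blast
  show "ideal_support G I \<subseteq> unit_space G - D"
  proof
    fix u assume u: "u \<in> ideal_support G I"
    then obtain f where f: "f \<in> unit_functions" "alg.emb f \<in> I" "f u \<noteq> 0" using ideal_support_iff[OF I] by blast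
    have uU: "u \<in> unit_space G" using u ideal_support_subset by blast
    have "restrict f u = 0" using zero[OF f(1,2)] by simp
    then have "u \<notin> gcarrier K" using f(3) by (auto simp: restrict_def extend0_def)
    then show "u \<in> unit_space G - D" using uU by (simp add: carrier_K unitD)
  qed
qed

lemma support_kernel: "ideal_support G kernel = unit_space G - D"
proof (rule support_eqI[OF closed_ideal_kernel J_subset_kernel])
  fix f assume f: "f \<in> unit_functions" "alg.emb f \<in> kernel"
  then have fC: "f \<in> Cc G" by (simp add: unit_functions_def)
  have "K.alg.emb (restrict f) = azero (Cr K)" using f(2) fC by (simp add: kernel_def q_emb)
  then show "restrict f = (\<lambda>g. 0)" using K.emb_eq_0[OF restrict_Cc[OF fC]] by simp
qed

text \<open>The unit space is open and closed, so an arbitrary lift can be cut down to it.\<close>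

lemma unit_function_lift:
  assumes h: "h \<in> K.unit_functions"
  obtains F where "F \<in> unit_functions" "restrict F = h"
proof -
  have hC: "h \<in> Cc K" "\<And>g. g \<notin> D \<Longrightarrow> h g = 0" using h by (auto simp: K.unit_functions_def unit_space_K)
  obtain F0 where F0: "F0 \<in> Cc G" "restrict F0 = h" using restrict_surj[OF hC(1)] by blast
  define F where "F = extend0 (unit_space G) F0"
  have Fz: "F g = 0" if "g \<notin> unit_space G" for g using that by (simp add: F_def extend0_def)
  obtain L where L: "continuous_map X euclidean F0" "compactin X L" "\<And>g. g \<notin> L \<Longrightarrow> F0 g = 0"
    using CcE[OF F0(1)] by blast
  have "continuous_map (unit_top G) euclidean F0"
    using L(1) by (simp add: unit_top_def continuous_map_from_subtopology)
  then have "continuous_map (unit_top G) euclidean F"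
    by (rule continuous_map_eq) (simp add: F_def extend0_def)
  then have "continuous_map X euclidean F" by (intro unit_function_continuous Fz)
  then have "F \<in> Cc G" using L(2) by (rule CcI) (simp add: F_def extend0_def L(3))
  then have "F \<in> unit_functions" using Fz by (simp add: unit_functions_def)
  moreover have "restrict F g = h g" for g
  proof (cases "g \<in> D")
    case True
    then show ?thesis using D_subset F0(2) by (auto simp: restrict_def extend0_def F_def)
  next
    case False
    have "restrict F g = 0"
    proof (cases "g \<in> gcarrier K \<and> g \<in> unit_space G")
      case True
      then have "g \<in> D" unfolding carrier_K by (metis mem_Collect_eq unitD(2))
      then show ?thesis using False by blast
    next
      case False
      then show ?thesis using Fz by (auto simp: restrict_def extend0_def)
    qed
    then show ?thesis using hC(2)[OF False] by simp
  qed
  ultimately show ?thesis using that by blast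
qed

text \<open>The ideal contains \<open>J\<close> and hence the kernel of \<open>q\<close>.  So its image is closed, and any lift of a function
  in the image lies in the ideal; a non-zero function on \<open>D\<close> in the image would thus give a point of \<open>D\<close> in the
  support.\<close>

lemma ideal_eq_J:
  assumes exact: "kernel = J" and int: "intersection_property K"
    and I: "closed_ideal (Cr G) I" and support: "ideal_support G I = unit_space G - D"
  shows "I = J"
proof
  show JI: "J \<subseteq> I" by (rule J_minimal[OF I]) (simp add: support)
  have ker: "{x \<in> acarrier (Cr G). q x = azero (Cr K)} \<subseteq> I" using JI exact by (simp add: kernel_def)
  have IA: "I \<subseteq> acarrier (Cr G)" using I by (simp add: closed_ideal_def)
  have qI: "closed_ideal (Cr K) (q ` I)" by (rule q.closed_ideal_image[OF I ker])
  have "q ` I = {azero (Cr K)}"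
  proof (rule ccontr)
    assume "q ` I \<noteq> {azero (Cr K)}"
    then have "q ` I \<inter> C0_embed K ` C0_unit K \<noteq> {azero (Cr K)}"
      using int qI unfolding intersection_property_def by blast
    moreover have "azero (Cr K) \<in> q ` I \<inter> C0_embed K ` C0_unit K"
      using qI K.C0_embed_zero unfolding closed_ideal_def by (metis IntI imageI)
    ultimately obtain Y where Y: "Y \<in> q ` I" "Y \<in> C0_embed K ` C0_unit K" "Y \<noteq> azero (Cr K)" by blast
    then obtain f where f: "f \<in> C0_unit K" "Y = C0_embed K f" by blast
    have "f \<noteq> (\<lambda>g. 0)" using Y(3) f(2) K.C0_embed_zero(1) by metis
    then obtain u where u: "f u \<noteq> 0" by blast
    obtain h where h: "h \<in> K.unit_functions" "K.alg.emb h \<in> q ` I" "h u \<noteq> 0"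
      using K.ideal_unit_function[OF qI f(1) _ u] Y(1) f(2) by blast
    obtain F where F: "F \<in> unit_functions" "restrict F = h" using unit_function_lift[OF h(1)] by blast
    have FC: "F \<in> Cc G" using F(1) by (simp add: unit_functions_def)
    have eF: "alg.emb F \<in> acarrier (Cr G)" using FC by (simp add: Cr_def)
    obtain x where x: "x \<in> I" "q x = q (alg.emb F)" using h(2) F(2) q_emb[OF FC] by auto
    have xA: "x \<in> acarrier (Cr G)" using x(1) IA by blast
    have "q (cr.sub (alg.emb F) x) = azero (Cr K)"
      using q.hom_sub[OF eF xA] x(2) q.closed[OF eF] by simp
    then have "cr.sub (alg.emb F) x \<in> I" using ker eF xA by auto
    then have "aadd (Cr G) (cr.sub (alg.emb F) x) x \<in> I" using I x(1) unfolding closed_ideal_def by blast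
    moreover have "aadd (Cr G) (cr.sub (alg.emb F) x) x = alg.emb F"
      using eF xA by (simp add: cr.add_assoc)
    ultimately have FI: "alg.emb F \<in> I" by simp
    have uD: "u \<in> D" using h(1,3) by (auto simp: K.unit_functions_def unit_space_K)
    have "F u \<noteq> 0" using h(3) F(2) by (auto simp: restrict_def extend0_def split: if_splits)
    then have "u \<in> ideal_support G I" using ideal_support_iff[OF I] F(1) FI by blast
    then show False using support uD by simp
  qed
  then have "I \<subseteq> kernel" using IA by (auto simp: kernel_def)
  then show "I \<subseteq> J" using exact by simp
qed

text \<open>The preimage under \<open>q\<close> of an ideal that meets \<open>C\<^sub>0(D)\<close> trivially has the same support as the kernel.\<close>

lemma intersection_property_K:
  assumes inj: "inj_on (ideal_support G) {I. closed_ideal (Cr G) I}"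
  shows "intersection_property K"
  unfolding intersection_property_def
proof (intro allI impI notI)
  fix I' assume I': "closed_ideal (Cr K) I' \<and> I' \<noteq> {azero (Cr K)}"
    and int: "I' \<inter> C0_embed K ` C0_unit K = {azero (Cr K)}"
  define I where "I = {x \<in> acarrier (Cr G). q x \<in> I'}"
  have I: "closed_ideal (Cr G) I" unfolding I_def by (rule q.closed_ideal_preimage) (use I' in blast)
  have "azero (Cr K) \<in> I'" using I' by (simp add: closed_ideal_def)
  then have "kernel \<subseteq> I" by (auto simp: kernel_def I_def)
  then have "ideal_support G I = unit_space G - D"
  proof (intro support_eqI[OF I])
    fix f assume f: "f \<in> unit_functions" "alg.emb f \<in> I"
    then have fC: "f \<in> Cc G" by (simp add: unit_functions_def)
    have rU: "restrict f \<in> K.unit_functions" by (rule restrict_unit_function[OF f(1)])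
    have "K.alg.emb (restrict f) \<in> I'" using f(2) fC by (simp add: I_def q_emb)
    then have "K.alg.emb (restrict f) \<in> I' \<inter> C0_embed K ` C0_unit K"
      using K.C0_embed_unit_function[OF rU] K.unit_functions_C0[OF rU] by (metis IntI imageI)
    then have "K.alg.emb (restrict f) = azero (Cr K)" using int by blast
    then show "restrict f = (\<lambda>g. 0)" using K.emb_eq_0[OF restrict_Cc[OF fC]] by simp
  qed (use J_subset_kernel in blast)
  then have "I = kernel" using inj_onD[OF inj, of I kernel] I closed_ideal_kernel support_kernel by simp
  moreover have "I' \<subseteq> q ` I"
  proof
    fix Y assume Y: "Y \<in> I'"
    then have "Y \<in> acarrier (Cr K)" using I' by (auto simp: closed_ideal_def)
    then obtain x where "x \<in> acarrier (Cr G)" "q x = Y" unfolding q.surjective[symmetric] by blast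
    then show "Y \<in> q ` I" using Y by (auto simp: I_def)
  qed
  ultimately have "I' \<subseteq> {azero (Cr K)}" by (auto simp: kernel_def)
  then show False using I' \<open>azero (Cr K) \<in> I'\<close> by blast
qed

lemma short_exact_iff:
  "short_exact (Cr H) (induced_map (Cc_alg H) (Cc_alg G) (extend0 (gcarrier H)))
    (Cr G) (induced_map (Cc_alg G) (Cc_alg K) (extend0 (gcarrier K))) (Cr K) \<longleftrightarrow> kernel = J"
  using induced_extend q.surjective
  unfolding short_exact_def q_def[unfolded restrict_def, symmetric] kernel_def by auto

end

theorem theorem1:
  fixes G :: "'g groupoid"
  assumes "locally_compact_groupoid G" and "etale G"
  shows "(inner_exact G \<and> residual_intersection_property G) \<longleftrightarrow>
    bij_betw (ideal_support G)
      {I. closed_ideal (Cr G) I}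
      {U. openin (unit_top G) U \<and> invariant G U}"
proof -
  interpret etale_groupoid G using assms by unfold_locales
  have closed: "closed_invariant G D" if "closedin (unit_top G) D" "invariant G D" for D
    using that by unfold_locales
  have complement: "closed_invariant G (unit_space G - U)" "unit_space G - (unit_space G - U) = U"
    if "openin (unit_top G) U" "invariant G U" for U
  proof -
    show "closed_invariant G (unit_space G - U)"
    proof (rule closed)
      show "closedin (unit_top G) (unit_space G - U)" using that(1) closedin_diff[OF closedin_topspace that(1)] by simp
      show "invariant G (unit_space G - U)" by (rule invariant_Diff[OF that(2)])
    qed
    show "unit_space G - (unit_space G - U) = U" using that(2) by (auto simp: invariant_def)
  qed
  have exact: "inner_exact G \<longleftrightarrow> (\<forall>D. closedin (unit_top G) D \<and> invariant G D \<longrightarrow> closed_invariant.kernel G D = closed_invariant.J G D)"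
    unfolding inner_exact_def Let_def
    using closed_invariant.short_exact_iff[OF closed] closed_invariant.H_def[OF closed] closed_invariant.K_def[OF closed]
    by metis
  show ?thesis
  proof
    assume L: "inner_exact G \<and> residual_intersection_property G"
    have unique: "I = closed_invariant.J G (unit_space G - U)"
      if "closed_ideal (Cr G) I" "ideal_support G I = U" "openin (unit_top G) U" "invariant G U" for I U
    proof -
      interpret closed_invariant G "unit_space G - U" by (rule complement(1)[OF that(3,4)])
      show ?thesis
      proof (rule ideal_eq_J[OF _ _ that(1)])
        show "kernel = J" using L exact closed_D invariant_D by blast
        show "intersection_property K"
          using L closed_D invariant_D unfolding residual_intersection_property_def K_def by blast
        show "ideal_support G I = unit_space G - (unit_space G - U)" using that complement(2) by simp
      qed
    qed
    have range: "openin (unit_top G) (ideal_support G I) \<and> invariant G (ideal_support G I)"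
      if "closed_ideal (Cr G) I" for I
      using ideal_support_open[OF that] ideal_support_subset ideal_support_invariant[OF that]
      by (simp add: openin_unit_top)
    show "bij_betw (ideal_support G) {I. closed_ideal (Cr G) I} {U. openin (unit_top G) U \<and> invariant G U}"
      unfolding bij_betw_def
    proof (intro conjI)
      show "inj_on (ideal_support G) {I. closed_ideal (Cr G) I}"
      proof (rule inj_onI)
        fix I I' assume II: "I \<in> {I. closed_ideal (Cr G) I}" "I' \<in> {I. closed_ideal (Cr G) I}"
          "ideal_support G I = ideal_support G I'"
        then show "I = I'" using unique[OF _ refl] range by (metis mem_Collect_eq)
      qed
      show "ideal_support G ` {I. closed_ideal (Cr G) I} = {U. openin (unit_top G) U \<and> invariant G U}"
      proof (intro equalityI subsetI)
      fix U assume "U \<in> ideal_support G ` {I. closed_ideal (Cr G) I}"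
      then show "U \<in> {U. openin (unit_top G) U \<and> invariant G U}" using range by blast
    next
      fix U assume "U \<in> {U. openin (unit_top G) U \<and> invariant G U}"
      then have U: "openin (unit_top G) U" "invariant G U" by auto
      interpret closed_invariant G "unit_space G - U" by (rule complement(1)[OF U])
      have "ideal_support G J = U" using support_J complement(2)[OF U] by simp
      then show "U \<in> ideal_support G ` {I. closed_ideal (Cr G) I}" using closed_ideal_J by blast
      qed
    qed
  next
    assume "bij_betw (ideal_support G) {I. closed_ideal (Cr G) I} {U. openin (unit_top G) U \<and> invariant G U}"
    then have inj: "inj_on (ideal_support G) {I. closed_ideal (Cr G) I}" by (rule bij_betw_imp_inj_on)
    show "inner_exact G \<and> residual_intersection_property G"
    proof
      show "inner_exact G" unfolding exact
      proof (intro allI impI)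
        fix D assume "closedin (unit_top G) D \<and> invariant G D"
        then interpret closed_invariant G D using closed by blast
        show "kernel = J"
          using inj_onD[OF inj, of kernel J] closed_ideal_kernel closed_ideal_J support_kernel support_J by simp
      qed
      show "residual_intersection_property G" unfolding residual_intersection_property_def
      proof (intro allI impI)
        fix D assume "closedin (unit_top G) D \<and> invariant G D"
        then interpret closed_invariant G D using closed by blast
        show "intersection_property (restrict_groupoid G D)"
          using intersection_property_K[OF inj] by (simp add: K_def)
      qed
    qed
  qed
qed


end
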